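(* Let $V$ be a vertex operator algebra over $\mathbb{C}$, let $n$ be a nonnegative integer and let $W$ be a weak $V$-module. For homogeneous $v\in V$ and $w\in W$ set $$v*_n w=\sum_{m=0}^{n}\binom{-n-1}{m}\mathrm{Res}_x\, x^{-n-m-1}(1+x)^{\mathrm{wt}\,v+n}Y(v,x)w,$$ $$w*_n v=\sum_{m=0}^{n}\binom{-n-1}{m}(-1)^{n-m}\mathrm{Res}_x\, x^{-n-m-1}(1+x)^{\mathrm{wt}\,v+m-1}Y(v,x)w,$$ extended by linearity to all $v\in V$. Then the subspace $O_n(W)$ of $W$ is stable under these left and right actions of $V$ on $W$ (that is, $v*_nO_n(W)\subset O_n(W)$ and $O_n(W)*_nv\subset O_n(W)$ for all $v\in V$), and the quotient space $A_n(W)=W/O_n(W)$ is an $A_n(V)$-bimodule, namely the quotient of the $A_n(V)$-bimodule $A'_n(W)=W/O'_n(W)$ modulo $O_n(W)/O'_n(W)$.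
   Context: **Vertex operator algebra notation.** $V=(V,Y,\mathbf 1,\omega)$ is a vertex operator algebra over $\mathbb{C}$, with $Y(v,x)=\sum_{m\in\mathbb{Z}}v_m x^{-m-1}$, $Y(\omega,x)=\sum_{m\in\mathbb{Z}}L(m)x^{-m-2}$; $\mathrm{wt}\,v$ is the weight ($L(0)$-eigenvalue) of a homogeneous vector $v$. A weak $V$-module is a vector space $W$ with a linear map $v\mapsto Y_W(v,x)\in\mathrm{Hom}(W,W((x)))$ (also written $Y$) satisfying all the axioms of a module except that no grading is required; $L(m)$ also denotes the coefficients of $Y_W(\omega,x)$ acting on $W$. $\mathrm{Res}_x$ is the coefficient of $x^{-1}$, and $(1+x)^k$, $k\in\mathbb{Z}$, is expanded in nonnegative powers of $x$. **$O'_n(W)$ and $O_n(W)$.** $O'_n(W)$ is the linear span of the elements $\mathrm{Res}_x x^{-2n-2}(1+x)^{\mathrm{wt}\,v+n}Y(v,x)w$ for $w\in W$ and homogeneous $v\in V$, and $O_n(W)=O'_n(W)+(L(-1)+L(0))W$. **$A_n(V)$.** $O_n(V)$ is the linear span in $V$ of the elements $(L(-1)+L(0))v$ and $\mathrm{Res}_x\frac{(1+x)^{\mathrm{wt}\,u+n}}{x^{2n+2}}Y(u,x)v$ for homogeneous $u,v\in V$. For homogeneous $u$ and $v\in V$, $u*_nv=\sum_{m=0}^n\binom{-n-1}{m}\mathrm{Res}_x\frac{(1+x)^{\mathrm{wt}\,u+n}}{x^{n+m+1}}Y(u,x)v$, extended linearly. It is known that $A_n(V)=V/O_n(V)$ is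 an associative algebra under $*_n$ with identity $\mathbf 1+O_n(V)$. **Bimodule $A'_n(W)$.** The left and right actions displayed in the claim descend to an $A_n(V)$-bimodule structure on $A'_n(W)=W/O'_n(W)$; this is the bimodule structure on $A'_n(W)$ referred to. *)

theory Defs
  imports
    "HOL-Computational_Algebra.Formal_Laurent_Series"
    "HOL-Library.Groups_Big_Fun"
    "HOL-Library.Set_Algebras"
    "HOL-Algebra.AbelCoset"
    "HOL-Algebra.Module"
    "HOL-Algebra.Algebraic_Closure_Type"
begin

unbundle fps_syntax

section \<open>Vertex operator algebras and weak modules\<close>

text \<open>
  The underlying vector spaces are whole types.  A vertex operator map sends \<open>v\<close> and \<open>w\<close> to the
  formal Laurent series \<open>Y(v,x)w\<close>; that only finitely many negative powers of \<open>x\<close> occur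
  is part of the type.
\<close>

record (overloaded) 'v vertex_data =
  vscale :: "complex \<Rightarrow> 'v \<Rightarrow> 'v"
  vertex_op :: "'v \<Rightarrow> 'v \<Rightarrow> ('v::ab_group_add) fls"
  vacuum :: 'v
  conformal :: 'v

record (overloaded) ('v, 'w) module_data =
  mscale :: "complex \<Rightarrow> 'w \<Rightarrow> 'w"
  mvertex_op :: "'v \<Rightarrow> 'w \<Rightarrow> ('w::ab_group_add) fls"

definition adjoint :: "('v::ab_group_add) vertex_data \<Rightarrow> ('v, 'v) module_data"
  where "adjoint V = \<lparr>mscale = vscale V, mvertex_op = vertex_op V\<rparr>"

text \<open>\<open>Y(v,x) = \<Sum>\<^sub>m v\<^sub>m x\<^sup>-\<^sup>m\<^sup>-\<^sup>1\<close> and \<open>Y(\<omega>,x) = \<Sum>\<^sub>m L(m) x\<^sup>-\<^sup>m\<^sup>-\<^sup>2\<close>, so \<open>L(m) = \<omega>\<^sub>m\<^sub>+\<^sub>1\<close>.\<close>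

definition mode :: "('v, 'w::ab_group_add) module_data \<Rightarrow> 'v \<Rightarrow> int \<Rightarrow> 'w \<Rightarrow> 'w"
  where "mode W v m w = mvertex_op W v w $$ (- m - 1)"

definition virasoro_op ::
    "('v::ab_group_add) vertex_data \<Rightarrow> ('v, 'w::ab_group_add) module_data \<Rightarrow> int \<Rightarrow> 'w \<Rightarrow> 'w"
  where "virasoro_op V W m w = mode W (conformal V) (m + 1) w"

text \<open>
  The Jacobi identity
  \<open>x\<^sub>0\<^sup>-\<^sup>1 \<delta>((x\<^sub>1 - x\<^sub>2)/x\<^sub>0) Y(u,x\<^sub>1) Y(v,x\<^sub>2) w - x\<^sub>0\<^sup>-\<^sup>1 \<delta>((x\<^sub>2 - x\<^sub>1)/(-x\<^sub>0)) Y(v,x\<^sub>2) Y(u,x\<^sub>1) w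
    = x\<^sub>2\<^sup>-\<^sup>1 \<delta>((x\<^sub>1 - x\<^sub>0)/x\<^sub>2) Y(Y(u,x\<^sub>0)v,x\<^sub>2) w\<close>,
  read off at \<open>x\<^sub>0\<^sup>-\<^sup>l\<^sup>-\<^sup>1 x\<^sub>1\<^sup>-\<^sup>m\<^sup>-\<^sup>1 x\<^sub>2\<^sup>-\<^sup>n\<^sup>-\<^sup>1\<close> for all integers \<open>l\<close>, \<open>m\<close>, \<open>n\<close>.  Each sum over \<open>i\<close> has
  finite support.
\<close>

definition jacobi_identity ::
    "('v::ab_group_add) vertex_data \<Rightarrow> ('v, 'w::ab_group_add) module_data \<Rightarrow> bool"
  where "jacobi_identity V W \<longleftrightarrow>
    (\<forall>u v w. \<forall>l m n :: int.
      Sum_any (\<lambda>i::nat. mscale W ((- 1) ^ i * (of_int l gchoose i))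
          (mode W u (m + l - int i) (mode W v (n + int i) w)
           - mscale W ((- 1) powi l) (mode W v (n + l - int i) (mode W u (m + int i) w))))
      = Sum_any (\<lambda>i::nat. mscale W (of_int m gchoose i)
          (mode W (mode (adjoint V) u (l + int i) v) (m + n - int i) w)))"

definition weight_space :: "('v::ab_group_add) vertex_data \<Rightarrow> int \<Rightarrow> 'v set"
  where "weight_space V k = {v. virasoro_op V (adjoint V) 0 v = vscale V (of_int k) v}"

definition weight_decomposition ::
    "('v::ab_group_add) vertex_data \<Rightarrow> 'v \<Rightarrow> (int \<Rightarrow> 'v) \<Rightarrow> bool"
  where "weight_decomposition V v f \<longleftrightarrow>
    (\<forall>k. f k \<in> weight_space V k) \<and> finite {k. f k \<noteq> 0} \<and> Sum_any f = v"

definition weight_component :: "('v::ab_group_add) vertex_data \<Rightarrow> int \<Rightarrow> 'v \<Rightarrow> 'v"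
  where "weight_component V k v = (THE f. weight_decomposition V v f) k"

locale vertex_operator_algebra = vector_space "vscale V"
  for V :: "('v::ab_group_add) vertex_data" +
  assumes vertex_op_linear_left:
      "Vector_Spaces.linear (vscale V) (vscale V) (\<lambda>u. mode (adjoint V) u m v)"
    and vertex_op_linear_right:
      "Vector_Spaces.linear (vscale V) (vscale V) (\<lambda>v. mode (adjoint V) u m v)"
    and vacuum_property: "mode (adjoint V) (vacuum V) m v = (if m = - 1 then v else 0)"
    and creation_property: "m \<ge> 0 \<Longrightarrow> mode (adjoint V) v m (vacuum V) = 0"
      "mode (adjoint V) v (- 1) (vacuum V) = v"
    and jacobi: "jacobi_identity V (adjoint V)"
    and virasoro_relations:
      "\<exists>c::complex. \<forall>l m v.
        virasoro_op V (adjoint V) l (virasoro_op V (adjoint V) m v)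
          - virasoro_op V (adjoint V) m (virasoro_op V (adjoint V) l v)
        = vscale V (of_int (l - m)) (virasoro_op V (adjoint V) (l + m) v)
          + vscale V (if l + m = 0 then of_int (l ^ 3 - l) / 12 * c else 0) v"
    and derivative_property:
      "mode (adjoint V) (virasoro_op V (adjoint V) (- 1) u) m v
        = vscale V (- of_int m) (mode (adjoint V) u (m - 1) v)"
    and weight_direct_sum: "\<exists>!f. weight_decomposition V v f"
    and weight_space_finite_dim: "\<exists>B. finite B \<and> weight_space V k \<subseteq> span B"
    and weight_bounded_below: "\<exists>N. \<forall>k<N. weight_space V k = {0}"

text \<open>
  The commutation relations of the operators \<open>L(m)\<close> on \<open>W\<close> and the \<open>L(-1)\<close>-derivative property
  follow from the axioms below.
\<close>

locale weak_module = V: vertex_operator_algebra V + W: vector_space "mscale W"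
  for V :: "('v::ab_group_add) vertex_data"
    and W :: "('v, 'w::ab_group_add) module_data" +
  assumes mvertex_op_linear_left:
      "Vector_Spaces.linear (vscale V) (mscale W) (\<lambda>v. mode W v m w)"
    and mvertex_op_linear_right:
      "Vector_Spaces.linear (mscale W) (mscale W) (\<lambda>w. mode W v m w)"
    and mvacuum_property: "mode W (vacuum V) m w = (if m = - 1 then w else 0)"
    and mjacobi: "jacobi_identity V W"


section \<open>The subspaces \<open>O'\<^sub>n(W)\<close>, \<open>O\<^sub>n(W)\<close>, \<open>O\<^sub>n(V)\<close> and the actions\<close>

text \<open>\<open>x\<^sup>a (1 + x)\<^sup>k\<close>, expanded in nonnegative powers of \<open>x\<close> after the factor \<open>x\<^sup>a\<close>\<close>

definition xpow_binomial :: "int \<Rightarrow> int \<Rightarrow> complex fls"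
  where "xpow_binomial a k = fls_X_intpow a * fps_to_fls (fps_binomial (of_int k))"

text \<open>\<open>Res\<^sub>x p(x) f(x)\<close> for \<open>p \<in> \<complex>((x))\<close> and \<open>f \<in> W((x))\<close>\<close>

definition res_mult :: "(complex \<Rightarrow> 'w \<Rightarrow> 'w) \<Rightarrow> complex fls \<Rightarrow> ('w::ab_group_add) fls \<Rightarrow> 'w"
  where "res_mult s p f = Sum_any (\<lambda>i::int. s (p $$ i) (f $$ (- 1 - i)))"

definition O'_generators ::
    "('v::ab_group_add) vertex_data \<Rightarrow> ('v, 'w::ab_group_add) module_data \<Rightarrow> nat \<Rightarrow> 'w set"
  where "O'_generators V W n =
    {res_mult (mscale W) (xpow_binomial (- 2 * int n - 2) (k + int n)) (mvertex_op W v w)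
      | k v w. v \<in> weight_space V k}"

definition O' ::
    "('v::ab_group_add) vertex_data \<Rightarrow> ('v, 'w::ab_group_add) module_data \<Rightarrow> nat \<Rightarrow> 'w set"
  where "O' V W n = Modules.module.span (mscale W) (O'_generators V W n)"

definition O_mod ::
    "('v::ab_group_add) vertex_data \<Rightarrow> ('v, 'w::ab_group_add) module_data \<Rightarrow> nat \<Rightarrow> 'w set"
  where "O_mod V W n = O' V W n + range (\<lambda>w. virasoro_op V W (- 1) w + virasoro_op V W 0 w)"

definition O_alg :: "('v::ab_group_add) vertex_data \<Rightarrow> nat \<Rightarrow> 'v set"
  where "O_alg V n = Modules.module.span (vscale V)
    (range (\<lambda>v. virasoro_op V (adjoint V) (- 1) v + virasoro_op V (adjoint V) 0 v)
     \<union> O'_generators V (adjoint V) n)"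

text \<open>
  In \<open>left_hom\<close> and \<open>right_hom\<close> the argument \<open>k\<close> is the weight of \<open>v\<close>; \<open>left_mult\<close> and
  \<open>right_mult\<close> are the linear extensions to arbitrary \<open>v\<close>.
\<close>

definition left_hom ::
    "('v, 'w::ab_group_add) module_data \<Rightarrow> nat \<Rightarrow> int \<Rightarrow> 'v \<Rightarrow> 'w \<Rightarrow> 'w"
  where "left_hom W n k v w =
    (\<Sum>m=0..n. mscale W ((- of_nat n - 1) gchoose m)
      (res_mult (mscale W) (xpow_binomial (- int n - int m - 1) (k + int n)) (mvertex_op W v w)))"

definition right_hom ::
    "('v, 'w::ab_group_add) module_data \<Rightarrow> nat \<Rightarrow> int \<Rightarrow> 'v \<Rightarrow> 'w \<Rightarrow> 'w"
  where "right_hom W n k v w =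
    (\<Sum>m=0..n. mscale W (((- of_nat n - 1) gchoose m) * (- 1) ^ (n - m))
      (res_mult (mscale W) (xpow_binomial (- int n - int m - 1) (k + int m - 1)) (mvertex_op W v w)))"

definition left_mult ::
    "('v::ab_group_add) vertex_data \<Rightarrow> ('v, 'w::ab_group_add) module_data \<Rightarrow> nat \<Rightarrow> 'v \<Rightarrow> 'w \<Rightarrow> 'w"
  where "left_mult V W n v w = Sum_any (\<lambda>k. left_hom W n k (weight_component V k v) w)"

definition right_mult ::
    "('v::ab_group_add) vertex_data \<Rightarrow> ('v, 'w::ab_group_add) module_data \<Rightarrow> nat \<Rightarrow> 'w \<Rightarrow> 'v \<Rightarrow> 'w"
  where "right_mult V W n w v = Sum_any (\<lambda>k. right_hom W n k (weight_component V k v) w)"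


section \<open>Bimodules over an associative algebra\<close>

text \<open>As for \<^term>\<open>module\<close> records, the fields \<open>mult\<close> and \<open>one\<close> of a bimodule are junk.\<close>

record ('s, 'a, 'b) bimodule = "('s, 'b) module" +
  lact :: "'a \<Rightarrow> 'b \<Rightarrow> 'b"
  ract :: "'b \<Rightarrow> 'a \<Rightarrow> 'b"

locale assoc_algebra = Module.module R A + ring A
  for R :: "('s, 'r) ring_scheme" and A :: "('s, 'a, 'p) module_scheme" +
  assumes smult_mult_left:
      "\<lbrakk>c \<in> carrier R; a \<in> carrier A; b \<in> carrier A\<rbrakk> \<Longrightarrow>
        (c \<odot>\<^bsub>A\<^esub> a) \<otimes>\<^bsub>A\<^esub> b = c \<odot>\<^bsub>A\<^esub> (a \<otimes>\<^bsub>A\<^esub> b)"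
    and smult_mult_right:
      "\<lbrakk>c \<in> carrier R; a \<in> carrier A; b \<in> carrier A\<rbrakk> \<Longrightarrow>
        a \<otimes>\<^bsub>A\<^esub> (c \<odot>\<^bsub>A\<^esub> b) = c \<odot>\<^bsub>A\<^esub> (a \<otimes>\<^bsub>A\<^esub> b)"

locale bimodule = A: assoc_algebra R A + M: Module.module R M
  for R :: "('s, 'r) ring_scheme" and A :: "('s, 'a, 'p) module_scheme"
    and M :: "('s, 'a, 'b, 'q) bimodule_scheme" +
  assumes lact_closed:
      "\<lbrakk>a \<in> carrier A; x \<in> carrier M\<rbrakk> \<Longrightarrow> lact M a x \<in> carrier M"
    and lact_add_left:
      "\<lbrakk>a \<in> carrier A; b \<in> carrier A; x \<in> carrier M\<rbrakk> \<Longrightarrow>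
        lact M (a \<oplus>\<^bsub>A\<^esub> b) x = lact M a x \<oplus>\<^bsub>M\<^esub> lact M b x"
    and lact_add_right:
      "\<lbrakk>a \<in> carrier A; x \<in> carrier M; y \<in> carrier M\<rbrakk> \<Longrightarrow>
        lact M a (x \<oplus>\<^bsub>M\<^esub> y) = lact M a x \<oplus>\<^bsub>M\<^esub> lact M a y"
    and lact_smult_left:
      "\<lbrakk>c \<in> carrier R; a \<in> carrier A; x \<in> carrier M\<rbrakk> \<Longrightarrow>
        lact M (c \<odot>\<^bsub>A\<^esub> a) x = c \<odot>\<^bsub>M\<^esub> lact M a x"
    and lact_smult_right:
      "\<lbrakk>c \<in> carrier R; a \<in> carrier A; x \<in> carrier M\<rbrakk> \<Longrightarrow>
        lact M a (c \<odot>\<^bsub>M\<^esub> x) = c \<odot>\<^bsub>M\<^esub> lact M a x"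
    and lact_mult:
      "\<lbrakk>a \<in> carrier A; b \<in> carrier A; x \<in> carrier M\<rbrakk> \<Longrightarrow>
        lact M (a \<otimes>\<^bsub>A\<^esub> b) x = lact M a (lact M b x)"
    and lact_one: "x \<in> carrier M \<Longrightarrow> lact M \<one>\<^bsub>A\<^esub> x = x"
    and ract_closed:
      "\<lbrakk>a \<in> carrier A; x \<in> carrier M\<rbrakk> \<Longrightarrow> ract M x a \<in> carrier M"
    and ract_add_left:
      "\<lbrakk>a \<in> carrier A; x \<in> carrier M; y \<in> carrier M\<rbrakk> \<Longrightarrow>
        ract M (x \<oplus>\<^bsub>M\<^esub> y) a = ract M x a \<oplus>\<^bsub>M\<^esub> ract M y a"
    and ract_add_right:
      "\<lbrakk>a \<in> carrier A; b \<in> carrier A; x \<in> carrier M\<rbrakk> \<Longrightarrow>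
        ract M x (a \<oplus>\<^bsub>A\<^esub> b) = ract M x a \<oplus>\<^bsub>M\<^esub> ract M x b"
    and ract_smult_left:
      "\<lbrakk>c \<in> carrier R; a \<in> carrier A; x \<in> carrier M\<rbrakk> \<Longrightarrow>
        ract M (c \<odot>\<^bsub>M\<^esub> x) a = c \<odot>\<^bsub>M\<^esub> ract M x a"
    and ract_smult_right:
      "\<lbrakk>c \<in> carrier R; a \<in> carrier A; x \<in> carrier M\<rbrakk> \<Longrightarrow>
        ract M x (c \<odot>\<^bsub>A\<^esub> a) = c \<odot>\<^bsub>M\<^esub> ract M x a"
    and ract_mult:
      "\<lbrakk>a \<in> carrier A; b \<in> carrier A; x \<in> carrier M\<rbrakk> \<Longrightarrow>
        ract M x (a \<otimes>\<^bsub>A\<^esub> b) = ract M (ract M x a) b"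
    and ract_one: "x \<in> carrier M \<Longrightarrow> ract M x \<one>\<^bsub>A\<^esub> = x"
    and lact_ract:
      "\<lbrakk>a \<in> carrier A; b \<in> carrier A; x \<in> carrier M\<rbrakk> \<Longrightarrow>
        ract M (lact M a x) b = lact M a (ract M x b)"

definition sub_bimodule ::
    "('s, 'r) ring_scheme \<Rightarrow> ('s, 'a, 'p) module_scheme \<Rightarrow> ('s, 'a, 'b, 'q) bimodule_scheme \<Rightarrow> 'b set \<Rightarrow> bool"
  where "sub_bimodule R A M N \<longleftrightarrow> submodule N R M \<and>
    (\<forall>a\<in>carrier A. \<forall>x\<in>N. lact M a x \<in> N \<and> ract M x a \<in> N)"

text \<open>
  As in \<^const>\<open>FactRing\<close>, an operation on cosets is the union of the cosets obtained from all
  representatives; it is a single coset exactly if the operation is well defined.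
\<close>

definition bimodule_quotient ::
    "('s, 'a, 'b, 'q) bimodule_scheme \<Rightarrow> 'b set \<Rightarrow> ('s, 'a, 'b set) bimodule"
  where "bimodule_quotient M N =
    \<lparr>carrier = a_rcosets\<^bsub>M\<^esub> N, monoid.mult = undefined, monoid.one = undefined,
     ring.zero = N, ring.add = set_add M,
     module.smult = (\<lambda>c P. \<Union>x\<in>P. N +>\<^bsub>M\<^esub> (c \<odot>\<^bsub>M\<^esub> x)),
     lact = (\<lambda>a P. \<Union>x\<in>P. N +>\<^bsub>M\<^esub> lact M a x),
     ract = (\<lambda>P a. \<Union>x\<in>P. N +>\<^bsub>M\<^esub> ract M x a)\<rparr>"

definition bimodule_iso ::
    "('s, 'r) ring_scheme \<Rightarrow> ('s, 'a, 'p) module_scheme \<Rightarrow> ('s, 'a, 'b, 'q) bimodule_scheme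
      \<Rightarrow> ('s, 'a, 'c, 't) bimodule_scheme \<Rightarrow> ('b \<Rightarrow> 'c) set"
  where "bimodule_iso R A M N = {h. bij_betw h (carrier M) (carrier N) \<and>
    (\<forall>x\<in>carrier M. \<forall>y\<in>carrier M. h (x \<oplus>\<^bsub>M\<^esub> y) = h x \<oplus>\<^bsub>N\<^esub> h y) \<and>
    (\<forall>c\<in>carrier R. \<forall>x\<in>carrier M. h (c \<odot>\<^bsub>M\<^esub> x) = c \<odot>\<^bsub>N\<^esub> h x) \<and>
    (\<forall>a\<in>carrier A. \<forall>x\<in>carrier M.
      h (lact M a x) = lact N a (h x) \<and> h (ract M x a) = ract N (h x) a)}"


section \<open>\<open>A\<^sub>n(V)\<close>, \<open>A'\<^sub>n(W)\<close> and \<open>A\<^sub>n(W)\<close>\<close>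

text \<open>
  \<open>Zhu_algebra V n\<close> is \<open>A\<^sub>n(V)\<close>, with the product \<open>u *\<^sub>n v\<close>, which is the left action of \<open>V\<close> on
  its adjoint module.
\<close>

definition Zhu_algebra :: "('v::ab_group_add) vertex_data \<Rightarrow> nat \<Rightarrow> (complex, 'v set) module"
  where "Zhu_algebra V n =
    \<lparr>carrier = range (\<lambda>v. v +o O_alg V n),
     monoid.mult = (\<lambda>P Q. \<Union>u\<in>P. \<Union>v\<in>Q. left_mult V (adjoint V) n u v +o O_alg V n),
     monoid.one = vacuum V +o O_alg V n,
     ring.zero = O_alg V n,
     ring.add = (+),
     module.smult = (\<lambda>c P. \<Union>v\<in>P. vscale V c v +o O_alg V n)\<rparr>"

text \<open>\<open>W/S\<close> with the operations of \<open>A\<^sub>n(V)\<close> induced by the left and right actions of \<open>V\<close> on \<open>W\<close>\<close>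

definition quotient_structure ::
    "('v::ab_group_add) vertex_data \<Rightarrow> ('v, 'w::ab_group_add) module_data \<Rightarrow> nat \<Rightarrow> 'w set
      \<Rightarrow> (complex, 'v set, 'w set) bimodule"
  where "quotient_structure V W n S =
    \<lparr>carrier = range (\<lambda>w. w +o S), monoid.mult = undefined, monoid.one = undefined,
     ring.zero = S,
     ring.add = (+),
     module.smult = (\<lambda>c P. \<Union>w\<in>P. mscale W c w +o S),
     lact = (\<lambda>A P. \<Union>v\<in>A. \<Union>w\<in>P. left_mult V W n v w +o S),
     ract = (\<lambda>P A. \<Union>w\<in>P. \<Union>v\<in>A. right_mult V W n w v +o S)\<rparr>"

definition A'_mod ::
    "('v::ab_group_add) vertex_data \<Rightarrow> ('v, 'w::ab_group_add) module_data \<Rightarrow> nat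
      \<Rightarrow> (complex, 'v set, 'w set) bimodule"
  where "A'_mod V W n = quotient_structure V W n (O' V W n)"

definition A_mod ::
    "('v::ab_group_add) vertex_data \<Rightarrow> ('v, 'w::ab_group_add) module_data \<Rightarrow> nat
      \<Rightarrow> (complex, 'v set, 'w set) bimodule"
  where "A_mod V W n = quotient_structure V W n (O_mod V W n)"

text \<open>\<open>O\<^sub>n(W)/O'\<^sub>n(W)\<close> as a subset of \<open>A'\<^sub>n(W)\<close>\<close>

definition O_mod_image ::
    "('v::ab_group_add) vertex_data \<Rightarrow> ('v, 'w::ab_group_add) module_data \<Rightarrow> nat \<Rightarrow> 'w set set"
  where "O_mod_image V W n = (\<lambda>w. w +o O' V W n) ` O_mod V W n"

abbreviation complex_ring :: "complex ring"
  where "complex_ring \<equiv> ring_of_type_algebra"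

end

theory Submission
  imports Defs
begin

text \<open>
  Write \<open>s = 1/x\<close> and \<open>z = 1 + x\<close>, and for homogeneous \<open>v\<close> let
  \<open>A(q,v)w = Res\<^sub>x q(x) z\<^bsup>wt v - 1\<^esup> Y(v,x)w\<close> (the constant \<open>act\<close>).  Since \<open>s z = 1 + s\<close>, all the weights
  disappear from the definitions: \<open>O'\<^sub>n(W)\<close> is spanned by the \<open>A(s\<^sup>n\<^sup>+\<^sup>1(1 + s)\<^sup>n\<^sup>+\<^sup>1, v)w\<close>, the left action of
  \<open>v\<close> is \<open>A(e,v)\<close> and the right action is \<open>A(e - 1,v)\<close>, where \<open>e\<close> (\<open>left_poly\<close>) is the polynomial in \<open>s\<close> of
  degree at most \<open>2n + 1\<close> with \<open>e \<equiv> 1\<close> modulo \<open>s\<^sup>n\<^sup>+\<^sup>1\<close> and \<open>e \<equiv> 0\<close> modulo \<open>(1 + s)\<^sup>n\<^sup>+\<^sup>1\<close>.  Let \<open>I\<close> be the ideal of \<open>\<complex>[s]\<close>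
  generated by \<open>s\<^sup>n\<^sup>+\<^sup>1(1 + s)\<^sup>n\<^sup>+\<^sup>1\<close>, and \<open>D = z d/dx = -s(1 + s) d/ds\<close>.  Then \<open>e\<close> is idempotent modulo \<open>I\<close>,
  \<open>D\<close> maps \<open>I\<close> into \<open>I\<close>, and \<open>D e\<close> lies in \<open>I\<close>.  The theorem follows from three computations.

  Integration by parts gives \<open>A(D p,v) = - A(p,(L(-1) + L(0))v)\<close> (\<open>act_euler\<close>).  Hence the polynomials \<open>p\<close>
  with \<open>A(p,v)w \<in> O'\<^sub>n(W)\<close> for all \<open>v\<close> and \<open>w\<close> form a subspace stable under \<open>D\<close>, which therefore contains all of \<open>I\<close>
  (\<open>act_ideal\<close>).

  The commutator \<open>[A(p,u),A(q,v)]\<close> is a sum of terms \<open>A(q h,u\<^sub>i v)\<close> with \<open>h\<close> obtained from \<open>p\<close> by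
  iterating \<open>D\<close> (\<open>act_commutator\<close>).  So every \<open>A(p,u)\<close> preserves \<open>O'\<^sub>n(W)\<close>, and \<open>A(e,u)\<close> commutes with
  \<open>A(e - 1,v)\<close> modulo \<open>O'\<^sub>n(W)\<close>.  As \<open>L(-1) + L(0) = A(1,\<omega>)\<close>, it also gives
  \<open>[L(-1) + L(0),A(p,v)] = - A(D p,v)\<close>, whose values lie in \<open>O'\<^sub>n(W)\<close> for \<open>p = e\<close> and \<open>p = e - 1\<close>: this is the
  stability of \<open>O\<^sub>n(W)\<close>.

  For the iterate \<open>A(f,A(g,u)v)\<close> the substitution \<open>x\<^sub>0 = (x\<^sub>1 - x\<^sub>2)/(1 + x\<^sub>2)\<close> turns \<open>g(s\<^sub>0)\<close> into a rational
  function with its pole at \<open>x\<^sub>1 = x\<^sub>2\<close>, and the Jacobi identity gives the difference of its two expansions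
  (\<open>act_iterate\<close>).  Each expansion depends linearly on \<open>g\<close>, has all its terms in \<open>O'\<^sub>n(W)\<close> when \<open>g \<in> I\<close>, and collapses
  to one term when \<open>g = e\<close> (\<open>pole_functional_left_poly\<close>).  The result is
  \<open>A(f,A(e,u)v) \<equiv> A(e,u)A(f,v) + A((e - 1)f,v)A(1,u)\<close> modulo \<open>O'\<^sub>n(W)\<close> (\<open>act_left_product\<close>), which for \<open>f = e\<close> and
  \<open>f = e - 1\<close> is associativity of the left and of the right action.  Applied to the adjoint module, where
  \<open>O\<^sub>n(V)\<close> plays the part of \<open>O\<^sub>n(W)\<close>, the same facts make \<open>A\<^sub>n(V)\<close> an associative algebra.
\<close>

section \<open>Formal Laurent series and polynomials in the inverse variable\<close>

abbreviation Xp :: "complex fls" where "Xp \<equiv> fls_X"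
abbreviation S :: "complex fls" where "S \<equiv> fls_X_inv"

definition Z :: "complex fls" where "Z = 1 + fls_X"

lemma X_S [simp]: "Xp * S = 1" "S * Xp = 1"
  by (simp_all add: fls_X_times_conv_shift(1) fls_X_inv_times_conv_shift(1))

lemma Z_nonzero [simp]: "Z \<noteq> 0"
proof
  assume "Z = 0"
  then have "Z $$ 0 = 0" by simp
  then show False by (simp add: Z_def)
qed

lemma S_Z: "S * Z = 1 + S"
  by (simp add: Z_def distrib_left)

lemma X_powi_mult_nth: "(Xp powi a * f) $$ k = f $$ (k - a)"
  by (simp add: fls_X_intpow_times_conv_shift)

lemma S_pow_powi: "S ^ k = Xp powi (- int k)"
  by (simp add: fls_X_inv_power_conv_shift_1)

lemma Z_powi_nth: "(Z powi k) $$ j = (if j < 0 then 0 else of_int k gchoose nat j)"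
  by (simp add: Z_def one_plus_fls_X_powi_eq)

lemma Z_powi_step: "Z powi k = Z * Z powi (k - 1)"
  using power_int_add_1'[of Z "k - 1"] by simp

lemma xpow_binomial_eq: "xpow_binomial a k = Xp powi a * Z powi k"
  by (simp add: xpow_binomial_def Z_def one_plus_fls_X_powi_eq)

lemma fls_deriv_power_int:
  fixes f :: "complex fls"
  assumes "f \<noteq> 0"
  shows "fls_deriv (f powi k) = of_int k * f powi (k - 1) * fls_deriv f"
proof -
  have nonneg: "fls_deriv (f ^ m) = of_nat m * f powi (int m - 1) * fls_deriv f" for m
  proof (induction m)
    case 0
    show ?case by simp
  next
    case (Suc m)
    have "f * f powi (int m - 1) = f ^ m"
      using assms by (metis power_int_add_1' power_int_of_nat diff_add_cancel)
    then have "fls_deriv (f ^ Suc m) = of_nat m * f ^ m * fls_deriv f + fls_deriv f * f ^ m"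
      by (simp add: Suc.IH)
    then show ?case
      by (simp add: algebra_simps)
  qed
  show ?thesis
  proof (cases "k \<ge> 0")
    case True
    then show ?thesis using nonneg[of "nat k"] by (simp add: power_int_def)
  next
    case False
    define m where "m = nat (- k)"
    have k: "k = - int m" using False by (simp add: m_def)
    have inv: "f powi k * f ^ m = 1"
      using assms by (simp add: k power_int_minus)
    then have "fls_deriv (f powi k * f ^ m) = 0" by simp
    then have "fls_deriv (f powi k) * f ^ m = - (f powi k * fls_deriv (f ^ m))"
      by (simp add: add_eq_0_iff)
    then have "fls_deriv (f powi k) * f ^ m * f powi k
      = - (f powi k * (of_nat m * f powi (int m - 1) * fls_deriv f)) * f powi k"
      by (simp add: nonneg)
    also have "\<dots> = - (of_nat m * (f powi k * f powi k * f powi (int m - 1)) * fls_deriv f)"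
      by (simp add: algebra_simps)
    also have "f powi k * f powi k * f powi (int m - 1) = f powi (k - 1)"
      using assms by (simp add: k flip: power_int_add)
    finally have "fls_deriv (f powi k) * (f powi k * f ^ m) = of_int k * f powi (k - 1) * fls_deriv f"
      by (simp add: k mult.commute mult.left_commute)
    then show ?thesis
      by (simp add: inv)
  qed
qed

lemma fls_deriv_Z_powi: "fls_deriv (Z powi k) = of_int k * Z powi (k - 1)"
  by (simp add: fls_deriv_power_int Z_def[THEN arg_cong[of _ _ fls_deriv]])


subsection \<open>Divided derivatives\<close>

text \<open>
  The divided derivatives \<open>f\<^bsup>(i)\<^esup>/i!\<close>, the coefficients of \<open>y\<^sup>i\<close> in \<open>f(x + y)\<close>
\<close>

definition hasse :: "nat \<Rightarrow> complex fls \<Rightarrow> complex fls"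
  where "hasse i f = fls_const (1 / fact i) * (fls_deriv ^^ i) f"

lemma hasse_0 [simp]: "hasse 0 f = f"
  by (simp add: hasse_def)

lemma hasse_Suc: "hasse (Suc i) f = fls_const (1 / of_nat (Suc i)) * fls_deriv (hasse i f)"
  by (simp add: hasse_def mult.assoc[symmetric])

lemma gbinomial_Suc_mult:
  "of_nat (Suc i) * (a gchoose Suc i) = (a - of_nat i) * (a gchoose i :: complex)"
  using gbinomial_mult_1[of a i] by (simp add: algebra_simps)

lemma hasse_nth: "hasse i f $$ k = (of_int (k + int i) gchoose i) * f $$ (k + int i)"
proof (induction i arbitrary: k)
  case 0
  show ?case by simp
next
  case (Suc i)
  define a where "a = k + int (Suc i)"
  have "of_nat (Suc i) * (of_int a gchoose Suc i :: complex) = of_int (k + 1) * (of_int a gchoose i)"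
    using gbinomial_Suc_mult[of i "of_int a"] by (simp add: a_def)
  then have "(of_int a gchoose Suc i :: complex)
      = (1 / of_nat (Suc i)) * (of_int (k + 1) * (of_int a gchoose i))"
    by (simp add: field_simps del: of_nat_Suc)
  moreover have "k + 1 + int i = a" by (simp add: a_def)
  ultimately show ?case
    unfolding a_def[symmetric] by (simp add: hasse_Suc Suc.IH del: of_nat_Suc)
qed

lemma hasse_add: "hasse i (f + g) = hasse i f + hasse i g"
  by (rule fls_eqI) (simp add: hasse_nth algebra_simps)

lemma hasse_const_mult: "hasse i (fls_const c * f) = fls_const c * hasse i f"
  by (rule fls_eqI) (simp add: hasse_nth)

lemma hasse_X_powi: "hasse i (Xp powi m) = fls_const (of_int m gchoose i) * Xp powi (m - int i)"
proof (rule fls_eqI)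
  fix k
  show "hasse i (Xp powi m) $$ k = (fls_const (of_int m gchoose i) * Xp powi (m - int i)) $$ k"
    by (cases "k + int i = m") (auto simp: hasse_nth simp flip: of_int_add)
qed

lemma hasse_Z_powi: "hasse i (Z powi m) = fls_const (of_int m gchoose i) * Z powi (m - int i)"
proof (induction i)
  case 0
  show ?case by simp
next
  case (Suc i)
  have eq: "(of_int m gchoose Suc i :: complex) = 1 / of_nat (Suc i) * ((of_int m gchoose i) * (of_int m - of_nat i))"
    using gbinomial_Suc_mult[of i "of_int m"] by (simp add: field_simps del: of_nat_Suc)
  have "hasse (Suc i) (Z powi m) = fls_const (1 / of_nat (Suc i)) *
      (fls_const (of_int m gchoose i) * (of_int (m - int i) * Z powi (m - int i - 1)))"
    by (simp add: hasse_Suc Suc.IH fls_deriv_Z_powi del: of_nat_Suc)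
  also have "\<dots> = fls_const (of_int m gchoose Suc i) * Z powi (m - int (Suc i))"
    by (simp add: eq fls_of_int mult.assoc[symmetric] del: of_nat_Suc)
      (simp add: algebra_simps)
  finally show ?case .
qed


subsection \<open>Polynomials in the inverse variable\<close>

definition ev :: "complex poly \<Rightarrow> complex fls"
  where "ev p = poly (map_poly fls_const p) S"

lemma ev_pCons [simp]: "ev (pCons a p) = fls_const a + S * ev p"
  by (simp add: ev_def map_poly_pCons)

lemma ev_0 [simp]: "ev 0 = 0"
  by (simp add: ev_def)

lemma ev_1 [simp]: "ev 1 = 1"
  by (simp add: one_pCons)

lemma ev_add [simp]: "ev (p + q) = ev p + ev q"
  by (induction p q rule: poly_induct2) (simp_all add: algebra_simps flip: fls_plus_const)

lemma ev_smult [simp]: "ev (smult c p) = fls_const c * ev p"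
  by (induction p) (simp_all add: algebra_simps flip: fls_const_mult_const)

lemma ev_minus [simp]: "ev (- p) = - ev p"
  using ev_smult[of "-1" p] by (simp flip: fls_const_1)

lemma ev_diff [simp]: "ev (p - q) = ev p - ev q"
  using ev_add[of p "- q"] by simp

lemma ev_mult [simp]: "ev (p * q) = ev p * ev q"
  by (induction p) (simp_all add: algebra_simps)

lemma ev_power [simp]: "ev (p ^ k) = ev p ^ k"
  by (induction k) simp_all

lemma ev_sum: "ev (sum f A) = (\<Sum>i\<in>A. ev (f i))"
  by (induction A rule: infinite_finite_induct) simp_all

abbreviation s_poly :: "complex poly" where "s_poly \<equiv> [:0, 1:]"
abbreviation t_poly :: "complex poly" where "t_poly \<equiv> [:1, 1:]"

text \<open>
  The derivation \<open>(1 + x) d/dx\<close>, read on polynomials in \<open>s = 1/x\<close>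
\<close>

definition euler :: "complex poly \<Rightarrow> complex poly"
  where "euler p = - (s_poly * t_poly * pderiv p)"

lemma euler_add: "euler (p + q) = euler p + euler q"
  by (simp add: euler_def pderiv_add algebra_simps)

lemma euler_mult: "euler (p * q) = euler p * q + p * euler q"
  by (simp add: euler_def pderiv_mult algebra_simps)

lemma ev_euler: "ev (euler p) = Z * fls_deriv (ev p)"
proof (induction p)
  case 0
  show ?case by (simp add: euler_def)
next
  case (pCons a p)
  have "euler (pCons a p) = euler (s_poly * p)"
    by (simp add: euler_def pderiv_pCons)
  also have "\<dots> = - (s_poly * t_poly) * p + s_poly * euler p"
    by (simp only: euler_mult) (simp add: euler_def pderiv_pCons)
  finally have "ev (euler (pCons a p)) = - (S * (1 + S)) * ev p + S * (Z * fls_deriv (ev p))"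
    using pCons.IH by (simp add: algebra_simps)
  also have "S * (1 + S) = Z * S\<^sup>2"
    by (simp add: S_Z[symmetric] power2_eq_square mult.commute mult.left_commute)
  finally show ?case by (simp add: algebra_simps)
qed

text \<open>
  Conjugating the Taylor expansion in \<open>x\<close> with the powers of \<open>1 + x\<close> keeps polynomials in \<open>1/x\<close>
  polynomial; this is what lets commutators be read off in the polynomial algebra.
\<close>

fun taylor :: "int \<Rightarrow> complex poly \<Rightarrow> nat \<Rightarrow> complex poly"
  where "taylor a p 0 = p"
  | "taylor a p (Suc i) = smult (1 / of_nat (Suc i))
       (smult (of_int (a - 1 - int i)) (taylor a p i) + euler (taylor a p i))"

lemma hasse_ev_Z_powi:
  "hasse i (ev p * Z powi (a - 1)) = ev (taylor a p i) * Z powi (a - 1 - int i)"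
proof (induction i)
  case 0
  show ?case by simp
next
  case (Suc i)
  let ?k = "a - 1 - int i"
  have "fls_deriv (ev (taylor a p i) * Z powi ?k)
      = (of_int ?k * ev (taylor a p i) + Z * fls_deriv (ev (taylor a p i))) * Z powi (?k - 1)"
  proof -
    have "Z powi ?k = Z * Z powi (?k - 1)"
      by (rule Z_powi_step)
    then show ?thesis
      unfolding fls_deriv_mult fls_deriv_Z_powi by (simp only: algebra_simps)
  qed
  moreover have "?k - 1 = a - 1 - int (Suc i)" by simp
  ultimately show ?case
    unfolding hasse_Suc Suc.IH taylor.simps ev_smult ev_add ev_euler fls_of_int by (simp only: mult.assoc)
qed

section \<open>Residues of vertex operators and the Jacobi identity\<close>

definition res :: "('v, 'w::ab_group_add) module_data \<Rightarrow> complex fls \<Rightarrow> 'v \<Rightarrow> 'w \<Rightarrow> 'w"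
  where "res W f v w = Sum_any (\<lambda>i. mscale W (f $$ i) (mode W v i w))"

lemma res_mult_eq_res: "res_mult (mscale W) f (mvertex_op W v w) = res W f v w"
proof -
  have "- 1 - i = - i - 1" for i :: int by simp
  then show ?thesis unfolding res_mult_def res_def mode_def by (rule Sum_any.cong[OF arg_cong])
qed

lemma mode_eventually_0: "\<exists>N. \<forall>i\<ge>N. mode W v i w = 0"
proof -
  obtain N where N: "\<And>k. k < N \<Longrightarrow> mvertex_op W v w $$ k = 0"
    using fls_nth_vanishes_belowE[of "mvertex_op W v w"] by blast
  have "\<forall>i\<ge>- N. mode W v i w = 0"
    by (auto simp: mode_def intro!: N)
  then show ?thesis ..
qed

lemma Sum_any_eq_0: "\<forall>i. f i = 0 \<Longrightarrow> Sum_any f = 0"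
proof -
  assume "\<forall>i. f i = 0"
  then have "f = (\<lambda>i. 0)" by (simp add: fun_eq_iff)
  then show ?thesis by (simp only: Sum_any.neutral)
qed

lemma finite_nat_support: "(\<And>i::nat. i \<ge> N \<Longrightarrow> f i = 0) \<Longrightarrow> finite {i. f i \<noteq> 0}"
  by (rule finite_subset[of _ "{..<N}"]) (auto simp: not_le[symmetric])

lemma fls_mult_nth_below:
  fixes g k :: "complex fls"
  assumes "\<And>j. j < N \<Longrightarrow> k $$ j = 0" and "j < N + fls_subdegree g"
  shows "(g * k) $$ j = 0"
proof (cases "k = 0")
  case False
  then have "N \<le> fls_subdegree k"
    using assms(1) by (intro fls_subdegree_geI)
  then show ?thesis using assms(2) by (intro fls_times_nth_eq0) simp
qed simp

text \<open>
  Linear identities between residues are proved on monomials and extended to all Laurent series by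
  \<open>x\<close>-adic continuity; \<open>high_order P\<close> says that \<open>P\<close> holds on a neighbourhood of \<open>0\<close>.
\<close>

definition high_order :: "(complex fls \<Rightarrow> bool) \<Rightarrow> bool"
  where "high_order P \<longleftrightarrow> (\<exists>N. \<forall>k. (\<forall>j<N. k $$ j = 0) \<longrightarrow> P k)"

lemma high_order_conj:
  assumes "high_order P" "high_order Q"
  shows "high_order (\<lambda>k. P k \<and> Q k)"
proof -
  obtain M N where "\<forall>k. (\<forall>j<M. k $$ j = 0) \<longrightarrow> P k" "\<forall>k. (\<forall>j<N. k $$ j = 0) \<longrightarrow> Q k"
    using assms by (auto simp: high_order_def)
  then have "\<forall>k. (\<forall>j<max M N. k $$ j = 0) \<longrightarrow> P k \<and> Q k"
    by (metis less_max_iff_disj)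
  then show ?thesis unfolding high_order_def by blast
qed

lemma high_order_mono: "high_order P \<Longrightarrow> (\<And>k. P k \<Longrightarrow> Q k) \<Longrightarrow> high_order Q"
  by (auto simp: high_order_def)

lemma high_order_all_less:
  fixes n :: nat
  assumes "\<And>i. high_order (P i)"
  shows "high_order (\<lambda>k. \<forall>i<n. P i k)"
proof (induction n)
  case 0
  show ?case by (simp add: high_order_def)
next
  case (Suc n)
  show ?case
    by (rule high_order_mono[OF high_order_conj[OF Suc assms[of n]]]) (auto simp: less_Suc_eq)
qed

lemma additive_eq_0I:
  fixes F :: "complex fls \<Rightarrow> 'w::ab_group_add"
  assumes add: "\<And>f g. F (f + g) = F f + F g"
    and monom: "\<And>c m. F (fls_const c * Xp powi m) = 0"
    and high: "high_order (\<lambda>f. F f = 0)"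
  shows "F f = 0"
proof -
  obtain N where N: "\<And>k. (\<forall>j<N. k $$ j = 0) \<Longrightarrow> F k = 0"
    using high by (auto simp: high_order_def)
  have *: "\<forall>j < N - int d. f $$ j = 0 \<Longrightarrow> F f = 0" for d f
  proof (induction d arbitrary: f)
    case 0
    then show ?case using N by simp
  next
    case (Suc d)
    define m where "m = N - int (Suc d)"
    define g where "g = f - fls_const (f $$ m) * Xp powi m"
    have "g $$ j = 0" if "j < N - int d" for j
      using that Suc.prems by (cases "j = m") (auto simp: g_def m_def)
    then have "F g = 0" by (intro Suc.IH) blast
    moreover have "F f = F g + F (fls_const (f $$ m) * Xp powi m)"
      by (subst add[symmetric]) (simp add: g_def)
    ultimately show ?case unfolding monom by simp
  qed
  obtain M where M: "\<And>k. k < M \<Longrightarrow> f $$ k = 0"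
    using fls_nth_vanishes_belowE[of f] by blast
  show ?thesis
    by (rule *[of "nat (N - M)"]) (auto intro!: M)
qed


context weak_module
begin

lemma mode_add_left: "mode W (u + v) m w = mode W u m w + mode W v m w"
  using module_hom.add[OF Vector_Spaces.linear.axioms(3)[OF mvertex_op_linear_left]] .

lemma mode_scale_left: "mode W (vscale V c v) m w = mscale W c (mode W v m w)"
  using module_hom.scale[OF Vector_Spaces.linear.axioms(3)[OF mvertex_op_linear_left]] .

lemma mode_add_right: "mode W v m (w + w') = mode W v m w + mode W v m w'"
  using module_hom.add[OF Vector_Spaces.linear.axioms(3)[OF mvertex_op_linear_right]] .

lemma mode_scale_right: "mode W v m (mscale W c w) = mscale W c (mode W v m w)"
  using module_hom.scale[OF Vector_Spaces.linear.axioms(3)[OF mvertex_op_linear_right]] .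

lemma mode_0 [simp]: "mode W 0 m w = 0" "mode W v m 0 = 0"
  using mode_add_left[of 0 0] mode_add_right[of _ _ 0 0] by simp_all

lemma Sum_any_scale:
  assumes "finite {i. f i \<noteq> 0}"
  shows "Sum_any (\<lambda>i. mscale W c (f i)) = mscale W c (Sum_any f)"
proof -
  have "Sum_any (\<lambda>i. mscale W c (f i)) = (\<Sum>i | f i \<noteq> 0. mscale W c (f i))"
    using assms by (intro Sum_any.expand_superset) auto
  then show ?thesis by (simp add: W.scale_sum_right Sum_any.expand_set)
qed

lemma res_finite: "finite {i. mscale W (f $$ i) (mode W v i w) \<noteq> 0}"
proof -
  obtain N where N: "\<forall>i\<ge>N. mode W v i w = 0" using mode_eventually_0[of W v w] ..
  obtain M where M: "\<And>k. k < M \<Longrightarrow> f $$ k = 0"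
    using fls_nth_vanishes_belowE[of f] by blast
  show ?thesis
  proof (rule finite_subset)
    have "mscale W (f $$ i) (mode W v i w) = 0" if "i < M \<or> N \<le> i" for i
      using that
    proof
      assume "i < M"
      then show ?thesis by (simp add: M)
    next
      assume "N \<le> i"
      then show ?thesis by (simp add: N)
    qed
    then show "{i. mscale W (f $$ i) (mode W v i w) \<noteq> 0} \<subseteq> {M..<N}"
      unfolding subset_iff mem_Collect_eq atLeastLessThan_iff by (meson not_le)
  qed simp
qed

lemma res_add: "res W (f + g) v w = res W f v w + res W g v w"
  unfolding res_def Sum_any.distrib[OF res_finite res_finite, symmetric] by (simp add: W.scale_left_distrib)

lemma res_add_left: "res W f (u + v) w = res W f u w + res W f v w"
  unfolding res_def Sum_any.distrib[OF res_finite res_finite, symmetric]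
  by (simp add: W.scale_right_distrib mode_add_left)

lemma res_add_right: "res W f v (w + w') = res W f v w + res W f v w'"
  unfolding res_def Sum_any.distrib[OF res_finite res_finite, symmetric]
  by (simp add: W.scale_right_distrib mode_add_right)

lemma res_const_mult: "res W (fls_const c * f) v w = mscale W c (res W f v w)"
  unfolding res_def Sum_any_scale[OF res_finite, symmetric] by simp

lemma res_scale_left: "res W f (vscale V c v) w = mscale W c (res W f v w)"
  unfolding res_def Sum_any_scale[OF res_finite, symmetric] by (simp add: mode_scale_left mult.commute)

lemma res_scale_right: "res W f v (mscale W c w) = mscale W c (res W f v w)"
  unfolding res_def Sum_any_scale[OF res_finite, symmetric] by (simp add: mode_scale_right mult.commute)

lemma res_0 [simp]: "res W 0 v w = 0" "res W f 0 w = 0" "res W f v 0 = 0"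
  by (simp_all add: res_def)

lemma res_sum: "res W (sum f A) v w = (\<Sum>i\<in>A. res W (f i) v w)"
  by (induction A rule: infinite_finite_induct) (simp_all add: res_add)

lemma res_X_powi: "res W (Xp powi m) v w = mode W v m w"
proof -
  have "res W (Xp powi m) v w = Sum_any (\<lambda>i. if i = m then mode W v i w else 0)"
    unfolding res_def by (rule Sum_any.cong) simp
  then show ?thesis by simp
qed

lemma res_eq_0:
  assumes "\<And>j. j < N \<Longrightarrow> f $$ j = 0" "\<And>j. j \<ge> N \<Longrightarrow> mode W v j w = 0"
  shows "res W f v w = 0"
proof -
  have "mscale W (f $$ i) (mode W v i w) = 0" for i
    by (cases "i < N") (simp_all add: assms)
  then show ?thesis unfolding res_def by (simp only: Sum_any.neutral)
qed

lemma high_order_res: "high_order (\<lambda>k. res W (g * k) v w = 0)"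
proof -
  obtain N where N: "\<forall>i\<ge>N. mode W v i w = 0" using mode_eventually_0[of W v w] ..
  have "res W (g * k) v w = 0" if "\<forall>j < N - fls_subdegree g. k $$ j = 0" for k
    by (rule res_eq_0[where N = N]) (use that N in \<open>auto intro!: fls_mult_nth_below[of "N - fls_subdegree g"]\<close>)
  then show ?thesis unfolding high_order_def by blast
qed

lemma high_order_res_X_pow: "high_order (\<lambda>k. \<forall>i. res W (Xp ^ i * k) v w = 0)"
proof -
  obtain N where N: "\<forall>i\<ge>N. mode W v i w = 0" using mode_eventually_0[of W v w] ..
  have "res W (Xp ^ i * k) v w = 0" if "\<forall>j < N. k $$ j = 0" for k i
    by (rule res_eq_0[where N = N])
      (use that N in \<open>auto simp: fls_X_power_times_conv_shift\<close>)
  then show ?thesis unfolding high_order_def by blast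
qed

lemma high_order_res_hasse: "high_order (\<lambda>k. res W (hasse i k * g) v w = 0)"
proof -
  obtain N where N: "\<forall>j. (\<forall>l<N. j $$ l = 0) \<longrightarrow> res W (g * j) v w = 0"
    using high_order_res[of g v w] by (auto simp: high_order_def)
  have "res W (hasse i k * g) v w = 0" if "\<forall>j < N + int i. k $$ j = 0" for k
    using that N[rule_format, of "hasse i k"] by (simp add: hasse_nth mult.commute[of g])
  then show ?thesis unfolding high_order_def by blast
qed

lemma res_X_pow_eventually_0: "\<exists>n. \<forall>i\<ge>n. res W (Xp ^ i * k) v w = 0"
proof -
  obtain N where N: "\<forall>i\<ge>N. mode W v i w = 0" using mode_eventually_0[of W v w] ..
  obtain M where M: "\<And>j. j < M \<Longrightarrow> k $$ j = 0"
    using fls_nth_vanishes_belowE[of k] by blast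
  have "res W (Xp ^ i * k) v w = 0" if "i \<ge> nat (N - M)" for i
    by (rule res_eq_0[where N = N])
      (use that N in \<open>auto simp: fls_X_power_times_conv_shift intro!: M\<close>)
  then show ?thesis by blast
qed


text \<open>
  The terms of the two sides of the Jacobi identity, multiplied by \<open>f(x\<^sub>1) g(x\<^sub>2)\<close> and integrated;
  monomials \<open>f\<close> and \<open>g\<close> give back the componentwise identity.
\<close>

definition jacobi_lhs :: "int \<Rightarrow> 'v \<Rightarrow> 'v \<Rightarrow> 'w \<Rightarrow> complex fls \<Rightarrow> complex fls \<Rightarrow> nat \<Rightarrow> 'w"
  where "jacobi_lhs l u v w f g i = mscale W ((- 1) ^ i * (of_int l gchoose i))
    (res W (Xp powi (l - int i) * f) u (res W (Xp ^ i * g) v w)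
     - mscale W ((- 1) powi l) (res W (Xp powi (l - int i) * g) v (res W (Xp ^ i * f) u w)))"

definition jacobi_rhs :: "int \<Rightarrow> 'v \<Rightarrow> 'v \<Rightarrow> 'w \<Rightarrow> complex fls \<Rightarrow> complex fls \<Rightarrow> nat \<Rightarrow> 'w"
  where "jacobi_rhs l u v w f g i = res W (hasse i f * g) (mode (adjoint V) u (l + int i) v) w"

lemma jacobi_lhs_finite: "finite {i. jacobi_lhs l u v w f g i \<noteq> 0}"
proof -
  obtain m where "\<forall>i\<ge>m. res W (Xp ^ i * g) v w = 0"
    using res_X_pow_eventually_0[of g v w] ..
  moreover obtain n where "\<forall>i\<ge>n. res W (Xp ^ i * f) u w = 0"
    using res_X_pow_eventually_0[of f u w] ..
  ultimately show ?thesis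
    by (intro finite_nat_support[of "max m n"]) (simp add: jacobi_lhs_def)
qed

lemma jacobi_rhs_vanish: "\<exists>n. \<forall>i\<ge>n. \<forall>f g. jacobi_rhs l u v w f g i = 0"
proof -
  obtain N where N: "\<forall>i\<ge>N. mode (adjoint V) u i v = 0"
    using mode_eventually_0[of "adjoint V" u v] ..
  have "jacobi_rhs l u v w f g i = 0" if "i \<ge> nat (N - l)" for i f g
    using that N by (simp add: jacobi_rhs_def res_def)
  then show ?thesis by blast
qed

lemma jacobi_rhs_finite: "finite {i. jacobi_rhs l u v w f g i \<noteq> 0}"
  using jacobi_rhs_vanish[of l u v w] by (metis finite_nat_support)

lemma jacobi_monomials:
  "Sum_any (jacobi_lhs l u v w (Xp powi m) (Xp powi n))
    = Sum_any (jacobi_rhs l u v w (Xp powi m) (Xp powi n))"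
proof -
  have mono: "Xp powi a * Xp powi b = Xp powi (a + b)" "Xp ^ i * Xp powi b = Xp powi (int i + b)" for a b i
    by (simp_all only: power_int_add[OF disjI1[OF fls_X_nonzero]] power_int_of_nat)
  have "jacobi_lhs l u v w (Xp powi m) (Xp powi n) = (\<lambda>i.
      mscale W ((- 1) ^ i * (of_int l gchoose i))
          (mode W u (m + l - int i) (mode W v (n + int i) w)
           - mscale W ((- 1) powi l) (mode W v (n + l - int i) (mode W u (m + int i) w))))"
    unfolding jacobi_lhs_def mono res_X_powi by (simp add: algebra_simps)
  moreover have "jacobi_rhs l u v w (Xp powi m) (Xp powi n) = (\<lambda>i. mscale W (of_int m gchoose i)
          (mode W (mode (adjoint V) u (l + int i) v) (m + n - int i) w))"
    unfolding jacobi_rhs_def hasse_X_powi mult.assoc mono res_const_mult res_X_powi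
    by (simp add: algebra_simps)
  ultimately show ?thesis
    using mjacobi by (simp add: jacobi_identity_def)
qed

lemma jacobi_lhs_add:
  "jacobi_lhs l u v w (f + f') g i = jacobi_lhs l u v w f g i + jacobi_lhs l u v w f' g i"
  "jacobi_lhs l u v w f (g + g') i = jacobi_lhs l u v w f g i + jacobi_lhs l u v w f g' i"
  by (simp_all add: jacobi_lhs_def res_add res_add_right distrib_left W.scale_right_distrib
      W.scale_right_diff_distrib)

lemma jacobi_rhs_add:
  "jacobi_rhs l u v w (f + f') g i = jacobi_rhs l u v w f g i + jacobi_rhs l u v w f' g i"
  "jacobi_rhs l u v w f (g + g') i = jacobi_rhs l u v w f g i + jacobi_rhs l u v w f g' i"
  by (simp_all add: jacobi_rhs_def res_add hasse_add distrib_left distrib_right)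

lemma jacobi_lhs_const_mult:
  "jacobi_lhs l u v w (fls_const c * f) g i = mscale W c (jacobi_lhs l u v w f g i)"
  "jacobi_lhs l u v w f (fls_const c * g) i = mscale W c (jacobi_lhs l u v w f g i)"
proof -
  have out: "Xp powi a * (fls_const c * f) = fls_const c * (Xp powi a * f)"
    "Xp ^ i * (fls_const c * f) = fls_const c * (Xp ^ i * f)" for a i f
    by (rule mult.left_commute)+
  have comm: "mscale W a (mscale W c y) = mscale W c (mscale W a y)" for a y
    by (simp add: mult.commute)
  have diff: "mscale W c y - mscale W c y' = mscale W c (y - y')" for y y'
    by (simp add: W.scale_right_diff_distrib)
  show "jacobi_lhs l u v w (fls_const c * f) g i = mscale W c (jacobi_lhs l u v w f g i)"
    "jacobi_lhs l u v w f (fls_const c * g) i = mscale W c (jacobi_lhs l u v w f g i)"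
    unfolding jacobi_lhs_def out res_const_mult res_scale_right
    by (simp_all only: comm[of "(- 1) powi l"] comm[of "(- 1) ^ i * (of_int l gchoose i)"] diff)
qed

lemma jacobi_rhs_const_mult:
  "jacobi_rhs l u v w (fls_const c * f) g i = mscale W c (jacobi_rhs l u v w f g i)"
  "jacobi_rhs l u v w f (fls_const c * g) i = mscale W c (jacobi_rhs l u v w f g i)"
  unfolding jacobi_rhs_def hasse_const_mult mult.assoc mult.left_commute[of "hasse i f" "fls_const c"] res_const_mult
  by (rule refl)+

lemma jacobi_lhs_high_order:
  "high_order (\<lambda>f. \<forall>i. jacobi_lhs l u v w f g i = 0)"
  "high_order (\<lambda>g. \<forall>i. jacobi_lhs l u v w f g i = 0)"
proof -
  obtain n where n: "\<forall>i\<ge>n. res W (Xp ^ i * g) v w = 0"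
    using res_X_pow_eventually_0[of g v w] ..
  have "high_order (\<lambda>f. (\<forall>i<n. res W (Xp powi (l - int i) * f) u (res W (Xp ^ i * g) v w) = 0)
      \<and> (\<forall>i. res W (Xp ^ i * f) u w = 0))"
    by (intro high_order_conj high_order_all_less high_order_res high_order_res_X_pow)
  then show "high_order (\<lambda>f. \<forall>i. jacobi_lhs l u v w f g i = 0)"
    by (rule high_order_mono) (metis jacobi_lhs_def n res_0(3) W.scale_zero_right diff_0_right not_le)
  obtain n where n: "\<forall>i\<ge>n. res W (Xp ^ i * f) u w = 0"
    using res_X_pow_eventually_0[of f u w] ..
  have "high_order (\<lambda>g. (\<forall>i<n. res W (Xp powi (l - int i) * g) v (res W (Xp ^ i * f) u w) = 0)
      \<and> (\<forall>i. res W (Xp ^ i * g) v w = 0))"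
    by (intro high_order_conj high_order_all_less high_order_res high_order_res_X_pow)
  then show "high_order (\<lambda>g. \<forall>i. jacobi_lhs l u v w f g i = 0)"
    by (rule high_order_mono) (metis jacobi_lhs_def n res_0(3) W.scale_zero_right diff_0_right not_le)
qed

lemma jacobi_rhs_high_order:
  "high_order (\<lambda>f. \<forall>i. jacobi_rhs l u v w f g i = 0)"
  "high_order (\<lambda>g. \<forall>i. jacobi_rhs l u v w f g i = 0)"
proof -
  obtain n where n: "\<forall>i\<ge>n. \<forall>f g. jacobi_rhs l u v w f g i = 0"
    using jacobi_rhs_vanish[of l u v w] ..
  have "high_order (\<lambda>f. \<forall>i<n. jacobi_rhs l u v w f g i = 0)"
    "high_order (\<lambda>g. \<forall>i<n. jacobi_rhs l u v w f g i = 0)"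
    unfolding jacobi_rhs_def
    by (intro high_order_all_less high_order_res high_order_res_hasse)+
  note less = this
  show "high_order (\<lambda>f. \<forall>i. jacobi_rhs l u v w f g i = 0)"
    using less(1) by (rule high_order_mono) (metis n not_le)
  show "high_order (\<lambda>g. \<forall>i. jacobi_rhs l u v w f g i = 0)"
    using less(2) by (rule high_order_mono) (metis n not_le)
qed

text \<open>
  Both sides are bilinear in \<open>(f, g)\<close> and, one argument being fixed, vanish once the other has
  large enough order, so the componentwise identity determines them.
\<close>

theorem jacobi_residues: "Sum_any (jacobi_lhs l u v w f g) = Sum_any (jacobi_rhs l u v w f g)"
proof -
  define F where "F f g = Sum_any (jacobi_lhs l u v w f g) - Sum_any (jacobi_rhs l u v w f g)" for f g
  have add: "F (f + f') g = F f g + F f' g" "F f (g + g') = F f g + F f g'" for f f' g g'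
    unfolding F_def jacobi_lhs_add jacobi_rhs_add
    by (simp_all add: Sum_any.distrib[OF jacobi_lhs_finite jacobi_lhs_finite]
        Sum_any.distrib[OF jacobi_rhs_finite jacobi_rhs_finite])
  have scale: "F (fls_const c * f) g = mscale W c (F f g)" "F f (fls_const c * g) = mscale W c (F f g)"
    for c f g
    unfolding F_def jacobi_lhs_const_mult jacobi_rhs_const_mult
    by (simp_all add: Sum_any_scale[OF jacobi_lhs_finite] Sum_any_scale[OF jacobi_rhs_finite]
        W.scale_right_diff_distrib)
  have high: "high_order (\<lambda>f. F f g = 0)" for g
    by (rule high_order_mono[OF high_order_conj[OF jacobi_lhs_high_order(1)[of l u v w g]
          jacobi_rhs_high_order(1)[of l u v w g]]])
      (simp add: F_def Sum_any_eq_0)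
  have high': "high_order (\<lambda>g. F f g = 0)" for f
    by (rule high_order_mono[OF high_order_conj[OF jacobi_lhs_high_order(2)[of l u v w f]
          jacobi_rhs_high_order(2)[of l u v w f]]])
      (simp add: F_def Sum_any_eq_0)
  have monom: "F f (Xp powi n) = 0" for n
  proof (rule additive_eq_0I[where F = "\<lambda>f. F f (Xp powi n)"])
    show "F (f + g) (Xp powi n) = F f (Xp powi n) + F g (Xp powi n)" for f g
      by (rule add(1))
    show "F (fls_const c * Xp powi m) (Xp powi n) = 0" for c m
      unfolding scale(1) unfolding F_def jacobi_monomials by simp
    show "high_order (\<lambda>f. F f (Xp powi n) = 0)"
      by (rule high)
  qed
  have "F f g = 0"
  proof (rule additive_eq_0I[where F = "F f"])
    show "F f (g + g') = F f g + F f g'" for g g'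
      by (rule add(2))
    show "F f (fls_const c * Xp powi n) = 0" for c n
      unfolding scale(2) monom by simp
    show "high_order (\<lambda>g. F f g = 0)"
      by (rule high')
  qed
  then show ?thesis by (simp add: F_def)
qed

end

section \<open>Weights\<close>

lemma mscale_adjoint [simp]: "mscale (adjoint V) = vscale V"
  by (simp add: adjoint_def)

lemma (in vertex_operator_algebra) adjoint_weak_module: "weak_module V (adjoint V)"
proof (intro weak_module.intro weak_module_axioms.intro)
  show "vertex_operator_algebra V" ..
  show "vector_space (mscale (adjoint V))"
    unfolding mscale_adjoint ..
  show "Vector_Spaces.linear (vscale V) (mscale (adjoint V)) (\<lambda>v. mode (adjoint V) v m w)"
    "Vector_Spaces.linear (mscale (adjoint V)) (mscale (adjoint V)) (\<lambda>w. mode (adjoint V) v m w)" for m v w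
    unfolding mscale_adjoint by (rule vertex_op_linear_left vertex_op_linear_right)+
qed (rule vacuum_property jacobi)+

context weak_module
begin

lemma jacobi_component:
  "Sum_any (\<lambda>i::nat. mscale W ((- 1) ^ i * (of_int l gchoose i))
          (mode W u (m + l - int i) (mode W v (n + int i) w)
           - mscale W ((- 1) powi l) (mode W v (n + l - int i) (mode W u (m + int i) w))))
      = Sum_any (\<lambda>i::nat. mscale W (of_int m gchoose i)
          (mode W (mode (adjoint V) u (l + int i) v) (m + n - int i) w))"
  by (rule mjacobi[unfolded jacobi_identity_def, THEN spec, THEN spec, THEN spec, THEN spec, THEN spec, THEN spec])

lemma mode_commutator:
  "mode W u m (mode W v n w) - mode W v n (mode W u m w)
    = Sum_any (\<lambda>i::nat. mscale W (of_int m gchoose i) (mode W (mode (adjoint V) u (int i) v) (m + n - int i) w))"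
proof -
  let ?L = "\<lambda>i::nat. mscale W ((- 1) ^ i * (of_int 0 gchoose i))
          (mode W u (m + 0 - int i) (mode W v (n + int i) w)
           - mscale W ((- 1) powi 0) (mode W v (n + 0 - int i) (mode W u (m + int i) w)))"
  have L: "?L i = (if i = 0 then mode W u m (mode W v n w) - mode W v n (mode W u m w) else 0)" for i
    by (cases i) simp_all
  have "Sum_any ?L = mode W u m (mode W v n w) - mode W v n (mode W u m w)"
    unfolding L by simp
  then show ?thesis
    by (simp only: jacobi_component add_0)
qed

lemma mode_L_minus_1:
  "mode W (virasoro_op V (adjoint V) (- 1) u) m w = mscale W (- of_int m) (mode W u (m - 1) w)"
proof -
  \<comment> \<open>\<open>L(-1)u = u\<^sub>-\<^sub>2 1\<close>, so this is the Jacobi identity for \<open>u\<close> and the vacuum at \<open>l = -2\<close>\<close>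
  let ?L = "\<lambda>i::nat. mscale W ((- 1) ^ i * (of_int (- 2) gchoose i))
          (mode W u (0 + - 2 - int i) (mode W (vacuum V) (m + int i) w)
           - mscale W ((- 1) powi (- 2)) (mode W (vacuum V) (m + - 2 - int i) (mode W u (0 + int i) w)))"
  let ?R = "\<lambda>i::nat. mscale W (of_int 0 gchoose i)
          (mode W (mode (adjoint V) u (- 2 + int i) (vacuum V)) (0 + m - int i) w)"
  have u2: "virasoro_op V (adjoint V) (- 1) u = mode (adjoint V) u (- 2) (vacuum V)"
    using V.derivative_property[of u "- 1" "vacuum V"] V.creation_property(2)[of "virasoro_op V (adjoint V) (- 1) u"]
    by simp
  have coeff: "(- 1) ^ i * (of_int (- 2) gchoose i) = (of_nat (Suc i) :: complex)" for i
  proof -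
    have "(of_int (- 2) gchoose i :: complex) = (- 1) ^ i * (of_nat (Suc i) gchoose i)"
      using gbinomial_minus[of "2 :: complex" i] by (simp add: algebra_simps)
    also have "(of_nat (Suc i) gchoose i :: complex) = of_nat (Suc i)"
      by (simp only: binomial_gbinomial[symmetric] binomial_Suc_n)
    finally show ?thesis by (simp add: mult.assoc[symmetric] flip: power_mult_distrib)
  qed
  have L: "?L i = (if i = nat \<bar>m\<bar> - 1 then mscale W (- of_int m) (mode W u (m - 1) w) else 0)" for i
  proof -
    consider "m = - 1 - int i" | "m = int i + 1" | "m \<noteq> - 1 - int i" "m \<noteq> int i + 1" by blast
    then show ?thesis
    proof cases
      case 1
      have "mode W (vacuum V) (m + int i) w = w" "mode W (vacuum V) (m + - 2 - int i) x = 0" for x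
        using 1 by (simp_all add: mvacuum_property)
      moreover have "0 + - 2 - int i = m - 1" using 1 by simp
      moreover have "of_nat (Suc i) = (- of_int m :: complex)" using 1 by simp
      ultimately have "?L i = mscale W (- of_int m) (mode W u (m - 1) w)"
        by (simp only: coeff W.scale_zero_right diff_0_right)
      moreover have "i = nat \<bar>m\<bar> - 1" using 1 by simp
      ultimately show ?thesis by (simp only: if_True simp_thms)
    next
      case 2
      have "mode W (vacuum V) (m + int i) w = 0" "mode W (vacuum V) (m + - 2 - int i) x = x" for x
        using 2 by (simp_all add: mvacuum_property)
      moreover have "0 + int i = m - 1" using 2 by simp
      moreover have "of_nat (Suc i) = (of_int m :: complex)" using 2 by simp
      ultimately have "?L i = mscale W (- of_int m) (mode W u (m - 1) w)"
        by (simp only: coeff mode_0) simp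
      moreover have "i = nat \<bar>m\<bar> - 1" using 2 by simp
      ultimately show ?thesis by (simp only: if_True simp_thms)
    next
      case 3
      have "mode W (vacuum V) (m + int i) w = 0" "mode W (vacuum V) (m + - 2 - int i) x = 0" for x
        using 3 by (simp_all add: mvacuum_property)
      then have "?L i = 0"
        by (simp only: coeff mode_0 W.scale_zero_right diff_self)
      moreover have "i \<noteq> nat \<bar>m\<bar> - 1 \<or> m = 0"
        using 3 by arith
      then have "(if i = nat \<bar>m\<bar> - 1 then mscale W (- of_int m) (mode W u (m - 1) w) else 0) = 0"
        by (elim disjE) simp_all
      ultimately show ?thesis by (simp only:)
    qed
  qed
  have R: "?R i = (if i = 0 then mode W (mode (adjoint V) u (- 2) (vacuum V)) m w else 0)" for i
    by (simp add: gbinomial_0_left)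
  have "mode W (mode (adjoint V) u (- 2) (vacuum V)) m w = Sum_any ?R"
    unfolding R by simp
  also have "\<dots> = Sum_any ?L"
    by (rule jacobi_component[symmetric])
  also have "\<dots> = mscale W (- of_int m) (mode W u (m - 1) w)"
    unfolding L by simp
  finally show ?thesis unfolding u2 .
qed

end


context vertex_operator_algebra
begin

lemmas adj_mode_0 [simp] = weak_module.mode_0[OF adjoint_weak_module]
lemmas adj_mode_scale_left = weak_module.mode_scale_left[OF adjoint_weak_module, unfolded mscale_adjoint]
lemmas adj_mode_scale_right = weak_module.mode_scale_right[OF adjoint_weak_module, unfolded mscale_adjoint]
lemmas adj_mode_add_left = weak_module.mode_add_left[OF adjoint_weak_module]
lemmas adj_mode_add_right = weak_module.mode_add_right[OF adjoint_weak_module]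

lemma L0_eq: "virasoro_op V (adjoint V) 0 v = mode (adjoint V) (conformal V) 1 v"
  by (simp add: virasoro_op_def)

lemma weight_space_iff: "v \<in> weight_space V a \<longleftrightarrow> mode (adjoint V) (conformal V) 1 v = vscale V (of_int a) v"
  by (simp add: weight_space_def L0_eq)

lemma weight_space_0 [simp]: "0 \<in> weight_space V a"
  by (simp add: weight_space_iff)

lemma weight_space_add: "u \<in> weight_space V a \<Longrightarrow> v \<in> weight_space V a \<Longrightarrow> u + v \<in> weight_space V a"
  by (simp add: weight_space_iff adj_mode_add_right scale_right_distrib)

lemma weight_space_scale: "v \<in> weight_space V a \<Longrightarrow> vscale V c v \<in> weight_space V a"
  by (simp only: weight_space_iff adj_mode_scale_right scale_scale mult.commute)

text \<open>\<open>[L(0), u\<^sub>m] = (L(-1)u)\<^sub>m\<^sub>+\<^sub>1 + (L(0)u)\<^sub>m = (wt u - m - 1) u\<^sub>m\<close>\<close>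

lemma mode_weight:
  assumes u: "u \<in> weight_space V a" and v: "v \<in> weight_space V b"
  shows "mode (adjoint V) u m v \<in> weight_space V (a + b - m - 1)"
proof -
  let ?md = "mode (adjoint V)" and ?\<omega> = "conformal V"
  let ?T = "\<lambda>i::nat. vscale V (of_int 1 gchoose i) (?md (?md ?\<omega> (int i) u) (1 + m - int i) v)"
  have L1: "?md ?\<omega> 0 u = virasoro_op V (adjoint V) (- 1) u"
    by (simp add: virasoro_op_def)
  have big: "?T i = 0" if "i \<ge> 2" for i
  proof -
    have "(1 choose i) = 0" using that by (intro binomial_eq_0) simp
    then have "(of_int 1 gchoose i :: complex) = 0"
      by (metis binomial_gbinomial of_int_1 of_nat_0 of_nat_1)
    then show ?thesis by simp
  qed
  have "{i. ?T i \<noteq> 0} \<subseteq> {..<2}"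
    using big unfolding subset_iff mem_Collect_eq lessThan_iff by (meson not_le)
  then have "Sum_any ?T = sum ?T {..<2}"
    by (intro Sum_any.expand_superset) simp_all
  also have "\<dots> = ?T 0 + ?T 1"
    by (simp add: numeral_2_eq_2)
  also have "?T 0 = vscale V (- of_int (m + 1)) (?md u m v)"
    by (simp only: L1 derivative_property of_nat_0 gbinomial_0 scale_one diff_0_right) simp
  also have "?T 1 = vscale V (of_int a) (?md u m v)"
    using u by (simp only: weight_space_iff adj_mode_scale_left of_nat_1 of_int_1 gbinomial_1 scale_one) simp
  finally have sum: "Sum_any ?T = vscale V (- of_int (m + 1)) (?md u m v) + vscale V (of_int a) (?md u m v)" .
  have "?md ?\<omega> 1 (?md u m v) = ?md u m (?md ?\<omega> 1 v) + Sum_any ?T"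
    using weak_module.mode_commutator[OF adjoint_weak_module, of ?\<omega> 1 u m v, unfolded mscale_adjoint]
    by (simp only: diff_eq_eq add.commute)
  also have "?md u m (?md ?\<omega> 1 v) = vscale V (of_int b) (?md u m v)"
    using v by (simp only: weight_space_iff adj_mode_scale_right)
  finally have "?md ?\<omega> 1 (?md u m v) = vscale V (of_int b) (?md u m v)
      + (vscale V (- of_int (m + 1)) (?md u m v) + vscale V (of_int a) (?md u m v))"
    unfolding sum .
  also have "\<dots> = vscale V (of_int (a + b - m - 1)) (?md u m v)"
    unfolding scale_left_distrib[symmetric] by (rule arg_cong[of _ _ "\<lambda>c. vscale V c _"]) simp
  finally show ?thesis by (simp add: weight_space_iff)
qed

lemma vacuum_weight: "vacuum V \<in> weight_space V 0"
  by (simp add: weight_space_iff creation_property(1))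

lemma conformal_weight: "conformal V \<in> weight_space V 2"
proof -
  let ?L = "virasoro_op V (adjoint V)"
  obtain c :: complex where c: "\<forall>l m v. ?L l (?L m v) - ?L m (?L l v) = vscale V (of_int (l - m)) (?L (l + m) v)
          + vscale V (if l + m = 0 then of_int (l ^ 3 - l) / 12 * c else 0) v"
    using virasoro_relations by blast
  have "?L (- 2) (vacuum V) = conformal V" "?L 0 (vacuum V) = 0"
    by (simp_all add: virasoro_op_def creation_property)
  moreover have "?L (- 2) 0 = 0" by (simp add: virasoro_op_def)
  moreover have "?L 0 (?L (- 2) (vacuum V)) - ?L (- 2) (?L 0 (vacuum V))
      = vscale V (of_int (0 - - 2)) (?L (0 + - 2) (vacuum V))
        + vscale V (if 0 + - 2 = (0::int) then of_int (0 ^ 3 - 0) / 12 * c else 0) (vacuum V)"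
    by (rule c[rule_format])
  ultimately show ?thesis by (simp add: weight_space_def)
qed

lemma weight_decomposition_component: "weight_decomposition V v (\<lambda>k. weight_component V k v)"
proof -
  have "weight_decomposition V v (THE f. weight_decomposition V v f)"
    by (rule theI'[OF weight_direct_sum])
  then show ?thesis by (simp add: weight_component_def)
qed

lemma weight_component_unique: "weight_decomposition V v f \<Longrightarrow> weight_component V k v = f k"
  unfolding weight_component_def by (subst the1_equality[OF weight_direct_sum]) simp_all

lemma weight_component_in: "weight_component V k v \<in> weight_space V k"
  and weight_component_finite: "finite {k. weight_component V k v \<noteq> 0}"
  and weight_component_Sum_any: "Sum_any (\<lambda>k. weight_component V k v) = v"
  using weight_decomposition_component[of v] by (simp_all add: weight_decomposition_def)

lemma weight_component_add: "weight_component V k (u + v) = weight_component V k u + weight_component V k v"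
proof (rule weight_component_unique)
  show "weight_decomposition V (u + v) (\<lambda>k. weight_component V k u + weight_component V k v)"
    unfolding weight_decomposition_def
  proof (intro conjI allI)
    show "weight_component V k u + weight_component V k v \<in> weight_space V k" for k
      by (intro weight_space_add weight_component_in)
    show "finite {k. weight_component V k u + weight_component V k v \<noteq> 0}"
      by (rule finite_subset[OF _ finite_UnI[OF weight_component_finite[of u] weight_component_finite[of v]]]) auto
    show "Sum_any (\<lambda>k. weight_component V k u + weight_component V k v) = u + v"
      by (simp only: Sum_any.distrib weight_component_finite weight_component_Sum_any)
  qed
qed

lemma weight_component_homogeneous:
  assumes "v \<in> weight_space V a"
  shows "weight_component V k v = (if k = a then v else 0)"
proof (rule weight_component_unique)
  show "weight_decomposition V v (\<lambda>k. if k = a then v else 0)"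
    using assms by (simp add: weight_decomposition_def)
qed

lemma weight_induct [case_names homogeneous add]:
  assumes hom: "\<And>a v. v \<in> weight_space V a \<Longrightarrow> P v"
    and add: "\<And>u v. P u \<Longrightarrow> P v \<Longrightarrow> P (u + v)"
  shows "P v"
proof -
  have "P (\<Sum>k\<in>K. weight_component V k v)" if "finite K" for K
    using that
    by (induction K rule: finite_induct)
      (auto intro!: add hom[OF weight_component_in] hom[OF weight_space_0])
  from this[OF weight_component_finite]
  have "P (\<Sum>k | weight_component V k v \<noteq> 0. weight_component V k v)" .
  then show ?thesis
    using weight_component_Sum_any[of v] by (simp only: Sum_any.expand_set)
qed

end

section \<open>The operators of the polynomial algebra\<close>

text \<open>
  For homogeneous \<open>v\<close> this is \<open>Res\<^sub>x f(x) (1 + x)\<^bsup>wt v - 1\<^esup> Y(v,x)w\<close>.  With this normalisation the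
  weights disappear from the formulas: the actions and the relations of \<open>A\<^sub>n(W)\<close> are given by
  polynomials in \<open>1/x\<close> that do not depend on \<open>v\<close>.
\<close>

definition act ::
    "('v::ab_group_add) vertex_data \<Rightarrow> ('v, 'w::ab_group_add) module_data \<Rightarrow> complex fls \<Rightarrow> 'v \<Rightarrow> 'w \<Rightarrow> 'w"
  where "act V W f v w = Sum_any (\<lambda>k. res W (f * Z powi (k - 1)) (weight_component V k v) w)"

context weak_module
begin

lemma act_homogeneous:
  assumes "v \<in> weight_space V a"
  shows "act V W f v w = res W (f * Z powi (a - 1)) v w"
proof -
  have "res W (f * Z powi (k - 1)) (weight_component V k v) w
      = (if k = a then res W (f * Z powi (k - 1)) v w else 0)" for k
    unfolding V.weight_component_homogeneous[OF assms] by simp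
  then show ?thesis by (simp add: act_def)
qed

lemma act_finite: "finite {k. res W (f k) (weight_component V k v) w \<noteq> 0}"
  by (rule finite_subset[OF _ V.weight_component_finite[of v]]) auto

lemma act_add: "act V W (f + g) v w = act V W f v w + act V W g v w"
  unfolding act_def Sum_any.distrib[OF act_finite act_finite, symmetric]
  by (simp only: distrib_right res_add)

lemma act_add_left: "act V W f (u + v) w = act V W f u w + act V W f v w"
  unfolding act_def Sum_any.distrib[OF act_finite act_finite, symmetric]
  by (simp only: V.weight_component_add res_add_left)

lemma act_add_right: "act V W f v (w + w') = act V W f v w + act V W f v w'"
  unfolding act_def Sum_any.distrib[OF act_finite act_finite, symmetric]
  by (simp only: res_add_right)

lemma act_const_mult: "act V W (fls_const c * f) v w = mscale W c (act V W f v w)"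
  unfolding act_def Sum_any_scale[OF act_finite, symmetric]
  by (simp only: mult.assoc res_const_mult)

lemma act_scale_right: "act V W f v (mscale W c w) = mscale W c (act V W f v w)"
  unfolding act_def Sum_any_scale[OF act_finite, symmetric]
  by (simp only: res_scale_right)

lemma act_scale_left: "act V W f (vscale V c v) w = mscale W c (act V W f v w)"
proof (induction v rule: V.weight_induct)
  case (homogeneous a v)
  then show ?case
    by (simp add: act_homogeneous[OF V.weight_space_scale[OF homogeneous]] act_homogeneous[OF homogeneous]
        res_scale_left)
next
  case (add u v)
  then show ?case
    by (simp only: V.scale_right_distrib W.scale_right_distrib act_add_left)
qed

lemma act_0 [simp]: "act V W 0 v w = 0" "act V W f 0 w = 0" "act V W f v 0 = 0"
  using act_add[of 0 0 v w] act_add_left[of f 0 0 w] act_add_right[of f v 0 0] by simp_all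

lemma act_minus: "act V W (- f) v w = - act V W f v w"
  using act_add[of f "- f" v w] by (intro minus_unique[symmetric]) simp

lemma act_minus_right: "act V W f v (- w) = - act V W f v w"
  using act_add_right[of f v w "- w"] by (intro minus_unique[symmetric]) simp

lemma act_diff: "act V W (f - g) v w = act V W f v w - act V W g v w"
  using act_add[of f "- g"] by (simp add: act_minus)

lemma act_diff_right: "act V W f v (w - w') = act V W f v w - act V W f v w'"
  using act_add_right[of f v w "- w'"] by (simp add: act_minus_right)

lemma act_sum: "act V W (sum f A) v w = (\<Sum>i\<in>A. act V W (f i) v w)"
  by (induction A rule: infinite_finite_induct) (simp_all add: act_add)

lemma act_sum_left: "act V W f (sum u A) w = (\<Sum>i\<in>A. act V W f (u i) w)"
  by (induction A rule: infinite_finite_induct) (simp_all add: act_add_left)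

lemma act_vacuum: "act V W f (vacuum V) w = mscale W ((f * Z powi (- 1)) $$ (- 1)) w"
proof -
  have "mscale W ((f * Z powi (- 1)) $$ i) (mode W (vacuum V) i w)
      = (if i = - 1 then mscale W ((f * Z powi (- 1)) $$ i) w else 0)" for i
    by (simp add: mvacuum_property)
  then show ?thesis by (simp add: act_homogeneous[OF V.vacuum_weight] res_def)
qed

text \<open>As \<open>\<omega>\<close> has weight 2, the left side is \<open>Res\<^sub>x (1 + x)Y(\<omega>,x)w\<close>.\<close>

lemma act_conformal: "act V W 1 (conformal V) w = virasoro_op V W (- 1) w + virasoro_op V W 0 w"
proof -
  have "Z powi 1 = Xp powi 0 + Xp powi 1" by (simp add: Z_def)
  then have "act V W 1 (conformal V) w = res W (Xp powi 0 + Xp powi 1) (conformal V) w"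
    by (simp add: act_homogeneous[OF V.conformal_weight])
  also have "\<dots> = virasoro_op V W (- 1) w + virasoro_op V W 0 w"
    unfolding res_add res_X_powi virasoro_op_def by simp
  finally show ?thesis .
qed

lemma res_L_minus_1: "res W f (virasoro_op V (adjoint V) (- 1) v) w = - res W (fls_deriv f) v w"
proof -
  have deriv: "fls_deriv f = hasse 1 f" for f
    by (simp add: hasse_Suc)
  let ?F = "\<lambda>f. res W f (virasoro_op V (adjoint V) (- 1) v) w + res W (hasse 1 f) v w"
  have "?F f = 0"
  proof (rule additive_eq_0I[where F = ?F])
    show "?F (f + g) = ?F f + ?F g" for f g
      by (simp only: hasse_add res_add ac_simps)
    show "?F (fls_const c * Xp powi m) = 0" for c m
      unfolding hasse_const_mult hasse_X_powi res_const_mult res_X_powi mode_L_minus_1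
      by simp
    have "high_order (\<lambda>f. res W (1 * f) (virasoro_op V (adjoint V) (- 1) v) w = 0 \<and> res W (hasse 1 f * 1) v w = 0)"
      by (intro high_order_conj high_order_res high_order_res_hasse)
    then show "high_order (\<lambda>f. ?F f = 0)"
      by (rule high_order_mono) simp
  qed
  then show ?thesis
    unfolding deriv by (rule eq_neg_iff_add_eq_0[THEN iffD2])
qed

text \<open>
  Integration by parts: \<open>L(-1)\<close> differentiates \<open>Y(v,x)\<close> and raises the weight by one, and the
  derivative that falls on the power of \<open>1 + x\<close> is cancelled by \<open>L(0)\<close>.
\<close>

lemma act_euler:
  "act V W (Z * fls_deriv f) v w
    = - act V W f (virasoro_op V (adjoint V) (- 1) v + virasoro_op V (adjoint V) 0 v) w"
proof (induction v rule: V.weight_induct)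
  case (homogeneous a v)
  have L1: "virasoro_op V (adjoint V) (- 1) v \<in> weight_space V (a + 1)"
    using V.mode_weight[OF V.conformal_weight homogeneous, of 0] by (simp add: virasoro_op_def algebra_simps)
  have L0: "virasoro_op V (adjoint V) 0 v = vscale V (of_int a) v"
    using homogeneous by (simp add: weight_space_def)
  have "act V W f (virasoro_op V (adjoint V) (- 1) v) w = - res W (fls_deriv (f * Z powi a)) v w"
    by (simp add: act_homogeneous[OF L1] res_L_minus_1)
  also have "fls_deriv (f * Z powi a)
      = fls_const (of_int a) * (f * Z powi (a - 1)) + (Z * fls_deriv f) * Z powi (a - 1)"
    unfolding fls_deriv_mult fls_deriv_Z_powi fls_of_int unfolding Z_powi_step[of a]
    by (simp only: ac_simps)
  finally show ?case
    unfolding act_add_left L0 act_scale_left res_add res_const_mult act_homogeneous[OF homogeneous]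
    by simp
next
  case (add u v)
  have L_add: "virasoro_op V (adjoint V) m (u + v) = virasoro_op V (adjoint V) m u + virasoro_op V (adjoint V) m v" for m
    by (simp only: virasoro_op_def V.adj_mode_add_right)
  show ?case
    unfolding L_add act_add_left using add.IH[unfolded act_add_left] by simp
qed

end

section \<open>Commutators and iterates\<close>

lemma Sum_any_int_to_nat:
  fixes f :: "int \<Rightarrow> 'b::ab_group_add"
  assumes "\<And>j. j < l \<Longrightarrow> f j = 0" "finite {j. f j \<noteq> 0}"
  shows "Sum_any f = Sum_any (\<lambda>i::nat. f (l + int i))"
proof -
  have inj: "inj_on (\<lambda>i. l + int i) A" for A
    by (rule inj_onI) simp
  have fin: "finite {i. f (l + int i) \<noteq> 0}"
    using finite_vimageI[OF assms(2) inj] by (simp add: vimage_def)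
  have "{j. f j \<noteq> 0} = (\<lambda>i. l + int i) ` {i. f (l + int i) \<noteq> 0}"
  proof (intro Set.set_eqI iffI)
    fix j
    assume "j \<in> {j. f j \<noteq> 0}"
    then have "f j \<noteq> 0" "l \<le> j" using assms(1)[of j] by (auto simp: not_less[symmetric])
    then show "j \<in> (\<lambda>i. l + int i) ` {i. f (l + int i) \<noteq> 0}"
      by (intro image_eqI[of _ _ "nat (j - l)"]) simp_all
  qed auto
  then show ?thesis
    unfolding Sum_any.expand_set by (simp add: sum.reindex[OF inj])
qed

definition pole_coeff :: "nat \<Rightarrow> nat \<Rightarrow> complex"
  where "pole_coeff N i = (- 1) ^ i * (- of_nat N gchoose i)"

context weak_module
begin

lemma act_Sum_any_left:
  assumes "finite {i. u i \<noteq> 0}"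
  shows "act V W f (Sum_any u) w = Sum_any (\<lambda>i. act V W f (u i) w)"
proof -
  have "Sum_any (\<lambda>i. act V W f (u i) w) = (\<Sum>i | u i \<noteq> 0. act V W f (u i) w)"
    by (rule Sum_any.expand_superset[OF assms]) auto
  then show ?thesis
    by (simp only: Sum_any.expand_set[of u] act_sum_left)
qed

text \<open>
  The Jacobi identity at \<open>l = 0\<close>: its left side is the commutator, and the Taylor coefficients
  of \<open>p(1/x)(1 + x)\<^bsup>a - 1\<^esup>\<close> are again of the form required by the weight of \<open>u\<^sub>i v\<close>.
\<close>

theorem act_commutator:
  assumes u: "u \<in> weight_space V a"
  shows "act V W (ev p) u (act V W g v w) - act V W g v (act V W (ev p) u w)
    = Sum_any (\<lambda>i. act V W (g * ev (taylor a p i)) (mode (adjoint V) u (int i) v) w)"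
proof (induction v rule: V.weight_induct)
  case (homogeneous b v)
  let ?f = "ev p * Z powi (a - 1)" and ?g = "g * Z powi (b - 1)"
  have L: "jacobi_lhs 0 u v w ?f ?g i
      = (if i = 0 then res W ?f u (res W ?g v w) - res W ?g v (res W ?f u w) else 0)" for i
    by (cases i) (simp_all add: jacobi_lhs_def)
  have R: "jacobi_rhs 0 u v w ?f ?g i
      = act V W (g * ev (taylor a p i)) (mode (adjoint V) u (int i) v) w" for i
  proof -
    have "mode (adjoint V) u (int i) v \<in> weight_space V (a + b - int i - 1)"
      by (rule V.mode_weight[OF u homogeneous])
    moreover have "Z powi (a - 1 - int i) * Z powi (b - 1) = Z powi (a + b - int i - 1 - 1)"
      by (simp add: algebra_simps flip: power_int_add)
    ultimately show ?thesis
      unfolding jacobi_rhs_def hasse_ev_Z_powi by (simp add: act_homogeneous ac_simps)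
  qed
  have "Sum_any (jacobi_lhs 0 u v w ?f ?g) = Sum_any (jacobi_rhs 0 u v w ?f ?g)"
    by (rule jacobi_residues)
  moreover have "Sum_any (jacobi_lhs 0 u v w ?f ?g) = res W ?f u (res W ?g v w) - res W ?g v (res W ?f u w)"
    unfolding L[abs_def] by simp
  moreover have "jacobi_rhs 0 u v w ?f ?g = (\<lambda>i. act V W (g * ev (taylor a p i)) (mode (adjoint V) u (int i) v) w)"
    by (rule ext) (rule R)
  ultimately show ?case
    by (simp only: act_homogeneous[OF u] act_homogeneous[OF homogeneous])
next
  case (add v v')
  have fin: "finite {i. act V W (g * ev (taylor a p i)) (mode (adjoint V) u (int i) v) w \<noteq> 0}" for v
  proof -
    obtain N where N: "\<forall>i\<ge>N. mode (adjoint V) u i v = 0"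
      using mode_eventually_0[of "adjoint V" u v] ..
    show ?thesis
      by (rule finite_nat_support[of "nat N"]) (simp add: N)
  qed
  show ?case
    unfolding V.adj_mode_add_right act_add_left act_add_right Sum_any.distrib[OF fin fin] add.IH[symmetric]
    by simp
qed

lemma res_binomial_series:
  "res W (Xp powi l * Z powi m) v w = Sum_any (\<lambda>i::nat. mscale W (of_int m gchoose i) (mode W v (l + int i) w))"
proof -
  have "res W (Xp powi l * Z powi m) v w
      = Sum_any (\<lambda>i::nat. mscale W ((Xp powi l * Z powi m) $$ (l + int i)) (mode W v (l + int i) w))"
    unfolding res_def
  proof (rule Sum_any_int_to_nat)
    show "mscale W ((Xp powi l * Z powi m) $$ j) (mode W v j w) = 0" if "j < l" for j
      unfolding X_powi_mult_nth Z_powi_nth using that by simp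
  qed (rule res_finite)
  then show ?thesis
    unfolding X_powi_mult_nth Z_powi_nth by simp
qed

lemma act_X_pow_eventually_0: "\<exists>n. \<forall>i\<ge>n. act V W (Xp ^ i * h) v w = 0"
proof (induction v rule: V.weight_induct)
  case (homogeneous a v)
  obtain n where n: "\<forall>i\<ge>n. res W (Xp ^ i * (h * Z powi (a - 1))) v w = 0"
    using res_X_pow_eventually_0[of "h * Z powi (a - 1)" v w] ..
  then show ?case
    by (intro exI[of _ n]) (simp add: act_homogeneous[OF homogeneous] mult.assoc)
next
  case (add u v)
  obtain m where m: "\<forall>i\<ge>m. act V W (Xp ^ i * h) u w = 0" using add.IH(1) ..
  obtain n where n: "\<forall>i\<ge>n. act V W (Xp ^ i * h) v w = 0" using add.IH(2) ..
  show ?case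
    by (rule exI[of _ "max m n"]) (simp add: m n act_add_left)
qed

text \<open>
  With \<open>z\<^sub>i = 1 + x\<^sub>i\<close>, the function \<open>z\<^sub>2\<^sup>p z\<^sub>1\<^sup>c (x\<^sub>1 - x\<^sub>2)\<^sup>-\<^sup>p\<^sup>-\<^sup>c\<close> is expanded in nonnegative powers of \<open>x\<^sub>2\<close>, and
  the two arguments of \<open>M\<close> receive the factors in \<open>x\<^sub>1\<close> and in \<open>x\<^sub>2\<close>.
\<close>

definition pole_pairing :: "(complex fls \<Rightarrow> complex fls \<Rightarrow> 'w) \<Rightarrow> nat \<Rightarrow> nat \<Rightarrow> 'w"
  where "pole_pairing M p c =
    Sum_any (\<lambda>i. mscale W (pole_coeff (p + c) i) (M (S ^ (p + i) * (1 + S) ^ c) (Xp ^ i * Z ^ p)))"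

lemma S_Z_pow: "S ^ k * Z ^ k = (1 + S) ^ k"
  by (simp only: power_mult_distrib[symmetric] S_Z)

lemma S_pow_Z_pow_mult: "S ^ (p + c + i) * Z ^ c = S ^ (p + i) * (1 + S) ^ c"
  unfolding S_Z_pow[symmetric] by (simp add: power_add)

text \<open>
  The component \<open>u\<^sub>jv\<close> has weight \<open>a + b - j - 1\<close>, so the outer operator contributes \<open>z\<^sub>2\<^bsup>-j\<^esup>\<close>; this rescales
  \<open>x\<^sub>0\<close> to \<open>(x\<^sub>1 - x\<^sub>2)/z\<^sub>2\<close>, under which \<open>s\<^sub>0 = z\<^sub>2/(x\<^sub>1 - x\<^sub>2)\<close> and \<open>1 + s\<^sub>0 = z\<^sub>1/(x\<^sub>1 - x\<^sub>2)\<close>.  The two terms are the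
  expansions of \<open>s\<^sub>0\<^sup>p(1 + s\<^sub>0)\<^sup>c\<close> for \<open>|x\<^sub>2| < |x\<^sub>1|\<close> and for \<open>|x\<^sub>1| < |x\<^sub>2|\<close>; in the second, exchanging the
  variables exchanges \<open>p\<close> and \<open>c\<close> up to sign.
\<close>

theorem act_iterate:
  assumes u: "u \<in> weight_space V a" and v: "v \<in> weight_space V b"
  shows "act V W f (act V (adjoint V) (S ^ p * (1 + S) ^ c) u v) w
    = pole_pairing (\<lambda>g h. act V W g u (act V W (h * f) v w)) p c
      - mscale W ((- 1) ^ (p + c)) (pole_pairing (\<lambda>g h. act V W (g * f) v (act V W h u w)) c p)"
proof -
  define l where "l = - int (p + c)"
  define F where "F = Z powi (a - 1 + int c)"
  define G where "G = f * Z powi (b - 1 + int p)"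
  let ?A = "\<lambda>i. mscale W (pole_coeff (p + c) i) (act V W (S ^ (p + i) * (1 + S) ^ c) u (act V W (Xp ^ i * Z ^ p * f) v w))"
  let ?B = "\<lambda>i. mscale W (pole_coeff (c + p) i) (act V W (S ^ (c + i) * (1 + S) ^ p * f) v (act V W (Xp ^ i * Z ^ c) u w))"
  have F: "F = Z ^ c * Z powi (a - 1)" and G: "G = Z ^ p * f * Z powi (b - 1)"
    by (simp_all add: F_def G_def power_int_add ac_simps)
  have pow: "Xp powi (l - int i) = S ^ (p + c + i)" for i
    unfolding S_pow_powi by (rule arg_cong[of _ _ "\<lambda>k. Xp powi k"]) (simp add: l_def)
  have pu: "Xp powi (l - int i) * F = S ^ (p + i) * (1 + S) ^ c * Z powi (a - 1)" for i
    unfolding pow F mult.assoc[symmetric] S_pow_Z_pow_mult ..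
  have pv: "Xp powi (l - int i) * G = S ^ (c + i) * (1 + S) ^ p * f * Z powi (b - 1)" for i
    unfolding pow G mult.assoc[symmetric] S_pow_Z_pow_mult[of c p, unfolded add.commute[of c p]] ..
  have sgn: "(- 1 :: complex) powi l = (- 1) ^ (p + c)"
    unfolding l_def power_int_minus by (simp only: power_int_of_nat) (simp flip: power_inverse)
  have L: "jacobi_lhs l u v w F G i = ?A i - mscale W ((- 1) ^ (p + c)) (?B i)" for i
  proof -
    have "jacobi_lhs l u v w F G i = mscale W (pole_coeff (p + c) i)
      (act V W (S ^ (p + i) * (1 + S) ^ c) u (act V W (Xp ^ i * Z ^ p * f) v w)
       - mscale W ((- 1) ^ (p + c)) (act V W (S ^ (c + i) * (1 + S) ^ p * f) v (act V W (Xp ^ i * Z ^ c) u w)))"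
      unfolding jacobi_lhs_def pu pv sgn act_homogeneous[OF u] act_homogeneous[OF v] pole_coeff_def
      unfolding F G l_def by (simp add: mult.assoc)
    then show ?thesis
      by (simp only: W.scale_right_diff_distrib W.scale_scale mult.commute add.commute[of c p])
  qed
  have R: "jacobi_rhs l u v w F G i
      = act V W f (vscale V (of_int (a - 1 + int c) gchoose i) (mode (adjoint V) u (l + int i) v)) w" for i
  proof -
    have "mode (adjoint V) u (l + int i) v \<in> weight_space V (a + b - (l + int i) - 1)"
      by (rule V.mode_weight[OF u v])
    moreover have "Z powi (a - 1 + int c - int i) * Z powi (b - 1 + int p) = Z powi (a + b - (l + int i) - 1 - 1)"
      unfolding l_def power_int_add[OF disjI1[OF Z_nonzero], symmetric]
      by (rule arg_cong[of _ _ "\<lambda>k. Z powi k"]) simp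
    ultimately show ?thesis
      unfolding jacobi_rhs_def F_def G_def hasse_Z_powi act_scale_left mult.assoc res_const_mult
      by (simp add: act_homogeneous mult.left_commute)
  qed
  have inner: "act V (adjoint V) (S ^ p * (1 + S) ^ c) u v
      = Sum_any (\<lambda>i. vscale V (of_int (a - 1 + int c) gchoose i) (mode (adjoint V) u (l + int i) v))"
  proof -
    have "S ^ p * (1 + S) ^ c * Z powi (a - 1) = Xp powi l * F"
      using pu[of 0] by simp
    then show ?thesis
      unfolding weak_module.act_homogeneous[OF V.adjoint_weak_module u]
      by (simp only: F_def weak_module.res_binomial_series[OF V.adjoint_weak_module] mscale_adjoint)
  qed
  have fin: "finite {i. vscale V (of_int (a - 1 + int c) gchoose i) (mode (adjoint V) u (l + int i) v) \<noteq> 0}"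
  proof -
    obtain N where N: "\<forall>i\<ge>N. mode (adjoint V) u i v = 0"
      using mode_eventually_0[of "adjoint V" u v] ..
    show ?thesis
      by (rule finite_nat_support[of "nat (N - l)"]) (simp add: N)
  qed
  have "act V W f (act V (adjoint V) (S ^ p * (1 + S) ^ c) u v) w = Sum_any (jacobi_rhs l u v w F G)"
    unfolding inner act_Sum_any_left[OF fin] by (rule Sum_any.cong) (rule R[symmetric])
  also have "\<dots> = Sum_any (jacobi_lhs l u v w F G)"
    by (rule jacobi_residues[symmetric])
  also have "\<dots> = Sum_any (\<lambda>i. ?A i + mscale W (- ((- 1) ^ (p + c))) (?B i))"
    by (rule Sum_any.cong) (simp add: L)
  also have "\<dots> = Sum_any ?A + Sum_any (\<lambda>i. mscale W (- ((- 1) ^ (p + c))) (?B i))"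
  proof (rule Sum_any.distrib)
    obtain m where m: "\<forall>i\<ge>m. act V W (Xp ^ i * (Z ^ p * f)) v w = 0"
      using act_X_pow_eventually_0[of "Z ^ p * f" v w] ..
    then show "finite {i. ?A i \<noteq> 0}"
      by (intro finite_nat_support[of m]) (simp add: mult.assoc)
  next
    obtain n where n: "\<forall>i\<ge>n. act V W (Xp ^ i * Z ^ c) u w = 0"
      using act_X_pow_eventually_0[of "Z ^ c" u w] ..
    then show "finite {i. mscale W (- ((- 1) ^ (p + c))) (?B i) \<noteq> 0}"
      by (intro finite_nat_support[of n]) simp
  qed
  also have "Sum_any (\<lambda>i. mscale W (- ((- 1) ^ (p + c))) (?B i)) = mscale W (- ((- 1) ^ (p + c))) (Sum_any ?B)"
  proof (rule Sum_any_scale)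
    obtain n where n: "\<forall>i\<ge>n. act V W (Xp ^ i * Z ^ c) u w = 0"
      using act_X_pow_eventually_0[of "Z ^ c" u w] ..
    then show "finite {i. ?B i \<noteq> 0}"
      by (intro finite_nat_support[of n]) simp
  qed
  finally show ?thesis
    unfolding pole_pairing_def by simp
qed

end

section \<open>Pole expansions as functionals on polynomials\<close>

lemma pole_coeff_0 [simp]: "pole_coeff N 0 = 1" "pole_coeff 0 i = (if i = 0 then 1 else 0)"
  by (auto simp: pole_coeff_def gbinomial_0_left)

lemma pole_coeff_Suc: "pole_coeff (Suc N) (Suc i) = pole_coeff N (Suc i) + pole_coeff (Suc N) i"
proof -
  have "(- of_nat N gchoose Suc i :: complex) = (- of_nat (Suc N) gchoose i) + (- of_nat (Suc N) gchoose Suc i)"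
    using gbinomial_Suc_Suc[of "- of_nat (Suc N) :: complex" i] by simp
  then show ?thesis by (simp add: pole_coeff_def algebra_simps)
qed

context weak_module
begin

text \<open>
  What the expansion needs of \<open>M\<close>: bilinearity, and vanishing on high powers of \<open>x\<^sub>2\<close>, which makes the
  expansion a finite sum
\<close>

definition residue_pairing :: "(complex fls \<Rightarrow> complex fls \<Rightarrow> 'w) \<Rightarrow> bool"
  where "residue_pairing M \<longleftrightarrow>
    (\<forall>g g' h. M (g + g') h = M g h + M g' h) \<and>
    (\<forall>g h h'. M g (h + h') = M g h + M g h') \<and>
    (\<forall>c g h. M (fls_const c * g) h = mscale W c (M g h)) \<and>
    (\<forall>c g h. M g (fls_const c * h) = mscale W c (M g h)) \<and>
    (\<forall>h. \<exists>n. \<forall>i\<ge>n. \<forall>g. M g (Xp ^ i * h) = 0)"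

lemma residue_pairing_sum:
  assumes "residue_pairing M"
  shows "M (sum f A) h = (\<Sum>i\<in>A. M (f i) h)" "M h (sum f A) = (\<Sum>i\<in>A. M h (f i))"
proof -
  have add: "M (g + g') h = M g h + M g' h" "M g (h + h') = M g h + M g h'" for g g' h h'
    using assms by (simp_all add: residue_pairing_def)
  have zero: "M 0 h = 0" "M g 0 = 0" for g h
    using add(1)[of 0 0 h] add(2)[of g 0 0] by simp_all
  show "M (sum f A) h = (\<Sum>i\<in>A. M (f i) h)" "M h (sum f A) = (\<Sum>i\<in>A. M h (f i))"
    by (induction A rule: infinite_finite_induct; simp add: add zero)+
qed

lemma residue_pairing_nilpotent:
  assumes "residue_pairing M"
  shows "\<exists>n. \<forall>i\<ge>n. \<forall>g. M g (Xp ^ i * h) = 0"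
  using assms by (simp add: residue_pairing_def)

lemma pole_pairing_sum:
  assumes n: "\<forall>i\<ge>n. \<forall>g. M g (Xp ^ i * Z ^ p) = 0" and "n \<le> K"
  shows "pole_pairing M p c
    = (\<Sum>i<K. mscale W (pole_coeff (p + c) i) (M (S ^ (p + i) * (1 + S) ^ c) (Xp ^ i * Z ^ p)))"
  unfolding pole_pairing_def
proof (rule Sum_any.expand_superset)
  let ?t = "\<lambda>i. mscale W (pole_coeff (p + c) i) (M (S ^ (p + i) * (1 + S) ^ c) (Xp ^ i * Z ^ p))"
  have "?t i = 0" if "\<not> i < K" for i
    using that \<open>n \<le> K\<close> n by simp
  then show "{i. ?t i \<noteq> 0} \<subseteq> {..<K}"
    unfolding subset_iff mem_Collect_eq lessThan_iff by blast
qed simp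

text \<open>
  Both terms on the right have the common denominator \<open>(x\<^sub>1 - x\<^sub>2)\<^sup>p\<^sup>+\<^sup>c\<^sup>+\<^sup>1\<close>, and \<open>(x\<^sub>1 - x\<^sub>2) + z\<^sub>2 = z\<^sub>1\<close>.
\<close>

lemma pole_pairing_pascal:
  assumes M: "residue_pairing M"
  shows "pole_pairing M p (Suc c) = pole_pairing M p c + pole_pairing M (Suc p) c"
proof -
  let ?m = "\<lambda>j i. M (S ^ (p + j) * (1 + S) ^ c) (Xp ^ i * Z ^ p)"
  have add: "M (g + g') h = M g h + M g' h" "M g (h + h') = M g h + M g h'" for g g' h h'
    using M by (simp_all add: residue_pairing_def)
  obtain n1 where n1: "\<forall>i\<ge>n1. \<forall>g. M g (Xp ^ i * Z ^ p) = 0"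
    using residue_pairing_nilpotent[OF M, of "Z ^ p"] ..
  obtain n2 where n2: "\<forall>i\<ge>n2. \<forall>g. M g (Xp ^ i * Z ^ Suc p) = 0"
    using residue_pairing_nilpotent[OF M, of "Z ^ Suc p"] ..
  define K where "K = max n1 n2"
  have K: "n1 \<le> Suc K" "n2 \<le> Suc K" "n1 \<le> K" by (simp_all add: K_def)
  note sums = pole_pairing_sum[OF n1 K(1), of "Suc c"] pole_pairing_sum[OF n1 K(1), of c]
    pole_pairing_sum[OF n2 K(2), of c]
  let ?c = "pole_coeff (Suc (p + c))" and ?d = "pole_coeff (p + c)"
  have top: "?m j K = 0" "?m j (Suc K) = 0" for j
    using n1[rule_format, OF K(3)] n1[rule_format, OF K(1)] by simp_all
  have "M (S ^ (p + i) * (1 + S) ^ Suc c) (Xp ^ i * Z ^ p) = ?m i i + ?m (Suc i) i" for i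
    unfolding add(1)[symmetric] by (rule arg_cong[of _ _ "\<lambda>g. M g _"]) (simp add: algebra_simps)
  then have 1: "pole_pairing M p (Suc c)
      = (\<Sum>i<Suc K. mscale W (?c i) (?m i i)) + (\<Sum>i<Suc K. mscale W (?c i) (?m (Suc i) i))"
    by (simp only: sums(1) add_Suc_right W.scale_right_distrib sum.distrib)
  have "M (S ^ (Suc p + i) * (1 + S) ^ c) (Xp ^ i * Z ^ Suc p) = ?m (Suc i) i + ?m (Suc i) (Suc i)" for i
  proof -
    have "Xp ^ i * Z ^ Suc p = Xp ^ i * Z ^ p + Xp ^ Suc i * Z ^ p"
      unfolding power_Suc[of Z] by (simp add: Z_def algebra_simps)
    then show ?thesis
      by (simp only: add(2)) simp
  qed
  then have 2: "pole_pairing M (Suc p) c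
      = (\<Sum>i<Suc K. mscale W (?c i) (?m (Suc i) i)) + (\<Sum>i<Suc K. mscale W (?c i) (?m (Suc i) (Suc i)))"
    by (simp only: sums(3) add_Suc W.scale_right_distrib sum.distrib)
  have "(\<Sum>i<Suc K. mscale W (?c i) (?m i i))
      = ?m 0 0 + (\<Sum>i<K. mscale W (?c (Suc i)) (?m (Suc i) (Suc i)))"
    by (simp only: sum.lessThan_Suc_shift) simp
  also have "\<dots> = (?m 0 0 + (\<Sum>i<K. mscale W (?d (Suc i)) (?m (Suc i) (Suc i))))
      + (\<Sum>i<K. mscale W (?c i) (?m (Suc i) (Suc i)))"
    by (simp only: pole_coeff_Suc W.scale_left_distrib sum.distrib add.assoc)
  also have "?m 0 0 + (\<Sum>i<K. mscale W (?d (Suc i)) (?m (Suc i) (Suc i))) = pole_pairing M p c"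
    unfolding sums(2) by (simp only: sum.lessThan_Suc_shift) simp
  also have "(\<Sum>i<K. mscale W (?c i) (?m (Suc i) (Suc i))) = (\<Sum>i<Suc K. mscale W (?c i) (?m (Suc i) (Suc i)))"
    by (simp only: sum.lessThan_Suc[of _ K] top W.scale_zero_right add_0_right)
  finally show ?thesis
    unfolding 1 2 by simp
qed

definition pole_functional :: "(complex fls \<Rightarrow> complex fls \<Rightarrow> 'w) \<Rightarrow> complex poly \<Rightarrow> 'w"
  where "pole_functional M g = Sum_any (\<lambda>j. mscale W (coeff g j) (pole_pairing M j 0))"

lemma pole_functional_finite: "finite {j. mscale W (coeff g j) (f j) \<noteq> 0}"
  by (rule finite_nat_support[of "Suc (degree g)"]) (simp add: coeff_eq_0)

lemma pole_functional_add: "pole_functional M (g + h) = pole_functional M g + pole_functional M h"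
  unfolding pole_functional_def Sum_any.distrib[OF pole_functional_finite pole_functional_finite, symmetric]
  by (simp only: coeff_add W.scale_left_distrib)

lemma pole_functional_smult: "pole_functional M (smult c g) = mscale W c (pole_functional M g)"
  unfolding pole_functional_def Sum_any_scale[OF pole_functional_finite, symmetric]
  by (simp only: coeff_smult W.scale_scale)

lemma pole_functional_0: "pole_functional M 0 = 0"
  by (simp add: pole_functional_def)

lemma pole_functional_sum: "pole_functional M (sum g A) = (\<Sum>i\<in>A. pole_functional M (g i))"
  by (induction A rule: infinite_finite_induct) (simp_all add: pole_functional_add pole_functional_0)

lemma pole_functional_diff: "pole_functional M (g - h) = pole_functional M g - pole_functional M h"
  using pole_functional_add[of M "g - h" h] by (simp add: eq_diff_eq)

text \<open>
  The Pascal relation says that \<open>pole_pairing M\<close> respects \<open>s\<^sup>p (1 + s)\<^sup>c\<^sup>+\<^sup>1 = s\<^sup>p (1 + s)\<^sup>c + s\<^sup>p\<^sup>+\<^sup>1 (1 + s)\<^sup>c\<close>,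
  so it depends on the polynomial only.
\<close>

lemma pole_functional_monomial:
  assumes M: "residue_pairing M"
  shows "pole_functional M (s_poly ^ p * t_poly ^ c) = pole_pairing M p c"
proof (induction c arbitrary: p)
  case 0
  have "mscale W (coeff (s_poly ^ p) j) (pole_pairing M j 0) = (if j = p then pole_pairing M j 0 else 0)" for j
    by (simp add: monom_altdef[of 1 p, simplified, symmetric])
  then show ?case
    by (simp add: pole_functional_def)
next
  case (Suc c)
  have "t_poly = 1 + s_poly" by (simp add: one_pCons)
  then have "s_poly ^ p * t_poly ^ Suc c = s_poly ^ p * t_poly ^ c + s_poly ^ Suc p * t_poly ^ c"
    by (simp only: power_Suc distrib_left distrib_right mult_1_left ac_simps)
  then show ?case
    by (simp only: pole_functional_add Suc.IH pole_pairing_pascal[OF M])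
qed

end

section \<open>The idempotent of the left action\<close>

text \<open>
  Collecting the powers of \<open>x\<close> and \<open>1 + x\<close> in the definitions of the actions and of \<open>O'\<^sub>n(W)\<close> by means of
  \<open>s(1 + x) = 1 + s\<close> leaves these polynomials.
\<close>

definition left_coeff :: "nat \<Rightarrow> nat \<Rightarrow> complex"
  where "left_coeff n m = (- of_nat n - 1) gchoose m"

definition ideal_poly :: "nat \<Rightarrow> complex poly"
  where "ideal_poly n = s_poly ^ (n + 1) * t_poly ^ (n + 1)"

definition left_poly :: "nat \<Rightarrow> complex poly"
  where "left_poly n = (\<Sum>m\<le>n. smult (left_coeff n m) (s_poly ^ m * t_poly ^ (n + 1)))"

definition right_poly :: "nat \<Rightarrow> complex poly"
  where "right_poly n = (\<Sum>m\<le>n. smult (left_coeff n m * (- 1) ^ (n - m)) (s_poly ^ (n + 1) * t_poly ^ m))"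

lemma s_pow_dvd_iff: "s_poly ^ k dvd p \<longleftrightarrow> (\<forall>i<k. coeff p i = 0)" for p :: "complex poly"
  using monom_1_dvd_iff'[of k p] by (simp add: monom_altdef)

lemma coeff_s_pow_mult: "coeff (s_poly ^ m * p) k = (if k < m then 0 else coeff p (k - m))" for p :: "complex poly"
  using coeff_monom_mult[of 1 m p k] by (simp add: monom_altdef)

lemma coeff_t_pow: "coeff (t_poly ^ N) k = (of_nat N gchoose k :: complex)"
proof (cases "k \<le> N")
  case True
  then show ?thesis by (simp add: coeff_linear_poly_power binomial_gbinomial)
next
  case False
  have "degree (t_poly ^ N) \<le> N"
    using degree_power_le[of t_poly N] by simp
  with False have "coeff (t_poly ^ N) k = 0" by (intro coeff_eq_0) simp
  then show ?thesis using False by (simp flip: binomial_gbinomial)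
qed

lemma t_dvd_left_poly: "t_poly ^ (n + 1) dvd left_poly n"
  unfolding left_poly_def by (intro dvd_sum dvd_smult dvd_triv_right)

text \<open>\<open>left_poly n\<close> is \<open>(1 + s)\<^sup>n\<^sup>+\<^sup>1\<close> times the truncated binomial series of \<open>(1 + s)\<^sup>-\<^sup>n\<^sup>-\<^sup>1\<close>.\<close>

lemma s_dvd_left_poly: "s_poly ^ (n + 1) dvd left_poly n - 1"
  unfolding s_pow_dvd_iff
proof (intro allI impI)
  fix k
  assume k: "k < n + 1"
  have "coeff (left_poly n) k = (\<Sum>m\<le>n. if k < m then 0 else left_coeff n m * (of_nat (n + 1) gchoose (k - m)))"
    unfolding left_poly_def coeff_sum coeff_smult coeff_s_pow_mult coeff_t_pow
    by (rule sum.cong) simp_all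
  also have "\<dots> = (\<Sum>m\<le>k. left_coeff n m * (of_nat (n + 1) gchoose (k - m)))"
    by (rule sum.mono_neutral_cong_right) (use k in auto)
  also have "\<dots> = (0 gchoose k)"
    using gbinomial_Vandermonde[of "- of_nat n - 1 :: complex" "of_nat (n + 1)" k]
    by (simp add: left_coeff_def atLeast0AtMost)
  finally show "coeff (left_poly n - 1) k = 0"
    by (cases k) simp_all
qed

lemma coprime_s_t: "coprime (s_poly ^ k) (t_poly ^ l :: complex poly)"
proof (rule coprime_power_left_iff[THEN iffD2], rule disjI1, rule coprime_power_right_iff[THEN iffD2], rule disjI1)
  show "coprime s_poly (t_poly :: complex poly)"
  proof (rule coprimeI)
    fix d :: "complex poly"
    assume "d dvd s_poly" "d dvd t_poly"
    then have "d dvd t_poly - s_poly" by (rule dvd_diff[rotated])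
    then show "d dvd 1" by (simp add: one_pCons)
  qed
qed

lemma ideal_poly_dvdI:
  "s_poly ^ (n + 1) dvd p \<Longrightarrow> t_poly ^ (n + 1) dvd p \<Longrightarrow> ideal_poly n dvd p"
  unfolding ideal_poly_def by (rule divides_mult) (simp_all only: coprime_s_t)

lemma ideal_dvd_idempotent: "ideal_poly n dvd left_poly n * (left_poly n - 1)"
  by (intro ideal_poly_dvdI dvd_mult2[OF t_dvd_left_poly] dvd_mult[OF s_dvd_left_poly])

lemma euler_diff: "euler (p - q) = euler p - euler q"
  using euler_add[of "p - q" q] by (simp add: eq_diff_eq)

lemma euler_1 [simp]: "euler 1 = 0"
  by (simp add: euler_def)

text \<open>
  A derivation that maps \<open>c\<close> to a multiple of \<open>c\<close> does the same to the ideal of \<open>c\<^sup>k\<close>.  For the Euler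
  operator this applies to \<open>s\<close> and to \<open>1 + s\<close>, because of its factor \<open>s(1 + s)\<close>.
\<close>

lemma pow_dvd_euler:
  assumes "c dvd euler c" "c ^ k dvd p"
  shows "c ^ k dvd euler p"
proof -
  have pow: "c ^ j dvd euler (c ^ j)" for j
  proof (induction j)
    case (Suc j)
    then show ?case
      unfolding power_Suc euler_mult by (intro dvd_add mult_dvd_mono assms dvd_refl)
  qed simp
  obtain r where "p = c ^ k * r" using assms(2) by blast
  then show ?thesis
    unfolding \<open>p = c ^ k * r\<close> euler_mult by (intro dvd_add dvd_mult2[OF pow] dvd_triv_left)
qed

lemma s_dvd_euler: "s_poly dvd euler s_poly" and t_dvd_euler: "t_poly dvd euler t_poly"
  unfolding euler_def by (simp_all only: dvd_minus_iff dvd_mult2 dvd_triv_left dvd_triv_right)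

lemma ideal_dvd_euler: "ideal_poly n dvd p \<Longrightarrow> ideal_poly n dvd euler p"
  unfolding ideal_poly_def
  by (metis ideal_poly_def ideal_poly_dvdI pow_dvd_euler s_dvd_euler t_dvd_euler dvd_mult_left dvd_mult_right)

lemma ideal_dvd_euler_left_poly: "ideal_poly n dvd euler (left_poly n)"
proof (rule ideal_poly_dvdI)
  show "s_poly ^ (n + 1) dvd euler (left_poly n)"
    using pow_dvd_euler[OF s_dvd_euler s_dvd_left_poly] by (simp only: euler_diff euler_1 diff_0_right)
  show "t_poly ^ (n + 1) dvd euler (left_poly n)"
    by (rule pow_dvd_euler[OF t_dvd_euler t_dvd_left_poly])
qed

text \<open>
  The substitution \<open>s \<mapsto> -1 - s\<close> exchanges \<open>s\<close> and \<open>1 + s\<close> up to sign, hence exchanges the two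
  complementary idempotents modulo \<open>s\<^sup>n\<^sup>+\<^sup>1(1 + s)\<^sup>n\<^sup>+\<^sup>1\<close>; as the degrees are at most \<open>2n + 1\<close>, exactly.
\<close>

lemma right_poly_eq: "right_poly n = left_poly n - 1"
proof -
  let ?c = "\<lambda>p. pcompose p [:- 1, - 1:]"
  have s: "?c s_poly = - t_poly" and t: "?c t_poly = - s_poly"
    by (simp_all add: pcompose_pCons)
  have pow: "?c (p ^ k) = ?c p ^ k" for p :: "complex poly" and k
    by (induction k) (simp_all add: pcompose_mult pcompose_1)
  have st: "?c (s_poly ^ m * t_poly ^ (n + 1)) = smult ((- 1) ^ (m + (n + 1))) (s_poly ^ (n + 1) * t_poly ^ m)" for m
  proof -
    have neg: "(- p) ^ k = smult ((- 1) ^ k) (p ^ k)" for p :: "complex poly" and k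
      by (induction k) simp_all
    show ?thesis unfolding pcompose_mult pow s t neg by (simp add: power_add mult.commute)
  qed
  have sign: "(- 1 :: complex) ^ (m + (n + 1)) = - ((- 1) ^ (n - m))" if "m \<le> n" for m
  proof -
    have "(- 1 :: complex) ^ (m + (n + 1)) = (- 1) ^ (2 * m + 1 + (n - m))"
      using that by (intro arg_cong[of _ _ "\<lambda>k. (- 1) ^ k"]) simp
    then show ?thesis by (simp add: power_add)
  qed
  have refl: "?c (left_poly n) = - right_poly n"
  proof -
    have "?c (left_poly n) = (\<Sum>m\<le>n. smult (left_coeff n m) (?c (s_poly ^ m * t_poly ^ (n + 1))))"
      unfolding left_poly_def by (simp only: pcompose_sum pcompose_smult)
    also have "\<dots> = (\<Sum>m\<le>n. - smult (left_coeff n m * (- 1) ^ (n - m)) (s_poly ^ (n + 1) * t_poly ^ m))"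
    proof (rule sum.cong[OF refl])
      fix m
      assume "m \<in> {..n}"
      then have "m \<le> n" by simp
      show "smult (left_coeff n m) (?c (s_poly ^ m * t_poly ^ (n + 1)))
          = - smult (left_coeff n m * (- 1) ^ (n - m)) (s_poly ^ (n + 1) * t_poly ^ m)"
        unfolding st sign[OF \<open>m \<le> n\<close>] smult_minus_left smult_minus_right smult_smult ..
    qed
    finally show ?thesis by (simp only: right_poly_def sum_negf)
  qed
  define d where "d = right_poly n - (left_poly n - 1)"
  have "s_poly ^ (n + 1) dvd right_poly n"
    unfolding right_poly_def by (intro dvd_sum dvd_smult dvd_triv_left)
  then have 1: "s_poly ^ (n + 1) dvd d"
    unfolding d_def by (rule dvd_diff[OF _ s_dvd_left_poly])
  have "?c (s_poly ^ (n + 1)) dvd ?c (left_poly n - 1)"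
  proof -
    obtain r where "left_poly n - 1 = s_poly ^ (n + 1) * r"
      using s_dvd_left_poly[of n] unfolding dvd_def ..
    then show ?thesis by (simp only: pcompose_mult dvd_triv_left)
  qed
  then have "t_poly ^ (n + 1) dvd - right_poly n - 1"
    unfolding pcompose_diff pcompose_1 refl pow s
    by (metis dvd_trans power_minus dvd_triv_right)
  then have "t_poly ^ (n + 1) dvd - (- right_poly n - 1) - left_poly n"
    using t_dvd_left_poly by (rule dvd_diff[OF dvd_minus_iff[THEN iffD2]])
  then have 2: "t_poly ^ (n + 1) dvd d"
    by (simp add: d_def algebra_simps)
  have deg_st: "degree (s_poly ^ k * t_poly ^ l) \<le> k + l" for k l
    using degree_mult_le[of "s_poly ^ k" "t_poly ^ l"] degree_power_le[of s_poly k] degree_power_le[of t_poly l]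
    by simp
  have "degree (left_poly n) \<le> 2 * n + 1" "degree (right_poly n) \<le> 2 * n + 1"
    unfolding left_poly_def right_poly_def
    by (intro degree_sum_le order_trans[OF degree_smult_le] order_trans[OF deg_st]; simp)+
  then have deg: "degree d \<le> 2 * n + 1"
    unfolding d_def by (intro degree_diff_le) simp_all
  have "d = 0"
  proof (rule ccontr)
    assume "d \<noteq> 0"
    then have "degree (ideal_poly n) \<le> degree d"
      by (intro dvd_imp_degree_le ideal_poly_dvdI 1 2)
    moreover have "degree (ideal_poly n) = 2 * n + 2"
    proof -
      have nz: "s_poly \<noteq> (0 :: complex poly)" "t_poly \<noteq> (0 :: complex poly)" by simp_all
      then have "degree (ideal_poly n) = degree (s_poly ^ (n + 1) :: complex poly) + degree (t_poly ^ (n + 1) :: complex poly)"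
        unfolding ideal_poly_def by (intro degree_mult_eq) (simp_all only: power_eq_0_iff simp_thms)
      then show ?thesis by (simp only: degree_power_eq[OF nz(1)] degree_power_eq[OF nz(2)]) simp
    qed
    ultimately show False using deg by simp
  qed
  then show ?thesis by (simp add: d_def)
qed

lemma ev_s_t: "ev (s_poly ^ p * t_poly ^ c) = S ^ p * (1 + S) ^ c"
  by simp

lemma sum_triangle:
  fixes G :: "nat \<Rightarrow> nat \<Rightarrow> 'b::comm_monoid_add"
  shows "(\<Sum>m\<le>n. \<Sum>i\<le>n - m. G m i) = (\<Sum>k\<le>n. \<Sum>m\<le>k. G m (k - m))"
proof -
  have "(\<Sum>m\<le>n. \<Sum>i\<le>n - m. G m i) = (\<Sum>(m, i)\<in>Sigma {..n} (\<lambda>m. {..n - m}). G m i)"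
    by (rule sum.Sigma) simp_all
  also have "Sigma {..n} (\<lambda>m. {..n - m}) = {(m, i). m + i \<le> n}"
    by auto
  finally show ?thesis by (simp only: sum.triangle_reindex_eq)
qed

context weak_module
begin

text \<open>
  Modulo multiples of \<open>s\<^sup>n\<^sup>+\<^sup>1(1 + s)\<^sup>n\<^sup>+\<^sup>1\<close> in the first argument, the pole expansion of the idempotent
  collapses to \<open>\<Sum>\<^sub>k a\<^sub>k s\<^sup>k(1 + s)\<^sup>n\<^sup>+\<^sup>1 (z\<^sub>2 - x\<^sub>2)\<^sup>k\<close>, and \<open>z\<^sub>2 - x\<^sub>2 = 1\<close>.
\<close>

theorem pole_functional_left_poly:
  assumes M: "residue_pairing M" and U: "W.subspace U"
    and ideal: "\<And>r h. M (ev (ideal_poly n * r)) h \<in> U"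
  shows "pole_functional M (left_poly n) - M (ev (left_poly n)) 1 \<in> U"
proof -
  let ?t = "\<lambda>m i. mscale W (pole_coeff (m + (n + 1)) i) (M (S ^ (m + i) * (1 + S) ^ (n + 1)) (Xp ^ i * Z ^ m))"
  have lin: "M (fls_const c * g) h = mscale W c (M g h)" "M g (fls_const c * h) = mscale W c (M g h)" for c g h
    using M by (simp_all add: residue_pairing_def)
  have high: "?t m i \<in> U" if "n < m + i" for m i
  proof -
    have "S ^ (m + i) * (1 + S) ^ (n + 1) = ev (ideal_poly n * s_poly ^ (m + i - (n + 1)))"
    proof -
      have "n + 1 + (m + i - (n + 1)) = m + i" using that by simp
      then have "s_poly ^ (m + i) = s_poly ^ (n + 1) * s_poly ^ (m + i - (n + 1))"
        by (simp only: power_add[symmetric])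
      then have "s_poly ^ (m + i) * t_poly ^ (n + 1) = ideal_poly n * s_poly ^ (m + i - (n + 1))"
        unfolding ideal_poly_def by (simp only: ac_simps)
      then show ?thesis by (simp only: ev_s_t[symmetric])
    qed
    then show ?thesis using ideal by (simp only: W.subspace_scale[OF U])
  qed
  have trunc: "pole_pairing M m (n + 1) - (\<Sum>i\<le>n - m. ?t m i) \<in> U" for m
  proof -
    obtain N where N: "\<forall>i\<ge>N. \<forall>g. M g (Xp ^ i * Z ^ m) = 0"
      using residue_pairing_nilpotent[OF M, of "Z ^ m"] ..
    define K where "K = N + Suc n"
    have "pole_pairing M m (n + 1) = (\<Sum>i<K. ?t m i)"
      by (rule pole_pairing_sum[OF N]) (simp add: K_def)
    also have "\<dots> = (\<Sum>i\<in>{..<K} - {..n - m}. ?t m i) + (\<Sum>i\<le>n - m. ?t m i)"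
      by (rule sum.subset_diff) (auto simp: K_def)
    finally have "pole_pairing M m (n + 1) - (\<Sum>i\<le>n - m. ?t m i) = (\<Sum>i\<in>{..<K} - {..n - m}. ?t m i)"
      by simp
    also have "\<dots> \<in> U"
      by (rule W.subspace_sum[OF U]) (rule high, auto)
    finally show ?thesis .
  qed
  have inner: "(\<Sum>m\<le>k. mscale W (left_coeff n m) (?t m (k - m)))
      = mscale W (left_coeff n k) (M (S ^ k * (1 + S) ^ (n + 1)) 1)" for k
  proof -
    let ?s = "S ^ k * (1 + S) ^ (n + 1)"
    have coeff: "left_coeff n m * pole_coeff (m + (n + 1)) (k - m)
        = left_coeff n k * (of_nat (k choose m) * (- 1) ^ (k - m))" if "m \<le> k" for m
    proof -
      have "- of_nat n - 1 - of_nat m = (- of_nat (m + (n + 1)) :: complex)" by simp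
      then have eq: "left_coeff n m * (- of_nat (m + (n + 1)) gchoose (k - m)) = left_coeff n k * of_nat (k choose m)"
        using gbinomial_trinomial_revision[OF that, of "- of_nat n - 1 :: complex"]
        by (simp only: left_coeff_def binomial_gbinomial)
      have swap: "x * (e * y) = z * (c * e)" if "x * y = z * c" for x y z c e :: complex
        unfolding mult.left_commute[of x e] that by (simp only: ac_simps)
      show ?thesis
        unfolding pole_coeff_def by (rule swap[OF eq])
    qed
    have "(\<Sum>m\<le>k. mscale W (left_coeff n m) (?t m (k - m)))
        = (\<Sum>m\<le>k. M ?s (fls_const (left_coeff n k * (of_nat (k choose m) * (- 1) ^ (k - m))) * (Xp ^ (k - m) * Z ^ m)))"
    proof (rule sum.cong[OF refl])
      fix m
      assume "m \<in> {..k}"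
      then have m: "m \<le> k" by simp
      then have "m + (k - m) = k" by simp
      then show "mscale W (left_coeff n m) (?t m (k - m))
          = M ?s (fls_const (left_coeff n k * (of_nat (k choose m) * (- 1) ^ (k - m))) * (Xp ^ (k - m) * Z ^ m))"
        by (simp only: W.scale_scale coeff[OF m] lin)
    qed
    also have "\<dots> = M ?s (\<Sum>m\<le>k. fls_const (left_coeff n k * (of_nat (k choose m) * (- 1) ^ (k - m))) * (Xp ^ (k - m) * Z ^ m))"
      by (simp only: residue_pairing_sum[OF M])
    also have "(\<Sum>m\<le>k. fls_const (left_coeff n k * (of_nat (k choose m) * (- 1) ^ (k - m))) * (Xp ^ (k - m) * Z ^ m))
        = fls_const (left_coeff n k) * (\<Sum>m\<le>k. of_nat (k choose m) * Z ^ m * (- Xp) ^ (k - m))"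
      unfolding sum_distrib_left
    proof (rule sum.cong[OF refl])
      fix m
      have reorder: "fls_const (c * (d * e)) * (x * y) = fls_const c * (fls_const d * y * (fls_const e * x))"
        for c d e :: complex and x y
        unfolding fls_const_mult_const[symmetric] by (simp only: ac_simps)
      have "fls_const ((- 1) ^ (k - m)) * Xp ^ (k - m) = (- Xp) ^ (k - m)"
        by (simp add: power_minus[of Xp] fls_const_power)
      then show "fls_const (left_coeff n k * (of_nat (k choose m) * (- 1) ^ (k - m))) * (Xp ^ (k - m) * Z ^ m)
          = fls_const (left_coeff n k) * (of_nat (k choose m) * Z ^ m * (- Xp) ^ (k - m))"
        using reorder[of "left_coeff n k" "of_nat (k choose m)" "(- 1) ^ (k - m)" "Xp ^ (k - m)" "Z ^ m"]
        by (simp only: fls_of_nat)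
    qed
    also have "(\<Sum>m\<le>k. of_nat (k choose m) * Z ^ m * (- Xp) ^ (k - m)) = 1"
      unfolding binomial_ring[symmetric] by (simp add: Z_def)
    finally show ?thesis by (simp only: lin)
  qed
  have "pole_functional M (left_poly n) = (\<Sum>m\<le>n. mscale W (left_coeff n m) (pole_pairing M m (n + 1)))"
    unfolding left_poly_def
    by (simp only: pole_functional_sum pole_functional_smult pole_functional_monomial[OF M])
  moreover have "M (ev (left_poly n)) 1 = (\<Sum>m\<le>n. mscale W (left_coeff n m) (\<Sum>i\<le>n - m. ?t m i))"
  proof -
    have "M (ev (left_poly n)) 1 = (\<Sum>k\<le>n. mscale W (left_coeff n k) (M (S ^ k * (1 + S) ^ (n + 1)) 1))"
      unfolding left_poly_def ev_sum ev_smult ev_s_t residue_pairing_sum[OF M] lin ..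
    also have "\<dots> = (\<Sum>k\<le>n. \<Sum>m\<le>k. mscale W (left_coeff n m) (?t m (k - m)))"
      by (simp only: inner)
    also have "\<dots> = (\<Sum>m\<le>n. \<Sum>i\<le>n - m. mscale W (left_coeff n m) (?t m i))"
      by (rule sum_triangle[symmetric])
    finally show ?thesis by (simp only: W.scale_sum_right)
  qed
  ultimately have "pole_functional M (left_poly n) - M (ev (left_poly n)) 1
      = (\<Sum>m\<le>n. mscale W (left_coeff n m) (pole_pairing M m (n + 1) - (\<Sum>i\<le>n - m. ?t m i)))"
    by (simp only: sum_subtractf W.scale_right_diff_distrib)
  also have "\<dots> \<in> U"
    by (intro W.subspace_sum[OF U] W.subspace_scale[OF U] trunc)
  finally show ?thesis .
qed

end

section \<open>The relations modulo \<open>O'\<^sub>n(W)\<close>\<close>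

lemma euler_monomial:
  "euler (s_poly ^ N * t_poly ^ M)
    = - (smult (of_nat N) (s_poly ^ N * t_poly ^ M) + smult (of_nat (N + M)) (s_poly ^ Suc N * t_poly ^ M))"
proof -
  have s: "euler (s_poly ^ N) = - smult (of_nat N) (s_poly ^ N * t_poly)"
  proof (induction N)
    case (Suc N)
    have "euler s_poly = - (s_poly * t_poly)" by (simp add: euler_def pderiv_pCons)
    then show ?case
      unfolding power_Suc euler_mult Suc.IH by (simp add: algebra_simps smult_add_left)
  qed simp
  have t: "euler (t_poly ^ M) = - smult (of_nat M) (s_poly * t_poly ^ M)"
  proof (induction M)
    case (Suc M)
    have "euler t_poly = - (s_poly * t_poly)" by (simp add: euler_def pderiv_pCons)
    then show ?case
      unfolding power_Suc euler_mult Suc.IH by (simp add: algebra_simps smult_add_left)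
  qed simp
  have t1: "t_poly = 1 + s_poly" by (simp add: one_pCons)
  have "euler (s_poly ^ N * t_poly ^ M)
      = - (smult (of_nat N) (s_poly ^ N * t_poly * t_poly ^ M) + smult (of_nat M) (s_poly ^ N * (s_poly * t_poly ^ M)))"
    unfolding euler_mult s t by simp
  also have "s_poly ^ N * t_poly * t_poly ^ M = s_poly ^ N * t_poly ^ M + s_poly ^ Suc N * t_poly ^ M"
    by (subst t1) (simp only: distrib_left distrib_right mult_1_right mult_1_left power_Suc ac_simps)
  also have "s_poly ^ N * (s_poly * t_poly ^ M) = s_poly ^ Suc N * t_poly ^ M"
    by (simp only: power_Suc ac_simps)
  finally show ?thesis
    by (simp only: smult_add_right smult_add_left of_nat_add add.assoc)
qed

text \<open>
  If \<open>r h\<close> lies in the ideal, with \<open>r\<close> the right polynomial, then so does \<open>r D h = D(r h) - (D r) h\<close>, because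
  \<open>D r\<close> lies in the ideal.
\<close>

lemma ideal_dvd_right_taylor: "ideal_poly n dvd right_poly n * taylor a (left_poly n) i"
proof (induction i)
  case 0
  show ?case
    using ideal_dvd_idempotent[of n] by (simp add: right_poly_eq mult.commute)
next
  case (Suc i)
  let ?h = "taylor a (left_poly n) i"
  have "ideal_poly n dvd euler (right_poly n * ?h) - euler (right_poly n) * ?h"
  proof (rule dvd_diff)
    show "ideal_poly n dvd euler (right_poly n * ?h)"
      by (rule ideal_dvd_euler[OF Suc.IH])
    show "ideal_poly n dvd euler (right_poly n) * ?h"
      unfolding right_poly_eq euler_diff euler_1 diff_0_right
      by (rule dvd_mult2[OF ideal_dvd_euler_left_poly])
  qed
  then have "ideal_poly n dvd right_poly n * euler ?h"
    by (simp add: euler_mult)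
  then show ?case
    unfolding taylor.simps mult_smult_right distrib_left
    by (intro dvd_smult dvd_add Suc.IH)
qed

context weak_module
begin

lemma ev_s_t_Z: "ev (s_poly ^ p * t_poly ^ c) = S ^ (p + c) * Z ^ c"
  using S_pow_Z_pow_mult[of p c 0] by (simp only: ev_s_t add_0_right)

text \<open>
  The sum over weights in the definition of the action is the one in the definition of \<open>act\<close>.
\<close>

lemma left_mult_eq: "left_mult V W n v w = act V W (ev (left_poly n)) v w"
proof -
  have "left_hom W n k v w = res W (ev (left_poly n) * Z powi (k - 1)) v w" for k v
  proof -
    have "xpow_binomial (- int n - int m - 1) (k + int n) = ev (s_poly ^ m * t_poly ^ (n + 1)) * Z powi (k - 1)" for m
    proof -
      have "ev (s_poly ^ m * t_poly ^ (n + 1)) * Z powi (k - 1) = S ^ (m + (n + 1)) * (Z ^ (n + 1) * Z powi (k - 1))"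
        unfolding ev_s_t_Z mult.assoc ..
      also have "Z ^ (n + 1) * Z powi (k - 1) = Z powi (int (n + 1) + (k - 1))"
        by (simp only: power_int_add[OF disjI1[OF Z_nonzero]] power_int_of_nat)
      also have "int (n + 1) + (k - 1) = k + int n" by simp
      also have "S ^ (m + (n + 1)) = Xp powi (- int n - int m - 1)"
        unfolding S_pow_powi by (rule arg_cong[of _ _ "\<lambda>k. Xp powi k"]) simp
      finally show ?thesis by (simp only: xpow_binomial_eq)
    qed
    then show ?thesis
      unfolding left_hom_def left_poly_def ev_sum sum_distrib_right res_sum ev_smult mult.assoc res_const_mult
        res_mult_eq_res
      by (simp only: left_coeff_def atLeast0AtMost)
  qed
  then show ?thesis by (simp only: left_mult_def act_def)
qed

lemma right_mult_eq: "right_mult V W n w v = act V W (ev (right_poly n)) v w"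
proof -
  have "right_hom W n k v w = res W (ev (right_poly n) * Z powi (k - 1)) v w" for k v
  proof -
    have "xpow_binomial (- int n - int m - 1) (k + int m - 1) = ev (s_poly ^ (n + 1) * t_poly ^ m) * Z powi (k - 1)" for m
    proof -
      have "ev (s_poly ^ (n + 1) * t_poly ^ m) * Z powi (k - 1) = S ^ ((n + 1) + m) * (Z ^ m * Z powi (k - 1))"
        unfolding ev_s_t_Z mult.assoc ..
      also have "Z ^ m * Z powi (k - 1) = Z powi (int m + (k - 1))"
        by (simp only: power_int_add[OF disjI1[OF Z_nonzero]] power_int_of_nat)
      also have "int m + (k - 1) = k + int m - 1" by simp
      also have "S ^ ((n + 1) + m) = Xp powi (- int n - int m - 1)"
        unfolding S_pow_powi by (rule arg_cong[of _ _ "\<lambda>k. Xp powi k"]) simp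
      finally show ?thesis by (simp only: xpow_binomial_eq)
    qed
    then show ?thesis
      unfolding right_hom_def right_poly_def ev_sum sum_distrib_right res_sum ev_smult mult.assoc res_const_mult
        res_mult_eq_res
      by (simp only: left_coeff_def atLeast0AtMost)
  qed
  then show ?thesis by (simp only: right_mult_def act_def)
qed

lemma O'_generators_eq:
  "O'_generators V W n = {act V W (ev (ideal_poly n)) v w | k v w. v \<in> weight_space V k}"
proof -
  have "res_mult (mscale W) (xpow_binomial (- 2 * int n - 2) (k + int n)) (mvertex_op W v w)
      = act V W (ev (ideal_poly n)) v w" if "v \<in> weight_space V k" for k v w
  proof -
    have "ev (ideal_poly n) * Z powi (k - 1) = S ^ ((n + 1) + (n + 1)) * (Z ^ (n + 1) * Z powi (k - 1))"
      unfolding ideal_poly_def ev_s_t_Z mult.assoc ..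
    also have "Z ^ (n + 1) * Z powi (k - 1) = Z powi (int (n + 1) + (k - 1))"
      by (simp only: power_int_add[OF disjI1[OF Z_nonzero]] power_int_of_nat)
    also have "int (n + 1) + (k - 1) = k + int n" by simp
    also have "S ^ ((n + 1) + (n + 1)) = Xp powi (- 2 * int n - 2)"
      unfolding S_pow_powi by (rule arg_cong[of _ _ "\<lambda>k. Xp powi k"]) simp
    finally show ?thesis
      by (simp only: res_mult_eq_res xpow_binomial_eq act_homogeneous[OF that])
  qed
  then show ?thesis unfolding O'_generators_def by (intro Collect_cong) metis
qed

lemma O'_subspace: "W.subspace (O' V W n)"
  unfolding O'_def by (rule W.subspace_span)

lemma O'_induct [consumes 1]:
  assumes "x \<in> O' V W n" "W.subspace {x. P x}"
    and "\<And>k v w. v \<in> weight_space V k \<Longrightarrow> P (act V W (ev (ideal_poly n)) v w)"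
  shows "P x"
  using assms(1) unfolding O'_def
proof (rule W.span_induct[OF _ assms(2)])
  fix x
  assume "x \<in> O'_generators V W n"
  then show "P x" unfolding O'_generators_eq using assms(3) by auto
qed

text \<open>
  The annihilated polynomials are stable under the Euler operator, because \<open>L(-1) + L(0)\<close> acts on \<open>V\<close>;
  starting from \<open>s\<^sup>n\<^sup>+\<^sup>1(1 + s)\<^sup>n\<^sup>+\<^sup>1\<close> it produces the whole ideal, one power of \<open>s\<close> at a time.
\<close>

theorem act_ideal:
  assumes "ideal_poly n dvd p"
  shows "act V W (ev p) v w \<in> O' V W n"
proof -
  define J where "J = {p. \<forall>v w. act V W (ev p) v w \<in> O' V W n}"
  have J_add: "p \<in> J \<Longrightarrow> q \<in> J \<Longrightarrow> p + q \<in> J" for p q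
    by (simp add: J_def act_add W.subspace_add[OF O'_subspace])
  have J_smult: "p \<in> J \<Longrightarrow> smult c p \<in> J" for p c
    by (simp add: J_def act_const_mult W.subspace_scale[OF O'_subspace])
  have J_euler: "p \<in> J \<Longrightarrow> euler p \<in> J" for p
    by (simp add: J_def ev_euler act_euler W.subspace_neg[OF O'_subspace])
  have "act V W (ev (ideal_poly n)) v w \<in> O' V W n" for v w
  proof (induction v rule: V.weight_induct)
    case (homogeneous k v)
    then show ?case
      unfolding O'_def O'_generators_eq by (intro W.span_base) blast
  next
    case (add u v)
    then show ?case by (simp only: act_add_left W.subspace_add[OF O'_subspace])
  qed
  then have base: "ideal_poly n \<in> J" by (simp add: J_def)
  have power: "s_poly ^ (n + 1 + j) * t_poly ^ (n + 1) \<in> J" for j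
  proof (induction j)
    case 0
    show ?case using base by (simp only: ideal_poly_def add_0_right)
  next
    case (Suc j)
    let ?N = "n + 1 + j" and ?M = "n + 1"
    let ?q = "s_poly ^ ?N * t_poly ^ ?M" and ?q' = "s_poly ^ Suc ?N * t_poly ^ ?M"
    have "smult (- 1 / of_nat (?N + ?M)) (euler ?q + smult (of_nat ?N) ?q) \<in> J"
      by (intro J_smult J_add J_euler Suc.IH)
    also have "euler ?q + smult (of_nat ?N) ?q = - smult (of_nat (?N + ?M)) ?q'"
      unfolding euler_monomial by simp
    also have "smult (- 1 / of_nat (?N + ?M)) (- smult (of_nat (?N + ?M)) ?q') = ?q'"
    proof -
      have "(of_nat (?N + ?M) :: complex) \<noteq> 0" by (simp only: of_nat_eq_0_iff)
      then have "- 1 / of_nat (?N + ?M) * - of_nat (?N + ?M) = (1 :: complex)"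
        unfolding times_divide_eq_left mult_minus1 minus_minus by (rule divide_self)
      then show ?thesis
        by (simp only: smult_minus_left[symmetric] smult_smult smult_1_left)
    qed
    finally show ?case by (simp only: add_Suc_right)
  qed
  have "s_poly ^ (n + 1 + j) * t_poly ^ (n + 1) * r \<in> J" for j r
  proof (induction r arbitrary: j rule: pCons_induct)
    case 0
    show ?case using J_smult[OF power, of 0] by simp
  next
    case (pCons a r)
    let ?A = "s_poly ^ (n + 1 + j) * t_poly ^ (n + 1)"
    have "pCons a r = smult a 1 + s_poly * r" by (simp add: one_pCons)
    then have "?A * pCons a r = smult a ?A + ?A * s_poly * r"
      by (simp only: distrib_left mult_smult_right mult_1_right mult.assoc)
    also have "?A * s_poly = s_poly ^ (n + 1 + Suc j) * t_poly ^ (n + 1)"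
      by (simp only: power_Suc add_Suc_right ac_simps)
    finally have "?A * pCons a r = smult a ?A + s_poly ^ (n + 1 + Suc j) * t_poly ^ (n + 1) * r" .
    then show ?case
      by (simp only: J_add J_smult power pCons.IH)
  qed
  from this[of 0] have "ideal_poly n * r \<in> J" for r
    by (simp only: ideal_poly_def add_0_right)
  then show ?thesis
    using assms by (auto simp: J_def dvd_def)
qed

end

section \<open>Module identities modulo the subspaces\<close>

lemma diff_add_rearrange: "a + a' - (b + b' + (c + c')) = a - (b + c) + (a' - (b' + c'))"
  for a b c :: "'b::ab_group_add"
  by (simp add: algebra_simps)

context weak_module
begin

lemma subspace_Sum_any:
  assumes "W.subspace U" "\<And>i. f i \<in> U"
  shows "Sum_any f \<in> U"
  unfolding Sum_any.expand_set by (rule W.subspace_sum[OF assms(1)]) (rule assms(2))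

lemma subspace_act_preimage:
  assumes "W.subspace U"
  shows "W.subspace {x. act V W f u x \<in> U}"
  unfolding W.subspace_def
  by (auto simp: act_add_right act_scale_right
      intro: W.subspace_0[OF assms] W.subspace_add[OF assms] W.subspace_scale[OF assms])

lemma commutator_in_O':
  assumes u: "u \<in> weight_space V a" and "\<And>i. ideal_poly n dvd q * taylor a p i"
  shows "act V W (ev p) u (act V W (ev q) v w) - act V W (ev q) v (act V W (ev p) u w) \<in> O' V W n"
  unfolding act_commutator[OF u] ev_mult[symmetric]
  by (intro subspace_Sum_any[OF O'_subspace] act_ideal assms(2))

text \<open>
  Commuting \<open>A(p,u)\<close> past a generator \<open>A(q,v)\<close> leaves only terms \<open>A(q h,u\<^sub>i v)\<close>, and \<open>q h\<close> stays in the ideal.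
\<close>

lemma act_O':
  assumes "x \<in> O' V W n"
  shows "act V W (ev p) u x \<in> O' V W n"
proof (induction u rule: V.weight_induct)
  case (homogeneous a u)
  show ?case
    using assms
  proof (induction rule: O'_induct)
    case 1
    show ?case by (rule subspace_act_preimage[OF O'_subspace])
  next
    case (2 k v w)
    have "act V W (ev p) u (act V W (ev (ideal_poly n)) v w)
        - act V W (ev (ideal_poly n)) v (act V W (ev p) u w) \<in> O' V W n"
      by (rule commutator_in_O'[OF homogeneous]) (rule dvd_triv_left)
    moreover have "act V W (ev (ideal_poly n)) v (act V W (ev p) u w) \<in> O' V W n"
      by (rule act_ideal) (rule dvd_refl)
    ultimately show ?case
      using W.subspace_add[OF O'_subspace] by fastforce
  qed
next
  case (add u v)
  then show ?case by (simp only: act_add_left W.subspace_add[OF O'_subspace])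
qed

lemma left_right_commute:
  "act V W (ev (left_poly n)) u (act V W (ev (right_poly n)) v w)
    - act V W (ev (right_poly n)) v (act V W (ev (left_poly n)) u w) \<in> O' V W n"
proof (induction u rule: V.weight_induct)
  case (homogeneous a u)
  then show ?case by (rule commutator_in_O') (rule ideal_dvd_right_taylor)
next
  case (add u u')
  from W.subspace_add[OF O'_subspace add.IH] show ?case
    by (simp only: act_add_left act_add_right add_diff_add)
qed

abbreviation L_op :: "'w \<Rightarrow> 'w"
  where "L_op w \<equiv> virasoro_op V W (- 1) w + virasoro_op V W 0 w"

abbreviation L_op_V :: "'v \<Rightarrow> 'v"
  where "L_op_V v \<equiv> virasoro_op V (adjoint V) (- 1) v + virasoro_op V (adjoint V) 0 v"

text \<open>
  The commutator of \<open>L(-1) + L(0) = A(1,\<omega>)\<close> with \<open>A(g,v)\<close> is \<open>A(g,\<omega>\<^sub>0v + \<omega>\<^sub>1v)\<close>: the Taylor expansion of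
  \<open>(1 + x)\<^bsup>wt \<omega> - 1\<^esup> = 1 + x\<close> stops after two terms.
\<close>

lemma L_op_act: "L_op (act V W g v w) = act V W g v (L_op w) - act V W (Z * fls_deriv g) v w"
proof -
  have taylor: "taylor 2 1 i = (if i < 2 then 1 else 0)" for i
  proof (induction i)
    case (Suc i)
    consider "i = 0" | "i = 1" | "2 \<le> i" by linarith
    then show ?case
      by cases (simp_all add: Suc.IH[simplified] euler_def)
  qed simp
  let ?f = "\<lambda>i. act V W (g * ev (taylor 2 1 i)) (mode (adjoint V) (conformal V) (int i) v) w"
  have "L_op (act V W g v w) - act V W g v (L_op w) = Sum_any ?f"
    using act_commutator[OF V.conformal_weight, of 1 g v w] by (simp only: ev_1 act_conformal)
  also have "\<dots> = sum ?f {..<2}"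
  proof (rule Sum_any.expand_superset)
    have "?f i = 0" if "\<not> i < 2" for i
      using that by (simp add: taylor)
    then show "{i. ?f i \<noteq> 0} \<subseteq> {..<2}"
      unfolding subset_iff mem_Collect_eq lessThan_iff by blast
  qed simp
  also have "\<dots> = act V W g (L_op_V v) w"
    by (simp add: taylor numeral_2_eq_2 act_add_left virasoro_op_def)
  also have "\<dots> = - act V W (Z * fls_deriv g) v w"
    by (simp add: act_euler)
  finally show ?thesis by (simp add: algebra_simps)
qed

lemma O_mod_iff: "x \<in> O_mod V W n \<longleftrightarrow> (\<exists>y\<in>O' V W n. \<exists>w. x = y + L_op w)"
  unfolding O_mod_def set_plus_def by auto

lemma L_op_add: "L_op (w + w') = L_op w + L_op w'"
  by (simp add: act_add_right flip: act_conformal)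

lemma L_op_scale: "L_op (mscale W c w) = mscale W c (L_op w)"
  by (simp add: act_scale_right flip: act_conformal)

lemma O_mod_subspace: "W.subspace (O_mod V W n)"
  unfolding W.subspace_def
proof (intro conjI ballI allI)
  show "0 \<in> O_mod V W n"
    unfolding O_mod_iff using W.subspace_0[OF O'_subspace] L_op_scale[of 0 0] by (intro bexI[of _ 0] exI[of _ 0]) simp_all
next
  fix x y
  assume "x \<in> O_mod V W n" "y \<in> O_mod V W n"
  then obtain x' w y' w' where x': "x' \<in> O' V W n" "x = x' + L_op w" and y': "y' \<in> O' V W n" "y = y' + L_op w'"
    unfolding O_mod_iff by auto
  have "x + y = (x' + y') + L_op (w + w')"
    unfolding x'(2) y'(2) L_op_add by (simp only: ac_simps)
  then show "x + y \<in> O_mod V W n"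
    unfolding O_mod_iff using W.subspace_add[OF O'_subspace x'(1) y'(1)] by blast
next
  fix c x
  assume "x \<in> O_mod V W n"
  then obtain x' w where x': "x' \<in> O' V W n" "x = x' + L_op w"
    unfolding O_mod_iff by auto
  have "mscale W c x = mscale W c x' + L_op (mscale W c w)"
    unfolding x'(2) L_op_scale by (simp only: W.scale_right_distrib)
  then show "mscale W c x \<in> O_mod V W n"
    unfolding O_mod_iff using W.subspace_scale[OF O'_subspace x'(1)] by blast
qed

lemma O'_subset_O_mod: "O' V W n \<subseteq> O_mod V W n"
  unfolding O_mod_iff subset_iff
proof (intro allI impI)
  fix x
  assume "x \<in> O' V W n"
  moreover have "x = x + L_op 0" using L_op_scale[of 0 0] by simp
  ultimately show "\<exists>y\<in>O' V W n. \<exists>w. x = y + L_op w" by blast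
qed

lemma L_op_in_O_mod: "L_op w \<in> O_mod V W n"
  unfolding O_mod_iff using W.subspace_0[OF O'_subspace] by force

lemma act_O_mod:
  assumes x: "x \<in> O_mod V W n" and p: "ideal_poly n dvd euler p"
  shows "act V W (ev p) v x \<in> O_mod V W n"
proof -
  obtain y w where y: "y \<in> O' V W n" "x = y + L_op w"
    using x unfolding O_mod_iff by blast
  have "act V W (ev p) v x = act V W (ev p) v y + (L_op (act V W (ev p) v w) + act V W (ev (euler p)) v w)"
    unfolding y(2) act_add_right[of _ _ y] L_op_act ev_euler by simp
  also have "\<dots> \<in> O_mod V W n"
    by (rule W.subspace_add[OF O_mod_subspace O'_subset_O_mod[THEN subsetD, OF act_O'[OF y(1)]]
          W.subspace_add[OF O_mod_subspace L_op_in_O_mod O'_subset_O_mod[THEN subsetD, OF act_ideal[OF p]]]])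
  finally show ?thesis .
qed

lemma residue_pairing_left: "residue_pairing (\<lambda>g h. act V W g u (act V W (h * f) v w))"
  unfolding residue_pairing_def
proof (intro conjI allI)
  fix h
  obtain n where n: "\<forall>i\<ge>n. act V W (Xp ^ i * (h * f)) v w = 0"
    using act_X_pow_eventually_0[of "h * f" v w] ..
  show "\<exists>n. \<forall>i\<ge>n. \<forall>g. act V W g u (act V W (Xp ^ i * h * f) v w) = 0"
    by (intro exI[of _ n]) (simp add: n mult.assoc)
qed (simp_all only: act_add act_add_right act_const_mult act_scale_right distrib_right mult.assoc)

lemma residue_pairing_right: "residue_pairing (\<lambda>g h. act V W (g * f) v (act V W h u w))"
  unfolding residue_pairing_def
proof (intro conjI allI)
  fix h
  obtain n where n: "\<forall>i\<ge>n. act V W (Xp ^ i * h) u w = 0"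
    using act_X_pow_eventually_0[of h u w] ..
  show "\<exists>n. \<forall>i\<ge>n. \<forall>g. act V W (g * f) v (act V W (Xp ^ i * h) u w) = 0"
    by (intro exI[of _ n]) (simp add: n)
qed (simp_all only: act_add act_add_right act_const_mult act_scale_right distrib_right mult.assoc)

text \<open>
  For \<open>p = c = n + 1\<close> every term of both expansions has its outer polynomial in the ideal.
\<close>

lemma act_of_ideal:
  "act V W (ev q) (act V (adjoint V) (ev (ideal_poly n)) u v) w \<in> O' V W n"
proof (induction u rule: V.weight_induct)
  case (homogeneous a u)
  note u = this
  show ?case
  proof (induction v rule: V.weight_induct)
    case (homogeneous b v)
    let ?N = "n + 1"
    have I: "S ^ (?N + i) * (1 + S) ^ ?N = ev (ideal_poly n * s_poly ^ i)" for i
      unfolding ideal_poly_def ev_mult ev_power by (simp add: power_add ac_simps)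
    have dvd: "ideal_poly n dvd ideal_poly n * s_poly ^ i" "ideal_poly n dvd ideal_poly n * s_poly ^ i * q" for i
      by (simp_all only: dvd_triv_left dvd_mult2)
    show ?case
      unfolding ideal_poly_def[of n] ev_s_t
      unfolding act_iterate[OF u homogeneous] pole_pairing_def
      unfolding I
      unfolding ev_mult[of _ q, symmetric]
      by (intro W.subspace_diff[OF O'_subspace] W.subspace_scale[OF O'_subspace]
          subspace_Sum_any[OF O'_subspace] act_ideal dvd)
  next
    case (add v v')
    then show ?case
      by (simp only: weak_module.act_add_right[OF V.adjoint_weak_module] act_add_left W.subspace_add[OF O'_subspace])
  qed
next
  case (add u u')
  then show ?case
    by (simp only: weak_module.act_add_left[OF V.adjoint_weak_module] act_add_left W.subspace_add[OF O'_subspace])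
qed

text \<open>
  Writing \<open>e\<close> for \<open>left_poly n\<close>: the first expansion of \<open>e(s\<^sub>0)\<close> collapses to \<open>e\<close>.  The second is the expansion
  of \<open>e(-1 - s) = 1 - e(s)\<close> with the variables exchanged, and collapses to \<open>1 - e\<close>; it is subtracted.
\<close>

theorem act_left_product:
  "act V W (ev q) (act V (adjoint V) (ev (left_poly n)) u v) w
    - (act V W (ev (left_poly n)) u (act V W (ev q) v w) + act V W (ev (right_poly n * q)) v (act V W 1 u w))
    \<in> O' V W n"
proof (induction u rule: V.weight_induct)
  case (homogeneous a u)
  note u = this
  show ?case
  proof (induction v rule: V.weight_induct)
    case (homogeneous b v)
    let ?M = "\<lambda>g h. act V W g u (act V W (h * ev q) v w)"
    let ?M' = "\<lambda>g h. act V W (g * ev q) v (act V W h u w)"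
    have M: "residue_pairing ?M" by (rule residue_pairing_left)
    have M': "residue_pairing ?M'" by (rule residue_pairing_right)
    have sign: "- (left_coeff n m * (- 1) ^ (m + (n + 1))) = left_coeff n m * (- 1) ^ (n - m)" if "m \<le> n" for m
    proof -
      have "m + (n + 1) = 2 * m + 1 + (n - m)" using that by simp
      then have "(- 1 :: complex) ^ (m + (n + 1)) = (- 1) ^ (2 * m + 1 + (n - m))" by (simp only:)
      then show ?thesis by (simp add: power_add)
    qed
    have "act V W (ev q) (act V (adjoint V) (ev (left_poly n)) u v) w
        = (\<Sum>m\<le>n. mscale W (left_coeff n m) (act V W (ev q) (act V (adjoint V) (S ^ m * (1 + S) ^ (n + 1)) u v) w))"
      unfolding left_poly_def ev_sum ev_smult ev_s_t weak_module.act_sum[OF V.adjoint_weak_module]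
        weak_module.act_const_mult[OF V.adjoint_weak_module] mscale_adjoint act_sum_left act_scale_left ..
    also have "\<dots> = (\<Sum>m\<le>n. mscale W (left_coeff n m) (pole_pairing ?M m (n + 1)))
        + (\<Sum>m\<le>n. mscale W (left_coeff n m * (- 1) ^ (n - m)) (pole_pairing ?M' (n + 1) m))"
      unfolding sum.distrib[symmetric] act_iterate[OF u homogeneous]
    proof (rule sum.cong[OF refl])
      fix m
      assume "m \<in> {..n}"
      then have "m \<le> n" by simp
      show "mscale W (left_coeff n m) (pole_pairing ?M m (n + 1) - mscale W ((- 1) ^ (m + (n + 1))) (pole_pairing ?M' (n + 1) m))
        = mscale W (left_coeff n m) (pole_pairing ?M m (n + 1))
          + mscale W (left_coeff n m * (- 1) ^ (n - m)) (pole_pairing ?M' (n + 1) m)"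
        unfolding sign[OF \<open>m \<le> n\<close>, symmetric] W.scale_right_diff_distrib W.scale_scale W.scale_minus_left
        by (rule diff_conv_add_uminus)
    qed
    also have "(\<Sum>m\<le>n. mscale W (left_coeff n m) (pole_pairing ?M m (n + 1))) = pole_functional ?M (left_poly n)"
      unfolding left_poly_def pole_functional_sum pole_functional_smult pole_functional_monomial[OF M] ..
    also have "(\<Sum>m\<le>n. mscale W (left_coeff n m * (- 1) ^ (n - m)) (pole_pairing ?M' (n + 1) m))
        = pole_functional ?M' (right_poly n)"
      unfolding right_poly_def pole_functional_sum pole_functional_smult pole_functional_monomial[OF M'] ..
    also have "pole_functional ?M' (right_poly n) = pole_functional ?M' (left_poly n) - ?M' 1 1"
    proof -
      have "pole_functional ?M' 1 = pole_pairing ?M' 0 0"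
        using pole_functional_monomial[OF M', of 0 0] by simp
      also have "\<dots> = Sum_any (\<lambda>i::nat. if i = 0 then ?M' 1 1 else 0)"
        unfolding pole_pairing_def by (rule Sum_any.cong) simp
      finally show ?thesis
        unfolding right_poly_eq pole_functional_diff by simp
    qed
    finally have eq: "act V W (ev q) (act V (adjoint V) (ev (left_poly n)) u v) w
        = pole_functional ?M (left_poly n) + (pole_functional ?M' (left_poly n) - ?M' 1 1)" .
    have "act V W (ev (right_poly n * q)) v (act V W 1 u w) = ?M' (ev (left_poly n)) 1 - ?M' 1 1"
      unfolding right_poly_eq ev_mult ev_diff ev_1 left_diff_distrib act_diff ..
    then have "act V W (ev q) (act V (adjoint V) (ev (left_poly n)) u v) w
        - (act V W (ev (left_poly n)) u (act V W (ev q) v w) + act V W (ev (right_poly n * q)) v (act V W 1 u w))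
      = (pole_functional ?M (left_poly n) - ?M (ev (left_poly n)) 1)
        + (pole_functional ?M' (left_poly n) - ?M' (ev (left_poly n)) 1)"
      unfolding eq by simp
    also have "\<dots> \<in> O' V W n"
    proof (intro W.subspace_add[OF O'_subspace] pole_functional_left_poly M M' O'_subspace)
      show "?M (ev (ideal_poly n * r)) h \<in> O' V W n" for r h
        by (rule act_ideal) (rule dvd_triv_left)
      show "?M' (ev (ideal_poly n * r)) h \<in> O' V W n" for r h
        unfolding ev_mult[of _ q, symmetric] by (rule act_ideal) (simp only: dvd_triv_left dvd_mult2)
    qed
    finally show ?case .
  next
    case (add v v')
    show ?case
      unfolding weak_module.act_add_right[OF V.adjoint_weak_module] act_add_left act_add_right diff_add_rearrange
      by (rule W.subspace_add[OF O'_subspace add.IH])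
  qed
next
  case (add u u')
  show ?case
    unfolding weak_module.act_add_left[OF V.adjoint_weak_module] act_add_left act_add_right diff_add_rearrange
    by (rule W.subspace_add[OF O'_subspace add.IH])
qed

end

section \<open>Unit and associativity laws\<close>

lemma ev_nth_pos: "0 < k \<Longrightarrow> ev p $$ k = 0"
proof (induction p arbitrary: k rule: pCons_induct)
  case (pCons a p)
  then show ?case by (simp add: fls_X_inv_times_conv_shift(1))
qed simp

lemma ev_nth_0: "ev p $$ 0 = coeff p 0"
  by (cases p) (simp add: fls_X_inv_times_conv_shift(1) ev_nth_pos)

lemma ex_antiderivative: "\<exists>H. pderiv H = h" for h :: "complex poly"
proof -
  have "pderiv (\<Sum>i\<le>degree h. monom (coeff h i / of_nat (Suc i)) (Suc i)) = (\<Sum>i\<le>degree h. monom (coeff h i) i)"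
  proof -
    have "pderiv (sum f A) = (\<Sum>i\<in>A. pderiv (f i))" for f :: "nat \<Rightarrow> complex poly" and A
      by (induction A rule: infinite_finite_induct) (simp_all add: pderiv_add)
    then show ?thesis
      by (simp add: pderiv_monom del: of_nat_Suc)
  qed
  then show ?thesis
    unfolding poly_as_sum_of_monoms by blast
qed

lemma ideal_dvd_euler_right_poly: "ideal_poly n dvd euler (right_poly n)"
  unfolding right_poly_eq euler_diff euler_1 diff_0_right by (rule ideal_dvd_euler_left_poly)

text \<open>
  Both \<open>left_poly n\<close> and \<open>1 + s\<close> are \<open>1\<close> modulo \<open>s\<close> and \<open>0\<close> modulo \<open>1 + s\<close>, and every multiple of \<open>s(1 + s)\<close> is in
  the image of the Euler operator.
\<close>

lemma left_poly_euler: "\<exists>H. left_poly n = t_poly + euler H"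
proof -
  have "s_poly dvd left_poly n - 1"
    by (rule dvd_trans[OF _ s_dvd_left_poly]) (simp only: power_add power_one_right dvd_triv_right)
  then have "s_poly dvd (left_poly n - 1) - s_poly"
    by (rule dvd_diff) (rule dvd_refl)
  also have "(left_poly n - 1) - s_poly = left_poly n - t_poly"
    by (simp add: one_pCons)
  finally have s: "s_poly dvd left_poly n - t_poly" .
  have "t_poly dvd left_poly n"
    by (rule dvd_trans[OF _ t_dvd_left_poly]) (simp only: power_add power_one_right dvd_triv_right)
  then have t: "t_poly dvd left_poly n - t_poly"
    by (rule dvd_diff) (rule dvd_refl)
  have "s_poly * t_poly dvd left_poly n - t_poly"
    by (rule divides_mult[OF s t]) (use coprime_s_t[of 1 1] in \<open>simp only: power_one_right\<close>)
  then obtain h where h: "left_poly n - t_poly = s_poly * t_poly * h"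
    unfolding dvd_def ..
  obtain H where H: "pderiv H = - h" using ex_antiderivative by blast
  have "euler H = left_poly n - t_poly"
    unfolding h euler_def H by (simp only: mult_minus_right minus_minus)
  then have "left_poly n = t_poly + euler H" by simp
  then show ?thesis ..
qed

context weak_module
begin

lemma act_left_vacuum: "act V W (ev (left_poly n)) (vacuum V) w = w"
proof -
  have "t_poly dvd left_poly n"
    by (rule dvd_trans[OF _ t_dvd_left_poly]) (simp only: power_add power_one_right dvd_triv_right)
  then obtain q where q: "left_poly n = t_poly * q" unfolding dvd_def ..
  have "s_poly ^ 1 dvd left_poly n - 1"
    by (rule dvd_trans[OF _ s_dvd_left_poly]) (simp only: power_add power_one_right dvd_triv_right)
  then have "coeff (left_poly n) 0 = 1"
    unfolding s_pow_dvd_iff by simp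
  then have q0: "coeff q 0 = 1" by (simp add: q coeff_mult_0)
  have "ev (left_poly n) * Z powi (- 1) = S * ev q * (Z * Z powi (- 1))"
  proof -
    have "ev t_poly = S * Z" by (simp add: S_Z)
    then show ?thesis unfolding q ev_mult by (simp only: ac_simps)
  qed
  also have "Z * Z powi (- 1) = 1" by simp
  finally have "(ev (left_poly n) * Z powi (- 1)) $$ (- 1) = 1"
    by (simp add: fls_X_inv_times_conv_shift(1) ev_nth_0 q0)
  then show ?thesis by (simp add: act_vacuum)
qed

lemma act_right_vacuum: "act V W (ev (right_poly n)) (vacuum V) w = w"
proof -
  have "act V W 1 (vacuum V) w = 0"
    unfolding act_vacuum mult_1_left Z_powi_nth by simp
  then show ?thesis
    unfolding right_poly_eq ev_diff ev_1 act_diff act_left_vacuum by simp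
qed

lemma O_alg_induct [consumes 1]:
  assumes "x \<in> O_alg V n" "V.subspace {x. P x}"
    and "\<And>v. P (L_op_V v)"
    and "\<And>k u v. u \<in> weight_space V k \<Longrightarrow> P (act V (adjoint V) (ev (ideal_poly n)) u v)"
  shows "P x"
  using assms(1) unfolding O_alg_def
proof (rule V.span_induct[OF _ assms(2)])
  fix x
  assume "x \<in> range L_op_V \<union> O'_generators V (adjoint V) n"
  then show "P x"
    unfolding weak_module.O'_generators_eq[OF V.adjoint_weak_module] using assms(3,4) by auto
qed

lemma act_O_alg:
  assumes x: "x \<in> O_alg V n" and q: "ideal_poly n dvd euler q"
  shows "act V W (ev q) x w \<in> O' V W n"
  using x
proof (induction rule: O_alg_induct)
  case 1
  show ?case
    unfolding V.subspace_def
    by (auto simp: act_add_left act_scale_left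
      intro: W.subspace_0[OF O'_subspace] W.subspace_add[OF O'_subspace] W.subspace_scale[OF O'_subspace])
next
  case (2 v)
  have "act V W (ev q) (L_op_V v) w = - act V W (ev (euler q)) v w"
    unfolding ev_euler act_euler by simp
  then show ?case
    by (simp only: W.subspace_neg[OF O'_subspace] act_ideal[OF q])
next
  case (3 k u v)
  show ?case by (rule act_of_ideal)
qed

lemma left_associative:
  "act V W (ev (left_poly n)) (act V (adjoint V) (ev (left_poly n)) u v) w
    - act V W (ev (left_poly n)) u (act V W (ev (left_poly n)) v w) \<in> O' V W n"
proof -
  have "act V W (ev (right_poly n * left_poly n)) v (act V W 1 u w) \<in> O' V W n"
    unfolding right_poly_eq by (rule act_ideal) (simp only: mult.commute ideal_dvd_idempotent)
  from W.subspace_add[OF O'_subspace act_left_product[of "left_poly n" n u v w] this]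
  show ?thesis by simp
qed

text \<open>
  Let \<open>r = right_poly n = e - 1\<close> with \<open>e = left_poly n\<close>.  Modulo the ideal \<open>r\<^sup>2 = -r\<close>, so the product formula
  gives \<open>A(e,u)A(r,v)w - A(r,v)A(1,u)w\<close>.  Commuting the first two operators makes this
  \<open>A(r,v)A(e,u)w - A(r,v)A(1,u)w = A(r,v)A(r,u)w\<close>.
\<close>

lemma right_associative:
  "act V W (ev (right_poly n)) (act V (adjoint V) (ev (left_poly n)) u v) w
    - act V W (ev (right_poly n)) v (act V W (ev (right_poly n)) u w) \<in> O' V W n"
proof -
  let ?L = "ev (left_poly n)" and ?R = "ev (right_poly n)"
  let ?c = "act V W 1 u w"
  have "ideal_poly n dvd right_poly n * right_poly n + right_poly n"
  proof -
    have "right_poly n * right_poly n + right_poly n = left_poly n * (left_poly n - 1)"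
      unfolding right_poly_eq by (simp only: left_diff_distrib mult_1_left diff_add_cancel)
    then show ?thesis by (simp only: ideal_dvd_idempotent)
  qed
  then have idem: "act V W (ev (right_poly n * right_poly n)) v ?c + act V W ?R v ?c \<in> O' V W n"
    unfolding act_add[symmetric] ev_add[symmetric] by (rule act_ideal)
  have R: "act V W ?R u w = act V W ?L u w - ?c"
    unfolding right_poly_eq ev_diff ev_1 act_diff ..
  have "act V W ?R (act V (adjoint V) ?L u v) w - act V W ?R v (act V W ?R u w)
      = (act V W ?R (act V (adjoint V) ?L u v) w
          - (act V W ?L u (act V W ?R v w) + act V W (ev (right_poly n * right_poly n)) v ?c))
        + ((act V W ?L u (act V W ?R v w) - act V W ?R v (act V W ?L u w))
        + (act V W (ev (right_poly n * right_poly n)) v ?c + act V W ?R v ?c))"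
    unfolding R act_diff_right by (simp add: algebra_simps del: ev_mult)
  also have "\<dots> \<in> O' V W n"
    by (intro W.subspace_add[OF O'_subspace] act_left_product left_right_commute idem)
  finally show ?thesis .
qed

lemma O_alg_eq_O_mod: "O_alg V n = O_mod V (adjoint V) n"
proof
  note adj = V.adjoint_weak_module
  show "O_alg V n \<subseteq> O_mod V (adjoint V) n"
  proof
    fix x
    assume "x \<in> O_alg V n"
    then show "x \<in> O_mod V (adjoint V) n"
    proof (induction rule: O_alg_induct)
      case 1
      show ?case using weak_module.O_mod_subspace[OF adj, of n] by simp
    next
      case (2 v)
      show ?case by (rule weak_module.L_op_in_O_mod[OF adj])
    next
      case (3 k u v)
      show ?case
        by (rule weak_module.O'_subset_O_mod[OF adj, THEN subsetD])
          (rule weak_module.act_ideal[OF adj dvd_refl])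
    qed
  qed
  show "O_mod V (adjoint V) n \<subseteq> O_alg V n"
  proof
    fix x
    assume "x \<in> O_mod V (adjoint V) n"
    then obtain y v where y: "y \<in> O' V (adjoint V) n" "x = y + L_op_V v"
      unfolding weak_module.O_mod_iff[OF adj] by blast
    have "y \<in> O_alg V n"
      using y(1) V.span_mono[of "O'_generators V (adjoint V) n" "range L_op_V \<union> O'_generators V (adjoint V) n"]
      unfolding O'_def O_alg_def mscale_adjoint by blast
    moreover have "L_op_V v \<in> O_alg V n"
      unfolding O_alg_def by (rule V.span_base) blast
    ultimately show "x \<in> O_alg V n"
      unfolding y(2) O_alg_def by (rule V.span_add)
  qed
qed

text \<open>
  \<open>A(1 + s,u)\<one> = u\<^sub>-\<^sub>1\<one> = u\<close>, and \<open>left_poly n - (1 + s)\<close> is some \<open>D H\<close>, which acts on the vacuum through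
  \<open>L(-1) + L(0)\<close> because the latter annihilates it.
\<close>

lemma right_unit: "act V (adjoint V) (ev (left_poly n)) u (vacuum V) - u \<in> O_alg V n"
proof -
  note adj = V.adjoint_weak_module
  obtain H where H: "left_poly n = t_poly + euler H" using left_poly_euler by blast
  have L1: "L_op_V (vacuum V) = 0"
    by (simp add: virasoro_op_def V.creation_property)
  have t: "act V (adjoint V) (ev t_poly) u (vacuum V) = u"
  proof (induction u rule: V.weight_induct)
    case (homogeneous a u)
    have "ev t_poly * Z powi (a - 1) = Xp powi (- 1) * Z powi a"
    proof -
      have "ev t_poly = S * Z" by (simp add: S_Z)
      moreover have "Xp powi (- 1) = S" using S_pow_powi[of 1] by simp
      ultimately show ?thesis unfolding Z_powi_step[of a] by (simp only: mult.assoc)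
    qed
    then have "act V (adjoint V) (ev t_poly) u (vacuum V)
        = Sum_any (\<lambda>i::nat. vscale V (of_int a gchoose i) (mode (adjoint V) u (- 1 + int i) (vacuum V)))"
      unfolding weak_module.act_homogeneous[OF adj homogeneous]
      by (simp only: weak_module.res_binomial_series[OF adj] mscale_adjoint)
    also have "\<dots> = Sum_any (\<lambda>i::nat. if i = 0 then u else 0)"
    proof (rule Sum_any.cong)
      fix i :: nat
      show "vscale V (of_int a gchoose i) (mode (adjoint V) u (- 1 + int i) (vacuum V)) = (if i = 0 then u else 0)"
        by (cases i) (simp_all add: V.creation_property)
    qed
    finally show ?case by simp
  next
    case (add u v)
    then show ?case by (simp only: weak_module.act_add_left[OF adj])
  qed
  have "act V (adjoint V) (ev (euler H)) u (vacuum V) = - L_op_V (act V (adjoint V) (ev H) u (vacuum V))"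
    using weak_module.L_op_act[OF adj, of "ev H" u "vacuum V"]
    unfolding L1 weak_module.act_0[OF adj] ev_euler by simp
  then have "act V (adjoint V) (ev (left_poly n)) u (vacuum V) - u = - L_op_V (act V (adjoint V) (ev H) u (vacuum V))"
    unfolding H ev_add weak_module.act_add[OF adj] t by simp
  also have "\<dots> \<in> O_alg V n"
    unfolding O_alg_eq_O_mod
    by (rule V.subspace_neg[OF weak_module.O_mod_subspace[OF adj, unfolded mscale_adjoint] weak_module.L_op_in_O_mod[OF adj]])
  finally show ?thesis .
qed

end

section \<open>Quotients by cosets\<close>

definition add_subgroup :: "'b::ab_group_add set \<Rightarrow> bool"
  where "add_subgroup U \<longleftrightarrow> 0 \<in> U \<and> (\<forall>x\<in>U. \<forall>y\<in>U. x - y \<in> U)"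

lemma add_subgroup_closed:
  assumes "add_subgroup U" "x \<in> U"
  shows "- x \<in> U" "y \<in> U \<Longrightarrow> x + y \<in> U"
proof -
  have diff: "\<And>x y. x \<in> U \<Longrightarrow> y \<in> U \<Longrightarrow> x - y \<in> U" and zero: "0 \<in> U"
    using assms(1) by (auto simp: add_subgroup_def)
  have neg: "- y \<in> U" if "y \<in> U" for y using diff[OF zero that] by simp
  show "- x \<in> U" by (rule neg[OF assms(2)])
  show "x + y \<in> U" if "y \<in> U" using diff[OF assms(2) neg[OF that]] by simp
qed

lemma coset_eqI:
  assumes U: "add_subgroup U" and ab: "a - b \<in> U"
  shows "a +o U = b +o U"
proof -
  have sub: "x +o U \<subseteq> y +o U" if "x - y \<in> U" for x y
  proof
    fix z
    assume "z \<in> x +o U"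
    then have "z - x \<in> U" by (rule set_plus_imp_minus)
    from add_subgroup_closed(2)[OF U this that] show "z \<in> y +o U"
      by (intro set_minus_imp_plus) simp
  qed
  have "b - a \<in> U" using add_subgroup_closed(1)[OF U ab] by simp
  with ab show ?thesis by (intro equalityI sub)
qed

lemma coset_plus:
  assumes "add_subgroup U"
  shows "(a +o U) + (b +o U) = (a + b) +o U"
proof -
  have "U + U = U"
  proof
    show "U + U \<subseteq> U" using add_subgroup_closed(2)[OF assms] by (auto simp: set_plus_def)
    show "U \<subseteq> U + U" using assms by (intro set_zero_plus2) (simp add: add_subgroup_def)
  qed
  then show ?thesis by (simp add: set_plus_rearrange)
qed

lemma self_in_coset: "add_subgroup U \<Longrightarrow> a \<in> a +o U"
  using set_plus_intro2[of 0 U a] by (simp add: add_subgroup_def)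

lemma UN_coset:
  assumes "add_subgroup U" "\<And>x. x \<in> a +o U \<Longrightarrow> f x = c"
  shows "(\<Union>x\<in>a +o U. f x) = c"
  using self_in_coset[OF assms(1)] assms(2) by blast

lemma complex_ring_simps:
  "carrier complex_ring = UNIV" "c \<otimes>\<^bsub>complex_ring\<^esub> d = c * d" "\<one>\<^bsub>complex_ring\<^esub> = 1"
  "\<zero>\<^bsub>complex_ring\<^esub> = 0" "c \<oplus>\<^bsub>complex_ring\<^esub> d = c + d"
  by (simp_all add: ring_of_type_algebra_def)

context weak_module
begin

lemma subspace_add_subgroup: "W.subspace U \<Longrightarrow> add_subgroup U"
  using W.subspace_0 W.subspace_diff by (auto simp: add_subgroup_def)

lemma quotient_module:
  fixes M :: "(complex, 'w set, 'q) module_scheme"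
  assumes U: "W.subspace U"
    and carrier: "carrier M = range (\<lambda>w. w +o U)"
    and zero: "\<zero>\<^bsub>M\<^esub> = U"
    and add: "\<And>P Q. P \<oplus>\<^bsub>M\<^esub> Q = P + Q"
    and smult: "\<And>c w. c \<odot>\<^bsub>M\<^esub> (w +o U) = mscale W c w +o U"
  shows "Module.module complex_ring M"
proof -
  have plus: "(a +o U) + (b +o U) = (a + b) +o U" for a b
    by (rule coset_plus[OF subspace_add_subgroup[OF U]])
  have U_coset: "U = 0 +o U" by simp
  have el: "\<exists>w. x = w +o U" if "x \<in> carrier M" for x
    using that carrier by auto
  have mem: "w +o U \<in> carrier M" for w
    using carrier by auto
  show ?thesis
  proof (rule moduleI)
    show "cring complex_ring"
      by (rule cring_from_type_algebra)
    show "abelian_group M"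
    proof (rule abelian_groupI)
      show "\<zero>\<^bsub>M\<^esub> \<in> carrier M" unfolding zero by (subst U_coset) (rule mem)
    next
      fix x y
      assume "x \<in> carrier M" "y \<in> carrier M"
      then show "x \<oplus>\<^bsub>M\<^esub> y \<in> carrier M" "x \<oplus>\<^bsub>M\<^esub> y = y \<oplus>\<^bsub>M\<^esub> x"
        using mem by (auto dest!: el simp: add plus add.commute)
    next
      fix x y z
      show "x \<oplus>\<^bsub>M\<^esub> y \<oplus>\<^bsub>M\<^esub> z = x \<oplus>\<^bsub>M\<^esub> (y \<oplus>\<^bsub>M\<^esub> z)"
        unfolding add by (rule add.assoc)
    next
      fix x
      assume "x \<in> carrier M"
      then obtain a where x: "x = a +o U" using el by blast
      have "U + (a +o U) = a +o U" using plus[of 0 a] by simp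
      then show "\<zero>\<^bsub>M\<^esub> \<oplus>\<^bsub>M\<^esub> x = x" by (simp add: x zero add)
      show "\<exists>y\<in>carrier M. y \<oplus>\<^bsub>M\<^esub> x = \<zero>\<^bsub>M\<^esub>"
        by (rule bexI[OF _ mem[of "- a"]]) (simp add: x zero add plus)
    qed
  next
    fix c d :: complex and x y
    assume "x \<in> carrier M" "y \<in> carrier M"
    then obtain a b where x: "x = a +o U" and y: "y = b +o U" using el by blast
    show "c \<odot>\<^bsub>M\<^esub> (x \<oplus>\<^bsub>M\<^esub> y) = c \<odot>\<^bsub>M\<^esub> x \<oplus>\<^bsub>M\<^esub> c \<odot>\<^bsub>M\<^esub> y"
      unfolding x y add plus smult by (simp only: W.scale_right_distrib)
  next
    fix c d :: complex and x
    assume "x \<in> carrier M"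
    then obtain a where x: "x = a +o U" using el by blast
    show "c \<odot>\<^bsub>M\<^esub> x \<in> carrier M" unfolding x smult by (rule mem)
    show "(c \<oplus>\<^bsub>complex_ring\<^esub> d) \<odot>\<^bsub>M\<^esub> x = c \<odot>\<^bsub>M\<^esub> x \<oplus>\<^bsub>M\<^esub> d \<odot>\<^bsub>M\<^esub> x"
      unfolding x add plus smult complex_ring_simps by (simp only: W.scale_left_distrib)
    show "(c \<otimes>\<^bsub>complex_ring\<^esub> d) \<odot>\<^bsub>M\<^esub> x = c \<odot>\<^bsub>M\<^esub> (d \<odot>\<^bsub>M\<^esub> x)"
      unfolding x add plus smult complex_ring_simps by (simp only: W.scale_scale)
    show "\<one>\<^bsub>complex_ring\<^esub> \<odot>\<^bsub>M\<^esub> x = x"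
      unfolding x smult complex_ring_simps by (simp only: W.scale_one)
  qed
qed

text \<open>
  Subspaces \<open>U\<close> of \<open>W\<close> for which \<open>W/U\<close> inherits the bimodule structure, so that \<open>A'\<^sub>n(W)\<close>, \<open>A\<^sub>n(W)\<close> and
  the product of \<open>A\<^sub>n(V)\<close> are treated at once
\<close>

definition stable_subspace :: "nat \<Rightarrow> 'w set \<Rightarrow> bool"
  where "stable_subspace n U \<longleftrightarrow> W.subspace U \<and> O' V W n \<subseteq> U
    \<and> (\<forall>v. \<forall>x\<in>U. left_mult V W n v x \<in> U \<and> right_mult V W n x v \<in> U)"

lemma stable_O': "stable_subspace n (O' V W n)"
  by (simp add: stable_subspace_def O'_subspace left_mult_eq right_mult_eq act_O')

lemma stable_O_mod: "stable_subspace n (O_mod V W n)"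
  by (simp add: stable_subspace_def O_mod_subspace O'_subset_O_mod left_mult_eq right_mult_eq act_O_mod
      ideal_dvd_euler_left_poly ideal_dvd_euler_right_poly)

lemma mult_linear:
  "left_mult V W n (u + v) w = left_mult V W n u w + left_mult V W n v w"
  "left_mult V W n v (w + w') = left_mult V W n v w + left_mult V W n v w'"
  "left_mult V W n (vscale V c v) w = mscale W c (left_mult V W n v w)"
  "left_mult V W n v (mscale W c w) = mscale W c (left_mult V W n v w)"
  "right_mult V W n w (u + v) = right_mult V W n w u + right_mult V W n w v"
  "right_mult V W n (w + w') v = right_mult V W n w v + right_mult V W n w' v"
  "right_mult V W n w (vscale V c v) = mscale W c (right_mult V W n w v)"
  "right_mult V W n (mscale W c w) v = mscale W c (right_mult V W n w v)"
  by (simp_all only: left_mult_eq right_mult_eq act_add_left act_add_right act_scale_left act_scale_right)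

lemma O_alg_subspace: "V.subspace (O_alg V n)"
  unfolding O_alg_def by (rule V.subspace_span)

lemma O_alg_add_subgroup: "add_subgroup (O_alg V n)"
  using V.subspace_0[OF O_alg_subspace] V.subspace_diff[OF O_alg_subspace] by (simp add: add_subgroup_def)

lemma mult_O_alg:
  assumes "x \<in> O_alg V n"
  shows "left_mult V W n x w \<in> O' V W n" "right_mult V W n w x \<in> O' V W n"
  unfolding left_mult_eq right_mult_eq
  by (rule act_O_alg[OF assms ideal_dvd_euler_left_poly] act_O_alg[OF assms ideal_dvd_euler_right_poly])+

context
  fixes n :: nat and U :: "'w set"
  assumes stable: "stable_subspace n U"
begin

lemma subspace_U: "W.subspace U" and O'_subset_U: "O' V W n \<subseteq> U"
  and left_mult_U: "x \<in> U \<Longrightarrow> left_mult V W n v x \<in> U" and right_mult_U: "x \<in> U \<Longrightarrow> right_mult V W n x v \<in> U"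
  using stable by (simp_all add: stable_subspace_def)

lemmas add_subgroup_U = subspace_add_subgroup[OF subspace_U]

lemma coset_eq_mod_O': "a - b \<in> O' V W n \<Longrightarrow> a +o U = b +o U"
  using O'_subset_U by (intro coset_eqI[OF add_subgroup_U]) blast

lemma quotient_smult: "c \<odot>\<^bsub>quotient_structure V W n U\<^esub> (w +o U) = mscale W c w +o U"
  unfolding quotient_structure_def module.simps
proof (rule UN_coset[OF add_subgroup_U])
  fix x
  assume "x \<in> w +o U"
  then have "mscale W c (x - w) \<in> U"
    by (intro W.subspace_scale[OF subspace_U] set_plus_imp_minus)
  then show "mscale W c x +o U = mscale W c w +o U"
    by (intro coset_eqI[OF add_subgroup_U]) (simp only: W.scale_right_diff_distrib)
qed

lemma quotient_lact: "lact (quotient_structure V W n U) (v +o O_alg V n) (w +o U) = left_mult V W n v w +o U"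
  unfolding quotient_structure_def bimodule.simps
proof (rule UN_coset[OF O_alg_add_subgroup], rule UN_coset[OF add_subgroup_U])
  fix v' w'
  assume v': "v' \<in> v +o O_alg V n" and w': "w' \<in> w +o U"
  have "left_mult V W n v' w' = left_mult V W n v w + (left_mult V W n (v' - v) w' + left_mult V W n v (w' - w))"
    using mult_linear(1)[of n v "v' - v" w'] mult_linear(2)[of n v w "w' - w"] by simp
  moreover have "left_mult V W n (v' - v) w' \<in> U"
    using mult_O_alg(1)[OF set_plus_imp_minus[OF v']] O'_subset_U by blast
  moreover have "left_mult V W n v (w' - w) \<in> U"
    by (rule left_mult_U[OF set_plus_imp_minus[OF w']])
  ultimately show "left_mult V W n v' w' +o U = left_mult V W n v w +o U"
    by (intro coset_eqI[OF add_subgroup_U]) (simp add: add_subgroup_closed(2)[OF add_subgroup_U])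
qed

lemma quotient_ract: "ract (quotient_structure V W n U) (w +o U) (v +o O_alg V n) = right_mult V W n w v +o U"
  unfolding quotient_structure_def bimodule.simps
proof (rule UN_coset[OF add_subgroup_U], rule UN_coset[OF O_alg_add_subgroup])
  fix v' w'
  assume v': "v' \<in> v +o O_alg V n" and w': "w' \<in> w +o U"
  have "right_mult V W n w' v' = right_mult V W n w v + (right_mult V W n w' (v' - v) + right_mult V W n (w' - w) v)"
    using mult_linear(5)[of n w' v "v' - v"] mult_linear(6)[of n w "w' - w" v] by simp
  moreover have "right_mult V W n w' (v' - v) \<in> U"
    using mult_O_alg(2)[OF set_plus_imp_minus[OF v']] O'_subset_U by blast
  moreover have "right_mult V W n (w' - w) v \<in> U"
    by (rule right_mult_U[OF set_plus_imp_minus[OF w']])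
  ultimately show "right_mult V W n w' v' +o U = right_mult V W n w v +o U"
    by (intro coset_eqI[OF add_subgroup_U]) (simp add: add_subgroup_closed(2)[OF add_subgroup_U])
qed

lemma quotient_carrier: "carrier (quotient_structure V W n U) = range (\<lambda>w. w +o U)"
  and quotient_zero: "\<zero>\<^bsub>quotient_structure V W n U\<^esub> = U"
  and quotient_add: "P \<oplus>\<^bsub>quotient_structure V W n U\<^esub> Q = P + Q"
  by (simp_all add: quotient_structure_def)

lemma quotient_structure_module: "Module.module complex_ring (quotient_structure V W n U)"
  by (rule quotient_module[OF subspace_U quotient_carrier quotient_zero quotient_add quotient_smult])

lemma quotient_left_assoc:
  "left_mult V W n (left_mult V (adjoint V) n u v) w +o U = left_mult V W n u (left_mult V W n v w) +o U"
  unfolding left_mult_eq weak_module.left_mult_eq[OF V.adjoint_weak_module]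
  by (rule coset_eq_mod_O'[OF left_associative])

lemma quotient_right_assoc:
  "right_mult V W n w (left_mult V (adjoint V) n u v) +o U = right_mult V W n (right_mult V W n w u) v +o U"
  unfolding left_mult_eq right_mult_eq weak_module.left_mult_eq[OF V.adjoint_weak_module]
  by (rule coset_eq_mod_O'[OF right_associative])

lemma quotient_left_right:
  "right_mult V W n (left_mult V W n u w) v +o U = left_mult V W n u (right_mult V W n w v) +o U"
  unfolding left_mult_eq right_mult_eq
  by (rule coset_eq_mod_O'[OF left_right_commute, symmetric])

end

end

section \<open>The bimodules \<open>A'\<^sub>n(W)\<close> and \<open>A\<^sub>n(W)\<close>\<close>

context weak_module
begin

lemma stable_O_alg: "weak_module.stable_subspace V (adjoint V) n (O_alg V n)"
  unfolding O_alg_eq_O_mod by (rule weak_module.stable_O_mod[OF V.adjoint_weak_module])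

lemma Zhu_carrier: "carrier (Zhu_algebra V n) = range (\<lambda>v. v +o O_alg V n)"
  and Zhu_zero: "\<zero>\<^bsub>Zhu_algebra V n\<^esub> = O_alg V n"
  and Zhu_one: "\<one>\<^bsub>Zhu_algebra V n\<^esub> = vacuum V +o O_alg V n"
  and Zhu_add: "P \<oplus>\<^bsub>Zhu_algebra V n\<^esub> Q = P + Q"
  by (simp_all add: Zhu_algebra_def)

lemma Zhu_smult: "c \<odot>\<^bsub>Zhu_algebra V n\<^esub> (v +o O_alg V n) = vscale V c v +o O_alg V n"
  using weak_module.quotient_smult[OF V.adjoint_weak_module stable_O_alg, where c = c and w = v]
  by (simp add: Zhu_algebra_def quotient_structure_def)

lemma Zhu_mult: "(u +o O_alg V n) \<otimes>\<^bsub>Zhu_algebra V n\<^esub> (v +o O_alg V n)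
    = left_mult V (adjoint V) n u v +o O_alg V n"
  using weak_module.quotient_lact[OF V.adjoint_weak_module stable_O_alg, where v = u and w = v]
  by (simp add: Zhu_algebra_def quotient_structure_def)

lemma Zhu_plus: "(u +o O_alg V n) + (v +o O_alg V n) = (u + v) +o O_alg V n"
  by (rule coset_plus[OF O_alg_add_subgroup])

lemma Zhu_module: "Module.module complex_ring (Zhu_algebra V n)"
  by (rule weak_module.quotient_module[OF V.adjoint_weak_module, unfolded mscale_adjoint,
      OF O_alg_subspace Zhu_carrier Zhu_zero Zhu_add Zhu_smult])

lemmas adj_mult_linear = weak_module.mult_linear[OF V.adjoint_weak_module, unfolded mscale_adjoint]

lemma Zhu_elem: "x \<in> carrier (Zhu_algebra V n) \<Longrightarrow> \<exists>v. x = v +o O_alg V n"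
  by (auto simp: Zhu_carrier)

lemma Zhu_mem: "v +o O_alg V n \<in> carrier (Zhu_algebra V n)"
  by (simp add: Zhu_carrier)

theorem Zhu_assoc_algebra: "assoc_algebra complex_ring (Zhu_algebra V n)"
proof (intro assoc_algebra.intro assoc_algebra_axioms.intro)
  show "Module.module complex_ring (Zhu_algebra V n)" by (rule Zhu_module)
  show "ring (Zhu_algebra V n)"
  proof (rule ringI)
    show "abelian_group (Zhu_algebra V n)"
      using Zhu_module by (rule Module.module.axioms)
    show "monoid (Zhu_algebra V n)"
    proof (rule monoidI)
      show "\<one>\<^bsub>Zhu_algebra V n\<^esub> \<in> carrier (Zhu_algebra V n)"
        unfolding Zhu_one by (rule Zhu_mem)
    next
      fix x y
      assume "x \<in> carrier (Zhu_algebra V n)" "y \<in> carrier (Zhu_algebra V n)"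
      then obtain u v where "x = u +o O_alg V n" "y = v +o O_alg V n" using Zhu_elem by blast
      then show "x \<otimes>\<^bsub>Zhu_algebra V n\<^esub> y \<in> carrier (Zhu_algebra V n)"
        by (simp only: Zhu_mult Zhu_mem)
    next
      fix x y z
      assume "x \<in> carrier (Zhu_algebra V n)" "y \<in> carrier (Zhu_algebra V n)" "z \<in> carrier (Zhu_algebra V n)"
      then obtain u v w where "x = u +o O_alg V n" "y = v +o O_alg V n" "z = w +o O_alg V n" using Zhu_elem by meson
      then show "x \<otimes>\<^bsub>Zhu_algebra V n\<^esub> y \<otimes>\<^bsub>Zhu_algebra V n\<^esub> z
          = x \<otimes>\<^bsub>Zhu_algebra V n\<^esub> (y \<otimes>\<^bsub>Zhu_algebra V n\<^esub> z)"
        by (simp only: Zhu_mult weak_module.quotient_left_assoc[OF V.adjoint_weak_module stable_O_alg])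
    next
      fix x
      assume "x \<in> carrier (Zhu_algebra V n)"
      then obtain u where x: "x = u +o O_alg V n" using Zhu_elem by blast
      show "\<one>\<^bsub>Zhu_algebra V n\<^esub> \<otimes>\<^bsub>Zhu_algebra V n\<^esub> x = x"
        unfolding x Zhu_one Zhu_mult weak_module.left_mult_eq[OF V.adjoint_weak_module]
          weak_module.act_left_vacuum[OF V.adjoint_weak_module] ..
      show "x \<otimes>\<^bsub>Zhu_algebra V n\<^esub> \<one>\<^bsub>Zhu_algebra V n\<^esub> = x"
        unfolding x Zhu_one Zhu_mult weak_module.left_mult_eq[OF V.adjoint_weak_module]
        by (rule coset_eqI[OF O_alg_add_subgroup right_unit])
    qed
  next
    fix x y z
    assume "x \<in> carrier (Zhu_algebra V n)" "y \<in> carrier (Zhu_algebra V n)" "z \<in> carrier (Zhu_algebra V n)"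
    then obtain u v w where x: "x = u +o O_alg V n" "y = v +o O_alg V n" "z = w +o O_alg V n" using Zhu_elem by meson
    show "(x \<oplus>\<^bsub>Zhu_algebra V n\<^esub> y) \<otimes>\<^bsub>Zhu_algebra V n\<^esub> z
        = x \<otimes>\<^bsub>Zhu_algebra V n\<^esub> z \<oplus>\<^bsub>Zhu_algebra V n\<^esub> y \<otimes>\<^bsub>Zhu_algebra V n\<^esub> z"
      "z \<otimes>\<^bsub>Zhu_algebra V n\<^esub> (x \<oplus>\<^bsub>Zhu_algebra V n\<^esub> y)
        = z \<otimes>\<^bsub>Zhu_algebra V n\<^esub> x \<oplus>\<^bsub>Zhu_algebra V n\<^esub> z \<otimes>\<^bsub>Zhu_algebra V n\<^esub> y"
      by (simp_all only: x Zhu_add Zhu_plus Zhu_mult adj_mult_linear)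
  qed
next
  fix c :: complex and x y
  assume "x \<in> carrier (Zhu_algebra V n)" "y \<in> carrier (Zhu_algebra V n)"
  then obtain u v where x: "x = u +o O_alg V n" "y = v +o O_alg V n" using Zhu_elem by meson
  show "(c \<odot>\<^bsub>Zhu_algebra V n\<^esub> x) \<otimes>\<^bsub>Zhu_algebra V n\<^esub> y = c \<odot>\<^bsub>Zhu_algebra V n\<^esub> (x \<otimes>\<^bsub>Zhu_algebra V n\<^esub> y)"
    "x \<otimes>\<^bsub>Zhu_algebra V n\<^esub> (c \<odot>\<^bsub>Zhu_algebra V n\<^esub> y) = c \<odot>\<^bsub>Zhu_algebra V n\<^esub> (x \<otimes>\<^bsub>Zhu_algebra V n\<^esub> y)"
    by (simp_all only: x Zhu_smult Zhu_mult adj_mult_linear)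
qed

theorem quotient_bimodule:
  assumes stable: "stable_subspace n U"
  shows "bimodule complex_ring (Zhu_algebra V n) (quotient_structure V W n U)"
    (is "bimodule _ ?A ?M")
proof -
  note ops = quotient_smult[OF stable] quotient_lact[OF stable] quotient_ract[OF stable] quotient_add[OF stable]
    coset_plus[OF add_subgroup_U[OF stable]] Zhu_add Zhu_plus Zhu_smult Zhu_mult Zhu_one mult_linear
  have el: "\<exists>w. x = w +o U" if "x \<in> carrier ?M" for x
    using that by (auto simp: quotient_carrier[OF stable])
  have mem: "w +o U \<in> carrier ?M" for w
    by (simp add: quotient_carrier[OF stable])
  show ?thesis
  proof (intro bimodule.intro bimodule_axioms.intro)
    show "assoc_algebra complex_ring ?A" by (rule Zhu_assoc_algebra)
    show "Module.module complex_ring ?M" by (rule quotient_structure_module[OF stable])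
  next
    fix a x
    assume "a \<in> carrier ?A" "x \<in> carrier ?M"
    then obtain u w where "a = u +o O_alg V n" "x = w +o U" using Zhu_elem el by meson
    then show "lact ?M a x \<in> carrier ?M" "ract ?M x a \<in> carrier ?M"
      by (simp_all only: ops mem)
  next
    fix a b x
    assume "a \<in> carrier ?A" "b \<in> carrier ?A" "x \<in> carrier ?M"
    then obtain u v w where e: "a = u +o O_alg V n" "b = v +o O_alg V n" "x = w +o U" using Zhu_elem el by meson
    show "lact ?M (a \<oplus>\<^bsub>?A\<^esub> b) x = lact ?M a x \<oplus>\<^bsub>?M\<^esub> lact ?M b x"
      "ract ?M x (a \<oplus>\<^bsub>?A\<^esub> b) = ract ?M x a \<oplus>\<^bsub>?M\<^esub> ract ?M x b"
      by (simp_all only: e ops)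
    show "lact ?M (a \<otimes>\<^bsub>?A\<^esub> b) x = lact ?M a (lact ?M b x)"
      by (simp only: e ops quotient_left_assoc[OF stable])
    show "ract ?M x (a \<otimes>\<^bsub>?A\<^esub> b) = ract ?M (ract ?M x a) b"
      by (simp only: e ops quotient_right_assoc[OF stable])
    show "ract ?M (lact ?M a x) b = lact ?M a (ract ?M x b)"
      by (simp only: e ops quotient_left_right[OF stable])
  next
    fix a x y
    assume "a \<in> carrier ?A" "x \<in> carrier ?M" "y \<in> carrier ?M"
    then obtain u w w' where e: "a = u +o O_alg V n" "x = w +o U" "y = w' +o U" using Zhu_elem el by meson
    show "lact ?M a (x \<oplus>\<^bsub>?M\<^esub> y) = lact ?M a x \<oplus>\<^bsub>?M\<^esub> lact ?M a y"
      "ract ?M (x \<oplus>\<^bsub>?M\<^esub> y) a = ract ?M x a \<oplus>\<^bsub>?M\<^esub> ract ?M y a"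
      by (simp_all only: e ops)
  next
    fix c :: complex and a x
    assume "a \<in> carrier ?A" "x \<in> carrier ?M"
    then obtain u w where e: "a = u +o O_alg V n" "x = w +o U" using Zhu_elem el by meson
    show "lact ?M (c \<odot>\<^bsub>?A\<^esub> a) x = c \<odot>\<^bsub>?M\<^esub> lact ?M a x" "lact ?M a (c \<odot>\<^bsub>?M\<^esub> x) = c \<odot>\<^bsub>?M\<^esub> lact ?M a x"
      "ract ?M (c \<odot>\<^bsub>?M\<^esub> x) a = c \<odot>\<^bsub>?M\<^esub> ract ?M x a" "ract ?M x (c \<odot>\<^bsub>?A\<^esub> a) = c \<odot>\<^bsub>?M\<^esub> ract ?M x a"
      by (simp_all only: e ops)
  next
    fix x
    assume "x \<in> carrier ?M"
    then obtain w where e: "x = w +o U" using el by meson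
    show "lact ?M \<one>\<^bsub>?A\<^esub> x = x"
      by (simp only: e ops left_mult_eq act_left_vacuum)
    show "ract ?M x \<one>\<^bsub>?A\<^esub> = x"
      by (simp only: e ops right_mult_eq act_right_vacuum)
  qed
qed

lemma A'_bimodule: "bimodule complex_ring (Zhu_algebra V n) (A'_mod V W n)"
  unfolding A'_mod_def by (rule quotient_bimodule[OF stable_O'])

lemma A_bimodule: "bimodule complex_ring (Zhu_algebra V n) (A_mod V W n)"
  unfolding A_mod_def by (rule quotient_bimodule[OF stable_O_mod])

lemmas A'_ops = quotient_smult[OF stable_O', folded A'_mod_def] quotient_lact[OF stable_O', folded A'_mod_def]
  quotient_ract[OF stable_O', folded A'_mod_def] quotient_add[OF stable_O', folded A'_mod_def]
  coset_plus[OF add_subgroup_U[OF stable_O']]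

lemmas A_ops = quotient_smult[OF stable_O_mod, folded A_mod_def] quotient_lact[OF stable_O_mod, folded A_mod_def]
  quotient_ract[OF stable_O_mod, folded A_mod_def] quotient_add[OF stable_O_mod, folded A_mod_def]
  coset_plus[OF add_subgroup_U[OF stable_O_mod]]

lemma O_mod_image_sub_bimodule:
  "sub_bimodule complex_ring (Zhu_algebra V n) (A'_mod V W n) (O_mod_image V W n)"
  unfolding sub_bimodule_def
proof (intro conjI ballI)
  interpret M: Module.module complex_ring "A'_mod V W n"
    using A'_bimodule by (rule bimodule.axioms)
  have im: "w +o O' V W n \<in> O_mod_image V W n" if "w \<in> O_mod V W n" for w
    using that by (simp add: O_mod_image_def)
  have el: "\<exists>w\<in>O_mod V W n. x = w +o O' V W n" if "x \<in> O_mod_image V W n" for x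
    using that by (auto simp: O_mod_image_def)
  have carrier: "carrier (A'_mod V W n) = range (\<lambda>w. w +o O' V W n)"
    unfolding A'_mod_def by (rule quotient_carrier[OF stable_O'])
  have zero: "\<zero>\<^bsub>A'_mod V W n\<^esub> = 0 +o O' V W n"
    unfolding A'_mod_def quotient_zero[OF stable_O'] by simp
  show "submodule (O_mod_image V W n) complex_ring (A'_mod V W n)"
  proof (rule M.submoduleI)
    show "O_mod_image V W n \<subseteq> carrier (A'_mod V W n)"
      unfolding carrier O_mod_image_def by blast
    show "\<zero>\<^bsub>A'_mod V W n\<^esub> \<in> O_mod_image V W n"
      unfolding zero by (rule im[OF W.subspace_0[OF O_mod_subspace]])
  next
    fix x
    assume "x \<in> O_mod_image V W n"
    then obtain w where w: "w \<in> O_mod V W n" "x = w +o O' V W n" using el by blast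
    have "\<ominus>\<^bsub>A'_mod V W n\<^esub> x = (- w) +o O' V W n"
    proof (rule M.minus_equality)
      show "(- w) +o O' V W n \<oplus>\<^bsub>A'_mod V W n\<^esub> x = \<zero>\<^bsub>A'_mod V W n\<^esub>"
        unfolding w(2) zero A'_ops by simp
    qed (auto simp: carrier w(2))
    then show "\<ominus>\<^bsub>A'_mod V W n\<^esub> x \<in> O_mod_image V W n"
      using im[OF W.subspace_neg[OF O_mod_subspace w(1)]] by (simp only:)
  next
    fix x y
    assume "x \<in> O_mod_image V W n" "y \<in> O_mod_image V W n"
    then obtain w w' where w: "w \<in> O_mod V W n" "x = w +o O' V W n" "w' \<in> O_mod V W n" "y = w' +o O' V W n"
      using el by meson
    show "x \<oplus>\<^bsub>A'_mod V W n\<^esub> y \<in> O_mod_image V W n"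
      unfolding w(2,4) A'_ops by (rule im[OF W.subspace_add[OF O_mod_subspace w(1,3)]])
  next
    fix c :: complex and x
    assume "x \<in> O_mod_image V W n"
    then obtain w where w: "w \<in> O_mod V W n" "x = w +o O' V W n" using el by blast
    show "c \<odot>\<^bsub>A'_mod V W n\<^esub> x \<in> O_mod_image V W n"
      unfolding w(2) A'_ops by (rule im[OF W.subspace_scale[OF O_mod_subspace w(1)]])
  qed
  fix a x
  assume "a \<in> carrier (Zhu_algebra V n)" "x \<in> O_mod_image V W n"
  then obtain v w where w: "a = v +o O_alg V n" "w \<in> O_mod V W n" "x = w +o O' V W n"
    using Zhu_elem el by meson
  show "lact (A'_mod V W n) a x \<in> O_mod_image V W n"
    unfolding w(1,3) A'_ops by (rule im[OF left_mult_U[OF stable_O_mod w(2)]])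
  show "ract (A'_mod V W n) x a \<in> O_mod_image V W n"
    unfolding w(1,3) A'_ops by (rule im[OF right_mult_U[OF stable_O_mod w(2)]])
qed

text \<open>
  A coset of \<open>O\<^sub>n(W)\<close> corresponds to the set of cosets of \<open>O'\<^sub>n(W)\<close> that it contains.
\<close>

definition coset_iso :: "nat \<Rightarrow> 'w set \<Rightarrow> 'w set set"
  where "coset_iso n P = (\<lambda>y. y +o O' V W n) ` P"

lemma coset_iso_eq: "coset_iso n (w +o O_mod V W n) = O_mod_image V W n +>\<^bsub>A'_mod V W n\<^esub> (w +o O' V W n)"
proof -
  have "O_mod_image V W n +>\<^bsub>A'_mod V W n\<^esub> (w +o O' V W n) = (\<lambda>x. (x + w) +o O' V W n) ` O_mod V W n"
    unfolding a_r_coset_def' O_mod_image_def using A'_ops(4,5) by auto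
  also have "\<dots> = coset_iso n (w +o O_mod V W n)"
  proof -
    have "w +o O_mod V W n = (\<lambda>x. x + w) ` O_mod V W n"
      by (auto simp: elt_set_plus_def add.commute)
    then show ?thesis unfolding coset_iso_def by (simp only: image_image)
  qed
  finally show ?thesis ..
qed

lemma Union_coset_iso: "\<Union>(coset_iso n (w +o O_mod V W n)) = w +o O_mod V W n"
proof
  show "\<Union>(coset_iso n (w +o O_mod V W n)) \<subseteq> w +o O_mod V W n"
  proof
    fix x
    assume "x \<in> \<Union>(coset_iso n (w +o O_mod V W n))"
    then obtain y where y: "y \<in> w +o O_mod V W n" "x \<in> y +o O' V W n"
      by (auto simp: coset_iso_def)
    have "(x - y) + (y - w) \<in> O_mod V W n"
      using O'_subset_O_mod set_plus_imp_minus[OF y(2)] set_plus_imp_minus[OF y(1)]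
      by (intro W.subspace_add[OF O_mod_subspace]) blast+
    then show "x \<in> w +o O_mod V W n"
      by (intro set_minus_imp_plus) simp
  qed
  show "w +o O_mod V W n \<subseteq> \<Union>(coset_iso n (w +o O_mod V W n))"
    unfolding coset_iso_def using self_in_coset[OF add_subgroup_U[OF stable_O']] by blast
qed

theorem coset_iso_bimodule_iso:
  "coset_iso n \<in> bimodule_iso complex_ring (Zhu_algebra V n)
    (A_mod V W n) (bimodule_quotient (A'_mod V W n) (O_mod_image V W n))"
proof -
  let ?O' = "O' V W n" and ?O = "O_mod V W n" and ?A' = "A'_mod V W n" and ?A = "A_mod V W n"
  let ?Q = "bimodule_quotient ?A' (O_mod_image V W n)" and ?h = "coset_iso n"
  have carrier: "carrier ?A = range (\<lambda>w. w +o ?O)"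
    unfolding A_mod_def by (rule quotient_carrier[OF stable_O_mod])
  have carrier': "carrier ?A' = range (\<lambda>w. w +o ?O')"
    unfolding A'_mod_def by (rule quotient_carrier[OF stable_O'])
  have carrierQ: "carrier ?Q = ?h ` carrier ?A"
    unfolding bimodule_quotient_def carrier
    by (simp only: module.simps partial_object.simps ring.simps monoid.simps A_RCOSETS_def' carrier'
        coset_iso_eq image_image UNION_singleton_eq_range)
  have el: "\<exists>w. x = w +o ?O" if "x \<in> carrier ?A" for x
    using that carrier by auto
  have UN: "(\<Union>P\<in>?h (w +o ?O). f P) = c"
    if "\<And>y. y \<in> w +o ?O \<Longrightarrow> f (y +o ?O') = c" for f :: "'w set \<Rightarrow> 'w set set" and w c
    unfolding coset_iso_def image_image
  proof (rule SUP_eq_const)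
    show "w +o ?O \<noteq> {}" using self_in_coset[OF add_subgroup_U[OF stable_O_mod], of w] by blast
  qed (rule that)
  have coset: "y +o ?O = w +o ?O" if "y \<in> w +o ?O" for y w
    by (rule coset_eqI[OF add_subgroup_U[OF stable_O_mod] set_plus_imp_minus[OF that]])
  have bij: "bij_betw ?h (carrier ?A) (carrier ?Q)"
  proof (rule bij_betw_imageI)
    show "inj_on ?h (carrier ?A)"
    proof (rule inj_on_inverseI)
      show "\<Union>(?h x) = x" if "x \<in> carrier ?A" for x
        using el[OF that] Union_coset_iso by auto
    qed
  qed (simp add: carrierQ)
  have h_add: "?h (x \<oplus>\<^bsub>?A\<^esub> y) = ?h x \<oplus>\<^bsub>?Q\<^esub> ?h y" for x y
  proof -
    have add: "x \<oplus>\<^bsub>?A\<^esub> y = x + y" by (rule A_ops)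
    have "?h x \<oplus>\<^bsub>?Q\<^esub> ?h y = (\<Union>P\<in>?h x. \<Union>Q\<in>?h y. {P + Q})"
      unfolding bimodule_quotient_def by (simp add: set_add_def' A'_ops(4))
    also have "\<dots> = (\<Union>a\<in>x. \<Union>b\<in>y. {(a + b) +o ?O'})"
      unfolding coset_iso_def by (simp add: A'_ops(5))
    also have "\<dots> = ?h (x + y)"
      by (auto simp: coset_iso_def set_plus_def)
    finally show ?thesis unfolding add ..
  qed
  have h_smult: "?h (c \<odot>\<^bsub>?A\<^esub> x) = c \<odot>\<^bsub>?Q\<^esub> ?h x" if x: "x \<in> carrier ?A" for c x
  proof -
    obtain w where w: "x = w +o ?O" using el[OF x] by blast
    have "c \<odot>\<^bsub>?Q\<^esub> ?h x = (\<Union>P\<in>?h x. O_mod_image V W n +>\<^bsub>?A'\<^esub> (c \<odot>\<^bsub>?A'\<^esub> P))"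
      by (simp add: bimodule_quotient_def)
    also have "\<dots> = ?h (c \<odot>\<^bsub>?A\<^esub> x)"
      unfolding w
    proof (rule UN)
      fix y
      assume "y \<in> w +o ?O"
      note eq = coset[OF this, symmetric]
      show "O_mod_image V W n +>\<^bsub>?A'\<^esub> (c \<odot>\<^bsub>?A'\<^esub> (y +o ?O')) = ?h (c \<odot>\<^bsub>?A\<^esub> (w +o ?O))"
        unfolding eq A'_ops(1) A_ops(1) coset_iso_eq ..
    qed
    finally show ?thesis ..
  qed
  have h_act: "?h (lact ?A a x) = lact ?Q a (?h x) \<and> ?h (ract ?A x a) = ract ?Q (?h x) a"
    if a: "a \<in> carrier (Zhu_algebra V n)" and x: "x \<in> carrier ?A" for a x
  proof -
    obtain w where w: "x = w +o ?O" using el[OF x] by blast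
    obtain v where v: "a = v +o O_alg V n" using Zhu_elem[OF a] by blast
    have "lact ?Q a (?h x) = (\<Union>P\<in>?h x. O_mod_image V W n +>\<^bsub>?A'\<^esub> lact ?A' a P)"
      by (simp add: bimodule_quotient_def)
    also have "\<dots> = ?h (lact ?A a x)"
      unfolding w v
    proof (rule UN)
      fix y
      assume "y \<in> w +o ?O"
      note eq = coset[OF this, symmetric]
      show "O_mod_image V W n +>\<^bsub>?A'\<^esub> lact ?A' (v +o O_alg V n) (y +o ?O')
          = ?h (lact ?A (v +o O_alg V n) (w +o ?O))"
        unfolding eq A'_ops(2) A_ops(2) coset_iso_eq ..
    qed
    finally have l: "lact ?Q a (?h x) = ?h (lact ?A a x)" .
    have "ract ?Q (?h x) a = (\<Union>P\<in>?h x. O_mod_image V W n +>\<^bsub>?A'\<^esub> ract ?A' P a)"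
      by (simp add: bimodule_quotient_def)
    also have "\<dots> = ?h (ract ?A x a)"
      unfolding w v
    proof (rule UN)
      fix y
      assume "y \<in> w +o ?O"
      note eq = coset[OF this, symmetric]
      show "O_mod_image V W n +>\<^bsub>?A'\<^esub> ract ?A' (y +o ?O') (v +o O_alg V n)
          = ?h (ract ?A (w +o ?O) (v +o O_alg V n))"
        unfolding eq A'_ops(3) A_ops(3) coset_iso_eq ..
    qed
    finally show ?thesis using l by simp
  qed
  show ?thesis
    unfolding bimodule_iso_def
  proof (intro CollectI conjI ballI)
    show "bij_betw ?h (carrier ?A) (carrier ?Q)" by (rule bij)
    show "?h (x \<oplus>\<^bsub>?A\<^esub> y) = ?h x \<oplus>\<^bsub>?Q\<^esub> ?h y" for x y by (rule h_add)
    show "?h (c \<odot>\<^bsub>?A\<^esub> x) = c \<odot>\<^bsub>?Q\<^esub> ?h x" if "x \<in> carrier ?A" for c x using that by (rule h_smult)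
    show "?h (lact ?A a x) = lact ?Q a (?h x)" if "a \<in> carrier (Zhu_algebra V n)" "x \<in> carrier ?A" for a x
      using h_act[OF that] by (rule conjunct1)
    show "?h (ract ?A x a) = ract ?Q (?h x) a" if "a \<in> carrier (Zhu_algebra V n)" "x \<in> carrier ?A" for a x
      using h_act[OF that] by (rule conjunct2)
  qed
qed

end

theorem corollary3p17:
  fixes V :: "('v::ab_group_add) vertex_data"
    and W :: "('v, 'w::ab_group_add) module_data"
    and n :: nat
  assumes "vertex_operator_algebra V" and "weak_module V W"
  shows "(\<forall>v. \<forall>w \<in> O_mod V W n.
            left_mult V W n v w \<in> O_mod V W n \<and> right_mult V W n w v \<in> O_mod V W n)
    \<and> bimodule complex_ring (Zhu_algebra V n) (A'_mod V W n)
    \<and> sub_bimodule complex_ring (Zhu_algebra V n) (A'_mod V W n) (O_mod_image V W n)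
    \<and> bimodule complex_ring (Zhu_algebra V n) (A_mod V W n)
    \<and> (\<exists>h \<in> bimodule_iso complex_ring (Zhu_algebra V n)
              (A_mod V W n) (bimodule_quotient (A'_mod V W n) (O_mod_image V W n)).
          \<forall>w. h (w +o O_mod V W n) = O_mod_image V W n +>\<^bsub>A'_mod V W n\<^esub> (w +o O' V W n))"
proof -
  interpret weak_module V W by (rule assms(2))
  show ?thesis
  proof (intro conjI)
    show "\<forall>v. \<forall>w \<in> O_mod V W n. left_mult V W n v w \<in> O_mod V W n \<and> right_mult V W n w v \<in> O_mod V W n"
      using stable_O_mod[of n] unfolding stable_subspace_def by (elim conjE)
  next
    show "\<exists>h \<in> bimodule_iso complex_ring (Zhu_algebra V n)
              (A_mod V W n) (bimodule_quotient (A'_mod V W n) (O_mod_image V W n)).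
          \<forall>w. h (w +o O_mod V W n) = O_mod_image V W n +>\<^bsub>A'_mod V W n\<^esub> (w +o O' V W n)"
      using coset_iso_bimodule_iso by (rule bexI[rotated]) (simp add: coset_iso_eq)
  qed (rule A'_bimodule O_mod_image_sub_bimodule A_bimodule)+
qed

end
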